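(* Let $I$ be an interval and let $\ell_1,\ell_2:I\to(0,\infty)$ be smooth (prescribed source warps). Put $F=\ell_1^{k_1}\ell_2^{k_2}$, $\lambda_i=d_i/\ell_i^2$, and $V(t,z)=\tfrac12\bigl(\lambda_1(t)|z_1|^2+\lambda_2(t)|z_2|^2\bigr)$ for $t\in I$, $z=(z_1,z_2)\in\mathbb S^3\subset\mathbb C^2$. For $(\xi,v)\in T_tI\times T_z\mathbb S^3$ with $\xi>0$ define $$\mathcal K(t,z;\xi,v)=\frac{F(t)}{2\xi}\bigl(|v|^2+2V(t,z)\xi^2\bigr).$$ Then $\mathcal K$ is a strongly convex conic Finsler metric on $I\times\mathbb S^3$ (with cone $\xi>0$). Moreover, for every smooth curve $\gamma=(z_1,z_2):I\to\mathbb S^3$, the map $G_\gamma$ is harmonic with respect to $g_\gamma$ if and only if the oriented graph $t\mapsto(t,\gamma(t))$ is an unparametrized $\mathcal K$-geodesic.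
   Context: Setting. For $i=1,2$, $(M_i,g_i)$ is a Riemannian manifold of dimension $k_i>0$, and $f_i:(M_i,g_i)\to\mathbb S^{2n_i+1}\subset\mathbb C^{n_i+1}$ (unit round sphere) is an eigenmap: a smooth map with $\Delta f_i=-d_if_i$, where $d_i=|df_i|^2>0$ is constant. A map $f$ into a unit sphere is harmonic iff $\Delta f=-|df|^2f$ (sign convention $\Delta=d^2/dt^2$ on $\mathbb R$). For a smooth curve $\gamma=(z_1,z_2):I\to\mathbb S^3\subset\mathbb C^2$ set $$G_\gamma(t,x,y)=(z_1(t)f_1(x),z_2(t)f_2(y))\in\mathbb S^{2n_1+2n_2+3},\qquad g_\gamma=dt^2+\ell_1(t)^2g_1+\ell_2(t)^2g_2\ \text{ on } I\times M_1\times M_2.$$ A conic Finsler metric on a manifold $N$ with (open, convex, fiberwise conic) domain $\mathscr C\subset TN$ is a smooth positive function on $\mathscr C$ that is positively $1$-homogeneous in the fiber variable; it is strongly convex if the fiber Hessian of half its square is positive definite at every point of $\mathscr C$. Here $\mathscr C=\{(t,z;\xi,v)\in T(I\times\mathbb S^3):\xi>0\}$. An (unparametrized) geodesic is an oriented curve with velocity in $\mathscr C$ which, on each compact subinterval, is a critical point of the length functional $\int\mathcal K$ for variations with fixed endpoints. *)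

theory Defs
  imports "HOL-Analysis.Analysis"
begin

section \<open>Smooth functions on subsets of Euclidean space\<close>

primrec Ck_on :: "nat \<Rightarrow> 'a::euclidean_space set \<Rightarrow> ('a \<Rightarrow> 'b::euclidean_space) \<Rightarrow> bool" where
  "Ck_on 0 U f \<longleftrightarrow> continuous_on U f"
| "Ck_on (Suc k) U f \<longleftrightarrow>
    (\<exists>f'. (\<forall>x\<in>U. (f has_derivative f' x) (at x)) \<and> (\<forall>v. Ck_on k U (\<lambda>x. f' x v)))"

text \<open>On an arbitrary set (an open set, an interval with end points, an embedded
  submanifold, \<open>\<dots>\<close>) smooth means: locally the restriction of a smooth function
  defined on an open set of the ambient space.\<close>

definition smooth_on :: "'a::euclidean_space set \<Rightarrow> ('a \<Rightarrow> 'b::euclidean_space) \<Rightarrow> bool" where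
  "smooth_on S f \<longleftrightarrow>
    (\<forall>x\<in>S. \<exists>U h. open U \<and> x \<in> U \<and> (\<forall>k. Ck_on k U h) \<and> (\<forall>y\<in>S \<inter> U. h y = f y))"

text \<open>The derivative of \<open>u : S \<rightarrow> 'b\<close> in direction \<open>b\<close>; the difference quotients only use
  points of \<open>S\<close>, so that it is one-sided at boundary points of \<open>S = I \<times> W\<close>, \<open>I\<close> an interval.\<close>

definition pd :: "'a::euclidean_space set \<Rightarrow> 'a \<Rightarrow> ('a \<Rightarrow> 'b::euclidean_space) \<Rightarrow> 'a \<Rightarrow> 'b" where
  "pd S b u x = vector_derivative (\<lambda>s. u (x + s *\<^sub>R b)) (at 0 within {s. x + s *\<^sub>R b \<in> S})"


section \<open>Riemannian metrics in coordinates\<close>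

text \<open>A field of bilinear forms on a set of coordinate vectors: \<open>g x u v\<close> is the value of
  the metric at \<open>x\<close> on the vectors \<open>u\<close>, \<open>v\<close>. Its coefficients are \<open>g x b c\<close> with
  \<open>b, c \<in> Basis\<close>.\<close>

type_synonym 'e metric_field = "'e \<Rightarrow> 'e \<Rightarrow> 'e \<Rightarrow> real"

text \<open>For \<open>b, c \<in> Basis\<close> this is the entry \<open>g\<^sup>b\<^sup>c\<close> of the inverse of the matrix of \<open>g x\<close>.\<close>

definition cometric :: "'e::euclidean_space metric_field \<Rightarrow> 'e metric_field" where
  "cometric g x b c = (THE w. \<forall>v. g x w v = b \<bullet> v) \<bullet> c"

text \<open>\<open>\<Gamma>\<^sup>a\<^sub>b\<^sub>c\<close>\<close>

definition christoffel ::
    "'e::euclidean_space set \<Rightarrow> 'e metric_field \<Rightarrow> 'e \<Rightarrow> 'e \<Rightarrow> 'e \<Rightarrow> 'e \<Rightarrow> real" where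
  "christoffel S g a b c x =
    (\<Sum>d\<in>Basis. cometric g x a d *
       (pd S b (\<lambda>y. g y d c) x + pd S c (\<lambda>y. g y b d) x - pd S d (\<lambda>y. g y b c) x)) / 2"

text \<open>The Laplace--Beltrami operator, i.e. the trace of the covariant Hessian, applied
  componentwise to a vector-valued function.\<close>

definition laplace_beltrami ::
    "'e::euclidean_space set \<Rightarrow> 'e metric_field \<Rightarrow> ('e \<Rightarrow> 'v::euclidean_space) \<Rightarrow> 'e \<Rightarrow> 'v" where
  "laplace_beltrami S g u x =
    (\<Sum>b\<in>Basis. \<Sum>c\<in>Basis. cometric g x b c *\<^sub>R
       (pd S b (pd S c u) x - (\<Sum>a\<in>Basis. christoffel S g a b c x *\<^sub>R pd S a u x)))"

definition norm2_differential ::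
    "'e::euclidean_space set \<Rightarrow> 'e metric_field \<Rightarrow> ('e \<Rightarrow> 'v::euclidean_space) \<Rightarrow> 'e \<Rightarrow> real" where
  "norm2_differential S g u x =
    (\<Sum>b\<in>Basis. \<Sum>c\<in>Basis. cometric g x b c * (pd S b u x \<bullet> pd S c u x))"


section \<open>Riemannian manifolds\<close>

text \<open>A chart together with the coordinate expression of the Riemannian metric in it; the
  latter is a metric field on the coordinate range \<open>chart_map c ` chart_dom c\<close>.\<close>

datatype ('m, 'e) rchart =
  RChart (chart_dom: "'m set") (chart_map: "'m \<Rightarrow> 'e") (chart_metric: "'e \<Rightarrow> 'e \<Rightarrow> 'e \<Rightarrow> real")

definition chart_range :: "('m, 'e) rchart \<Rightarrow> 'e set" where
  "chart_range c = chart_map c ` chart_dom c"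

definition in_chart :: "('m, 'e) rchart \<Rightarrow> ('m \<Rightarrow> 'b) \<Rightarrow> 'e \<Rightarrow> 'b" where
  "in_chart c f = f \<circ> inv_into (chart_dom c) (chart_map c)"

definition riemannian_chart :: "'m topology \<Rightarrow> ('m, 'e::euclidean_space) rchart \<Rightarrow> bool" where
  "riemannian_chart X c \<longleftrightarrow>
    openin X (chart_dom c) \<and> open (chart_range c) \<and>
    homeomorphic_map (subtopology X (chart_dom c)) (top_of_set (chart_range c)) (chart_map c) \<and>
    (\<forall>x\<in>chart_range c. bilinear (chart_metric c x) \<and>
       (\<forall>u v. chart_metric c x u v = chart_metric c x v u) \<and>
       (\<forall>u. u \<noteq> 0 \<longrightarrow> 0 < chart_metric c x u u)) \<and>
    (\<forall>u v. smooth_on (chart_range c) (\<lambda>x. chart_metric c x u v))"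

text \<open>The transition map is smooth and pulls back one metric expression to the other.\<close>

definition compatible_charts ::
    "('m, 'e::euclidean_space) rchart \<Rightarrow> ('m, 'e) rchart \<Rightarrow> bool" where
  "compatible_charts c c' \<longleftrightarrow>
    (let W = chart_map c ` (chart_dom c \<inter> chart_dom c'); \<tau> = in_chart c (chart_map c')
     in smooth_on W \<tau> \<and>
        (\<forall>x\<in>W. \<forall>u v. chart_metric c x u v =
           chart_metric c' (\<tau> x) (frechet_derivative \<tau> (at x) u) (frechet_derivative \<tau> (at x) v)))"

text \<open>A nonempty Riemannian manifold without boundary of dimension \<open>DIM('e)\<close>, given by its
  underlying topological space and a smooth atlas.\<close>

definition riemannian_manifold ::
    "'m topology \<Rightarrow> ('m, 'e::euclidean_space) rchart set \<Rightarrow> bool" where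
  "riemannian_manifold X A \<longleftrightarrow>
    topspace X \<noteq> {} \<and> Hausdorff_space X \<and> second_countable X \<and>
    (\<Union>c\<in>A. chart_dom c) = topspace X \<and>
    (\<forall>c\<in>A. riemannian_chart X c) \<and>
    (\<forall>c\<in>A. \<forall>c'\<in>A. compatible_charts c c')"

definition smooth_map ::
    "('m, 'e::euclidean_space) rchart set \<Rightarrow> ('m \<Rightarrow> 'v::euclidean_space) \<Rightarrow> bool" where
  "smooth_map A f \<longleftrightarrow> (\<forall>c\<in>A. smooth_on (chart_range c) (in_chart c f))"

text \<open>\<open>\<Delta>f\<close> and \<open>|df|\<^sup>2\<close> at a point of the domain of the chart \<open>c\<close>. They do not depend on
  the chart; equations between them are required in every chart of the atlas.\<close>

definition laplacian ::
    "('m, 'e::euclidean_space) rchart \<Rightarrow> ('m \<Rightarrow> 'v::euclidean_space) \<Rightarrow> 'm \<Rightarrow> 'v" where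
  "laplacian c f p = laplace_beltrami (chart_range c) (chart_metric c) (in_chart c f) (chart_map c p)"

definition energy_density ::
    "('m, 'e::euclidean_space) rchart \<Rightarrow> ('m \<Rightarrow> 'v::euclidean_space) \<Rightarrow> 'm \<Rightarrow> real" where
  "energy_density c f p =
    norm2_differential (chart_range c) (chart_metric c) (in_chart c f) (chart_map c p)"

text \<open>The equation \<open>\<Delta>f = - |df|\<^sup>2 f\<close> is the harmonic map equation for a map into the unit sphere of \<open>'v\<close>
  (with \<open>\<Delta> = d\<^sup>2/dt\<^sup>2\<close> on \<open>\<real>\<close>).\<close>

definition harmonic_sphere_map ::
    "('m, 'e::euclidean_space) rchart set \<Rightarrow> ('m \<Rightarrow> 'v::euclidean_space) \<Rightarrow> bool" where
  "harmonic_sphere_map A f \<longleftrightarrow>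
    smooth_map A f \<and>
    (\<forall>c\<in>A. \<forall>p\<in>chart_dom c. f p \<in> sphere 0 1 \<and>
       laplacian c f p = - (energy_density c f p *\<^sub>R f p))"

definition eigenmap ::
    "('m, 'e::euclidean_space) rchart set \<Rightarrow> real \<Rightarrow> ('m \<Rightarrow> 'v::euclidean_space) \<Rightarrow> bool" where
  "eigenmap A d f \<longleftrightarrow>
    smooth_map A f \<and> 0 < d \<and>
    (\<forall>c\<in>A. \<forall>p\<in>chart_dom c. f p \<in> sphere 0 1 \<and>
       energy_density c f p = d \<and> laplacian c f p = - (d *\<^sub>R f p))"

text \<open>The atlas of product charts of \<open>I \<times> M\<^sub>1 \<times> M\<^sub>2\<close> with the metric
  \<open>dt\<^sup>2 + l\<^sub>1(t)\<^sup>2 g\<^sub>1 + l\<^sub>2(t)\<^sup>2 g\<^sub>2\<close>. The interval may contain its end points.\<close>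

definition warped_product ::
    "real set \<Rightarrow> (real \<Rightarrow> real) \<Rightarrow> (real \<Rightarrow> real) \<Rightarrow>
     ('m1, 'e1) rchart set \<Rightarrow> ('m2, 'e2) rchart set \<Rightarrow>
     (real \<times> 'm1 \<times> 'm2, real \<times> 'e1 \<times> 'e2) rchart set" where
  "warped_product I l1 l2 A1 A2 =
    (\<lambda>(c1, c2).
       RChart (I \<times> chart_dom c1 \<times> chart_dom c2)
         (\<lambda>(t, p, q). (t, chart_map c1 p, chart_map c2 q))
         (\<lambda>(t, x, y) (\<tau>, u, v) (\<tau>', u', v').
            \<tau> * \<tau>' + (l1 t)\<^sup>2 * chart_metric c1 x u u' + (l2 t)\<^sup>2 * chart_metric c2 y v v'))
    ` (A1 \<times> A2)"

definition G_map ::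
    "(real \<Rightarrow> complex \<times> complex) \<Rightarrow> ('m1 \<Rightarrow> complex^'n1) \<Rightarrow> ('m2 \<Rightarrow> complex^'n2) \<Rightarrow>
     real \<times> 'm1 \<times> 'm2 \<Rightarrow> (complex^'n1) \<times> (complex^'n2)" where
  "G_map \<gamma> f1 f2 = (\<lambda>(t, p, q). (fst (\<gamma> t) *s f1 p, snd (\<gamma> t) *s f2 q))"


section \<open>Conic Finsler metrics\<close>

text \<open>For a manifold \<open>N\<close> embedded in \<open>'a\<close>, tangent vectors are pairs (base point, vector of
  \<open>'a\<close>), \<open>TN\<close> is the tangent bundle and \<open>C \<subseteq> TN\<close> the domain of the metric.\<close>

definition conic_finsler_metric ::
    "('a::euclidean_space \<times> 'a) set \<Rightarrow> ('a \<times> 'a) set \<Rightarrow> ('a \<times> 'a \<Rightarrow> real) \<Rightarrow> bool" where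
  "conic_finsler_metric TN C K \<longleftrightarrow>
    openin (top_of_set TN) C \<and>
    (\<forall>p. convex {v. (p, v) \<in> C}) \<and>
    (\<forall>p v r. (p, v) \<in> C \<longrightarrow> 0 < r \<longrightarrow> (p, r *\<^sub>R v) \<in> C) \<and>
    smooth_on C K \<and>
    (\<forall>p v. (p, v) \<in> C \<longrightarrow> 0 < K (p, v)) \<and>
    (\<forall>p v r. (p, v) \<in> C \<longrightarrow> 0 < r \<longrightarrow> K (p, r *\<^sub>R v) = r * K (p, v))"

definition hessian :: "('a::real_vector \<Rightarrow> real) \<Rightarrow> 'a \<Rightarrow> 'a \<Rightarrow> 'a \<Rightarrow> real" where
  "hessian \<phi> v w w' = deriv (\<lambda>r. deriv (\<lambda>s. \<phi> (v + r *\<^sub>R w + s *\<^sub>R w')) 0) 0"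

definition strongly_convex ::
    "('a::euclidean_space \<times> 'a) set \<Rightarrow> ('a \<times> 'a) set \<Rightarrow> ('a \<times> 'a \<Rightarrow> real) \<Rightarrow> bool" where
  "strongly_convex TN C K \<longleftrightarrow>
    (\<forall>p v w. (p, v) \<in> C \<longrightarrow> (p, w) \<in> TN \<longrightarrow> w \<noteq> 0 \<longrightarrow>
       0 < hessian (\<lambda>u. (K (p, u))\<^sup>2 / 2) v w w)"

text \<open>Since \<open>C \<subseteq> TN\<close>, the last condition also says that the varied curves lie in \<open>N\<close>.\<close>

definition fixed_end_variation ::
    "('a::euclidean_space \<times> 'a) set \<Rightarrow> (real \<Rightarrow> 'a) \<Rightarrow> real \<Rightarrow> real \<Rightarrow> real \<Rightarrow>
     (real \<Rightarrow> real \<Rightarrow> 'a) \<Rightarrow> bool" where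
  "fixed_end_variation C c a b \<epsilon> \<Phi> \<longleftrightarrow>
    0 < \<epsilon> \<and> smooth_on ({-\<epsilon><..<\<epsilon>} \<times> {a..b}) (\<lambda>(r, s). \<Phi> r s) \<and>
    (\<forall>s\<in>{a..b}. \<Phi> 0 s = c s) \<and>
    (\<forall>r\<in>{-\<epsilon><..<\<epsilon>}. \<Phi> r a = c a \<and> \<Phi> r b = c b) \<and>
    (\<forall>r\<in>{-\<epsilon><..<\<epsilon>}. \<forall>s\<in>{a..b}.
       (\<Phi> r s, vector_derivative (\<Phi> r) (at s within {a..b})) \<in> C)"

definition finsler_length ::
    "('a::euclidean_space \<times> 'a \<Rightarrow> real) \<Rightarrow> real \<Rightarrow> real \<Rightarrow> (real \<Rightarrow> 'a) \<Rightarrow> real" where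
  "finsler_length K a b c =
    integral {a..b} (\<lambda>s. K (c s, vector_derivative c (at s within {a..b})))"

text \<open>The oriented curve represented by the parametrization \<open>c : J \<rightarrow> N\<close> is a geodesic. As
  the length does not change under oriented reparametrizations, no condition is put on
  the parametrization.\<close>

definition unparametrized_geodesic ::
    "('a::euclidean_space \<times> 'a) set \<Rightarrow> ('a \<times> 'a \<Rightarrow> real) \<Rightarrow> real set \<Rightarrow> (real \<Rightarrow> 'a) \<Rightarrow> bool" where
  "unparametrized_geodesic C K J c \<longleftrightarrow>
    smooth_on J c \<and>
    (\<forall>t\<in>J. (c t, vector_derivative c (at t within J)) \<in> C) \<and>
    (\<forall>a b \<epsilon> \<Phi>. a < b \<longrightarrow> {a..b} \<subseteq> J \<longrightarrow> fixed_end_variation C c a b \<epsilon> \<Phi> \<longrightarrow>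
       ((\<lambda>r. finsler_length K a b (\<Phi> r)) has_real_derivative 0) (at 0))"


section \<open>The metric on \<open>I \<times> S\<^sup>3\<close>\<close>

text \<open>The tangent bundle of \<open>I \<times> S\<^sup>3 \<subseteq> \<real> \<times> \<complex>\<^sup>2\<close>; \<open>\<bullet>\<close> is the real inner product of \<open>\<complex>\<^sup>2\<close>.\<close>

definition T_IS3 ::
    "real set \<Rightarrow> ((real \<times> complex \<times> complex) \<times> (real \<times> complex \<times> complex)) set" where
  "T_IS3 I = {((t, z), (\<xi>, v)) |t z \<xi> v. t \<in> I \<and> z \<in> sphere 0 1 \<and> z \<bullet> v = 0}"

definition cone_IS3 ::
    "real set \<Rightarrow> ((real \<times> complex \<times> complex) \<times> (real \<times> complex \<times> complex)) set" where
  "cone_IS3 I = {((t, z), (\<xi>, v)) |t z \<xi> v. ((t, z), (\<xi>, v)) \<in> T_IS3 I \<and> 0 < \<xi>}"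

definition warp_density ::
    "nat \<Rightarrow> nat \<Rightarrow> (real \<Rightarrow> real) \<Rightarrow> (real \<Rightarrow> real) \<Rightarrow> real \<Rightarrow> real" where
  "warp_density k1 k2 l1 l2 t = l1 t ^ k1 * l2 t ^ k2"

definition potential ::
    "real \<Rightarrow> real \<Rightarrow> (real \<Rightarrow> real) \<Rightarrow> (real \<Rightarrow> real) \<Rightarrow> real \<Rightarrow> complex \<times> complex \<Rightarrow> real" where
  "potential d1 d2 l1 l2 t z =
    (d1 / (l1 t)\<^sup>2 * (cmod (fst z))\<^sup>2 + d2 / (l2 t)\<^sup>2 * (cmod (snd z))\<^sup>2) / 2"

definition K_metric ::
    "(real \<Rightarrow> real) \<Rightarrow> (real \<Rightarrow> complex \<times> complex \<Rightarrow> real) \<Rightarrow>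
     (real \<times> complex \<times> complex) \<times> (real \<times> complex \<times> complex) \<Rightarrow> real" where
  "K_metric F V = (\<lambda>((t, z), (\<xi>, v)). F t / (2 * \<xi>) * ((norm v)\<^sup>2 + 2 * V t z * \<xi>\<^sup>2))"

end

theory Submission
  imports Defs
begin

text \<open>In product charts the Laplacian of the warped metric is
  \<open>u\<^sub>t\<^sub>t + (F'/F) u\<^sub>t + l\<^sub>1\<^sup>-\<^sup>2 \<Delta>\<^sub>1 u + l\<^sub>2\<^sup>-\<^sup>2 \<Delta>\<^sub>2 u\<close>. Applied to \<open>(z\<^sub>1 f\<^sub>1, z\<^sub>2 f\<^sub>2)\<close>, whose factors \<open>f\<^sub>i\<close>
  are unit eigenmaps, the harmonic map equation becomes the ordinary differential equation
  \<open>F\<^sup>-\<^sup>1 (F \<gamma>')' - (\<lambda>\<^sub>1 z\<^sub>1, \<lambda>\<^sub>2 z\<^sub>2) = - e \<gamma>\<close> with \<open>e = |\<gamma>'|\<^sup>2 + 2 V\<close>; its component along \<open>\<gamma>\<close>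
  holds automatically, so it says that the tangential part of
  \<open>P = (F \<gamma>')' - F (\<lambda>\<^sub>1 z\<^sub>1, \<lambda>\<^sub>2 z\<^sub>2)\<close> vanishes.
  On the other side, for a variation of the graph with variation field \<open>(X, Y)\<close> the first
  derivative of the length is \<open>- \<integral> P \<bullet> (Y - X \<gamma>')\<close>: the equation in the \<open>t\<close>-direction is implied
  by the one in the sphere direction because the length is invariant under
  reparametrization. As \<open>Y - X \<gamma>'\<close> is tangent to the sphere, graphs with tangential part \<open>E = 0\<close> are
  geodesics; conversely one tests with \<open>X = 0\<close>, \<open>Y = 2 (s - a) (b - s) E\<close>.
  Strong convexity follows from \<open>(K\<^sup>2/2)'' = K'\<^sup>2 + K K''\<close> along a line with direction \<open>(\<eta>, \<omega>)\<close>, where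
  \<open>K'' = F |\<xi> \<omega> - \<eta> v|\<^sup>2 / \<xi>\<^sup>3\<close>.\<close>

section \<open>Smooth functions\<close>

text \<open>\<open>K\<close> is the homogenization of the time-dependent Lagrangian
  \<open>F e / 2\<close>, where \<open>e = |\<gamma>'|^2 + 2 V\<close>: it is \<open>\<xi>\<close>
  times that Lagrangian at the velocity \<open>v / \<xi>\<close>. As \<open>e\<close> is the energy
  density of the join and \<open>F\<close> the volume density of the warped metric in
  \<open>t\<close>, this is the Dirichlet energy reduced to curves. The factors may be noncompact,
  with infinite total energy, so the two equations are compared and not the two functionals.

  The obstacle that shapes the analysis is that \<open>I\<close> may contain its end points.
  Derivatives there are one-sided, and uniqueness of derivatives, symmetry of mixed derivatives and
  the chain rule have to hold on sets that are not open. Smoothness therefore means local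
  extendability, and every derivative is taken within a set that is large enough in each coordinate
  direction to determine it.

  The normal component of the equation is automatic because differentiating
  \<open>\<gamma> \<bullet> \<gamma>' = 0\<close> gives
  \<open>\<gamma> \<bullet> \<gamma>'' = - |\<gamma>'|^2\<close>, which is the first summand of
  \<open>- e\<close>; the potential gives the second.\<close>

lemma Ck_on_subset: "Ck_on k U f \<Longrightarrow> V \<subseteq> U \<Longrightarrow> Ck_on k V f"
proof (induction k arbitrary: f)
  case 0
  then show ?case by (auto intro: continuous_on_subset)
next
  case (Suc k)
  then show ?case by (simp, meson subsetD)
qed

lemma Ck_on_SucE:
  assumes "Ck_on (Suc k) U f"
  obtains f' where "\<And>x. x \<in> U \<Longrightarrow> (f has_derivative f' x) (at x)" "\<And>v. Ck_on k U (\<lambda>x. f' x v)"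
  using assms by auto

lemma Ck_on_cong:
  assumes "open U" "\<And>x. x \<in> U \<Longrightarrow> f x = g x" "Ck_on k U f"
  shows "Ck_on k U g"
proof (cases k)
  case 0
  with assms show ?thesis by (simp cong: continuous_on_cong)
next
  case (Suc n)
  then obtain f' where f': "\<And>x. x \<in> U \<Longrightarrow> (f has_derivative f' x) (at x)"
      "\<And>v. Ck_on n U (\<lambda>x. f' x v)"
    using assms(3) by auto
  have "(g has_derivative f' x) (at x)" if "x \<in> U" for x
    using f'(1)[OF that] assms(1) that assms(2) by (rule has_derivative_transform_within_open)
  with f' Suc show ?thesis by auto
qed

lemma Ck_on_SucD: "Ck_on (Suc k) U f \<Longrightarrow> Ck_on k U f"
proof (induction k arbitrary: f)
  case 0
  then show ?case
    by (auto intro!: continuous_at_imp_continuous_on dest: has_derivative_continuous)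
next
  case (Suc k)
  from Suc.prems obtain f' where "\<And>x. x \<in> U \<Longrightarrow> (f has_derivative f' x) (at x)"
      and "\<And>v. Ck_on (Suc k) U (\<lambda>x. f' x v)"
    unfolding Ck_on.simps(2)[of "Suc k"] by blast
  with Suc.IH show ?case unfolding Ck_on.simps(2)[of k] by blast
qed

lemma Ck_on_const: "Ck_on k U (\<lambda>x. c)"
proof (induction k arbitrary: c)
  case (Suc k)
  then show ?case by (auto intro!: exI[of _ "\<lambda>_ _. 0"])
qed simp

lemma Ck_on_bounded_linear:
  assumes "bounded_linear L" shows "Ck_on k U L"
proof (cases k)
  case 0
  with assms show ?thesis by (simp add: linear_continuous_on)
next
  case (Suc n)
  with assms show ?thesis
    by (auto intro!: exI[of _ "\<lambda>_. L"] Ck_on_const bounded_linear_imp_has_derivative)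
qed

lemma Ck_on_add: "Ck_on k U f \<Longrightarrow> Ck_on k U g \<Longrightarrow> Ck_on k U (\<lambda>x. f x + g x)"
proof (induction k arbitrary: f g)
  case 0
  then show ?case by (auto intro: continuous_intros)
next
  case (Suc k)
  obtain f' where f': "\<And>x. x \<in> U \<Longrightarrow> (f has_derivative f' x) (at x)" "\<And>v. Ck_on k U (\<lambda>x. f' x v)"
    using Ck_on_SucE[OF Suc.prems(1)] by blast
  obtain g' where "\<And>x. x \<in> U \<Longrightarrow> (g has_derivative g' x) (at x)" "\<And>v. Ck_on k U (\<lambda>x. g' x v)"
    using Ck_on_SucE[OF Suc.prems(2)] by blast
  with f' show ?case
    by (auto intro!: exI[of _ "\<lambda>x v. f' x v + g' x v"] Suc.IH has_derivative_add)
qed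

text \<open>Stated for an arbitrary bounded bilinear map because products, scalar multiples, inner
  products and \<open>*s\<close> all occur. The Leibniz rule brings back \<open>f\<close> and
  \<open>g\<close> themselves, so their class is lowered by \<open>Ck_on_SucD\<close> before the
  induction hypothesis applies.\<close>

lemma Ck_on_bilinear:
  assumes "bounded_bilinear m"
  shows "Ck_on k U f \<Longrightarrow> Ck_on k U g \<Longrightarrow> Ck_on k U (\<lambda>x. m (f x) (g x))"
proof (induction k arbitrary: f g)
  case 0
  then show ?case by (auto intro: bounded_bilinear.continuous_on[OF assms])
next
  case (Suc k)
  obtain f' where f': "\<And>x. x \<in> U \<Longrightarrow> (f has_derivative f' x) (at x)" "\<And>v. Ck_on k U (\<lambda>x. f' x v)"
    using Ck_on_SucE[OF Suc.prems(1)] by blast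
  obtain g' where g': "\<And>x. x \<in> U \<Longrightarrow> (g has_derivative g' x) (at x)" "\<And>v. Ck_on k U (\<lambda>x. g' x v)"
    using Ck_on_SucE[OF Suc.prems(2)] by blast
  have "Ck_on k U f" "Ck_on k U g" using Suc.prems by (auto dest: Ck_on_SucD simp del: Ck_on.simps)
  with f' g' show ?case
    by (auto intro!: exI[of _ "\<lambda>x v. m (f x) (g' x v) + m (f' x v) (g x)"] Ck_on_add
        Suc.IH bounded_bilinear.FDERIV[OF assms])
qed

lemma Ck_on_compose_linear:
  assumes L: "bounded_linear L" and "L ` V \<subseteq> U"
  shows "Ck_on k U f \<Longrightarrow> Ck_on k V (\<lambda>x. f (L x))"
proof (induction k arbitrary: f)
  case 0
  then show ?case using assms
    by (auto intro: continuous_on_compose2[of U f] linear_continuous_on)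
next
  case (Suc k)
  obtain f' where d: "\<And>x. x \<in> U \<Longrightarrow> (f has_derivative f' x) (at x)"
      "\<And>v. Ck_on k U (\<lambda>x. f' x v)"
    using Ck_on_SucE[OF Suc.prems] by blast
  have "((\<lambda>x. f (L x)) has_derivative (\<lambda>v. f' (L x) (L v))) (at x)" if "x \<in> V" for x
    using has_derivative_compose[OF bounded_linear_imp_has_derivative[OF L] d(1)[of "L x"]]
      that assms(2) by auto
  with Suc.IH d show ?case by (auto intro!: exI[of _ "\<lambda>x v. f' (L x) (L v)"])
qed

lemma Ck_on_linear_compose:
  assumes L: "bounded_linear L"
  shows "Ck_on k U f \<Longrightarrow> Ck_on k U (\<lambda>x. L (f x))"
proof (induction k arbitrary: f)
  case 0
  then show ?case using assms by (auto intro: bounded_linear.continuous_on)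
next
  case (Suc k)
  obtain f' where "\<And>x. x \<in> U \<Longrightarrow> (f has_derivative f' x) (at x)"
      "\<And>v. Ck_on k U (\<lambda>x. f' x v)"
    using Ck_on_SucE[OF Suc.prems] by blast
  with Suc.IH show ?case
    by (auto intro!: exI[of _ "\<lambda>x v. L (f' x v)"] bounded_linear.has_derivative[OF L])
qed

lemma Ck_on_inverse:
  fixes f :: "'a::euclidean_space \<Rightarrow> real"
  assumes "\<And>x. x \<in> U \<Longrightarrow> f x \<noteq> 0"
  shows "Ck_on k U f \<Longrightarrow> Ck_on k U (\<lambda>x. inverse (f x))"
proof (induction k)
  case 0
  then show ?case using assms by (auto intro: continuous_on_inverse)
next
  case (Suc k)
  obtain f' where d: "\<And>x. x \<in> U \<Longrightarrow> (f has_derivative f' x) (at x)"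
      "\<And>v. Ck_on k U (\<lambda>x. f' x v)"
    using Ck_on_SucE[OF Suc.prems] by blast
  \<comment> \<open>The derivative \<open>- f' / f^2\<close> contains the inverse again; the
    induction hypothesis supplies it one order lower.\<close>
  have ck: "Ck_on k U (\<lambda>x. inverse (f x))" using Suc by (auto dest: Ck_on_SucD simp del: Ck_on.simps)
  have "Ck_on k U (\<lambda>x. - (inverse (f x) * f' x v * inverse (f x)))" for v
    using ck d(2)[of v] by (intro Ck_on_linear_compose[OF bounded_linear_minus[OF bounded_linear_ident]]
        Ck_on_bilinear[OF bounded_bilinear_mult])
  with d assms show ?case
    by (auto intro!: exI[of _ "\<lambda>x v. - (inverse (f x) * f' x v * inverse (f x))"]
        Deriv.has_derivative_inverse)
qed

section \<open>Smooth functions on arbitrary subsets, by local extension\<close>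

lemma smooth_onE:
  assumes "smooth_on S f" "x \<in> S"
  obtains U h where "open U" "x \<in> U" "\<forall>k. Ck_on k U h" "\<forall>y\<in>S \<inter> U. h y = f y"
  using assms unfolding smooth_on_def by blast

lemma smooth_onI:
  assumes "\<And>x. x \<in> S \<Longrightarrow> \<exists>U h. open U \<and> x \<in> U \<and> (\<forall>k. Ck_on k U h) \<and> (\<forall>y\<in>S \<inter> U. h y = f y)"
  shows "smooth_on S f"
  using assms unfolding smooth_on_def by blast

lemma smooth_on_cong: "smooth_on S f \<Longrightarrow> (\<And>x. x \<in> S \<Longrightarrow> f x = g x) \<Longrightarrow> smooth_on S g"
  unfolding smooth_on_def by (metis IntD1)

lemma smooth_on_subset: "smooth_on S f \<Longrightarrow> T \<subseteq> S \<Longrightarrow> smooth_on T f"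
  unfolding smooth_on_def by (rule ballI, drule bspec, erule subsetD, assumption) blast

lemma smooth_on_imp_continuous_on:
  assumes "smooth_on S f" shows "continuous_on S f"
proof (unfold continuous_on_eq_continuous_within, intro ballI)
  fix x assume x: "x \<in> S"
  obtain U h where U: "open U" "x \<in> U" "\<forall>k. Ck_on k U h"
      "\<forall>y\<in>S \<inter> U. h y = f y"
    using smooth_onE[OF assms x] by blast
  have "isCont h x"
    using U(3)[rule_format, of 0] U(1,2) by (simp add: continuous_on_eq_continuous_at)
  then have "continuous (at x within S) h" by (rule continuous_at_imp_continuous_within)
  moreover obtain d where d: "d > 0" "ball x d \<subseteq> U" by (rule openE[OF U(1,2)])
  ultimately show "continuous (at x within S) f"
    using U(4) x by (auto elim!: continuous_transform_within simp: subset_iff dist_commute)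
qed

lemma smooth_on_const [simp]: "smooth_on S (\<lambda>x. c)"
  by (rule smooth_onI) (auto intro!: exI[of _ UNIV] exI[of _ "\<lambda>_. c"] Ck_on_const)

lemma smooth_on_bounded_linear: "bounded_linear L \<Longrightarrow> smooth_on S L"
  by (rule smooth_onI) (auto intro!: exI[of _ UNIV] exI[of _ L] Ck_on_bounded_linear)

text \<open>The inner map is linear because smooth compositions occur only with coordinate
  projections. Where \<open>F\<close> is later composed with a varied curve, only continuity and a
  first derivative are used.\<close>

lemma smooth_on_compose_linear:
  assumes "smooth_on T f" "bounded_linear L" "\<And>x. x \<in> S \<Longrightarrow> L x \<in> T"
  shows "smooth_on S (\<lambda>x. f (L x))"
proof (rule smooth_onI)
  fix x assume x: "x \<in> S"
  obtain U h where U: "open U" "L x \<in> U" "\<forall>k. Ck_on k U h"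
      "\<forall>y\<in>T \<inter> U. h y = f y"
    using smooth_onE[OF assms(1) assms(3)[OF x]] by blast
  have "open (L -` U)"
    using U(1) assms(2) by (intro open_vimage linear_continuous_on) auto
  moreover have "Ck_on k (L -` U) (\<lambda>x. h (L x))" for k
    using U(3) assms(2) by (intro Ck_on_compose_linear[of L _ U]) auto
  ultimately show "\<exists>U h. open U \<and> x \<in> U \<and> (\<forall>k. Ck_on k U h) \<and> (\<forall>y\<in>S \<inter> U. h y = f (L y))"
    using U assms(3) by (intro exI[of _ "L -` U"] exI[of _ "\<lambda>x. h (L x)"]) auto
qed

lemma smooth_on_linear_compose:
  assumes "smooth_on S f" "bounded_linear L"
  shows "smooth_on S (\<lambda>x. L (f x))"
proof (rule smooth_onI)
  fix x assume x: "x \<in> S"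
  obtain U h where "open U" "x \<in> U" "\<forall>k. Ck_on k U h"
      "\<forall>y\<in>S \<inter> U. h y = f y"
    using smooth_onE[OF assms(1) x] by blast
  then show "\<exists>U h. open U \<and> x \<in> U \<and> (\<forall>k. Ck_on k U h) \<and> (\<forall>y\<in>S \<inter> U. h y = L (f y))"
    using assms(2) by (intro exI[of _ U] exI[of _ "\<lambda>x. L (h x)"]) (auto intro: Ck_on_linear_compose)
qed

lemma smooth_on_bilinear:
  assumes "bounded_bilinear m" "smooth_on S f" "smooth_on S g"
  shows "smooth_on S (\<lambda>x. m (f x) (g x))"
proof (rule smooth_onI)
  fix x assume x: "x \<in> S"
  obtain U h where U: "open U" "x \<in> U" "\<forall>k. Ck_on k U h"
      "\<forall>y\<in>S \<inter> U. h y = f y"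
    using smooth_onE[OF assms(2) x] by blast
  obtain U' h' where U': "open U'" "x \<in> U'" "\<forall>k. Ck_on k U' h'"
      "\<forall>y\<in>S \<inter> U'. h' y = g y"
    using smooth_onE[OF assms(3) x] by blast
  have "Ck_on k (U \<inter> U') (\<lambda>x. m (h x) (h' x))" for k
    using U(3)[rule_format, of k] U'(3)[rule_format, of k]
    by (intro Ck_on_bilinear[OF assms(1)]) (auto elim: Ck_on_subset)
  with U U' show "\<exists>U h. open U \<and> x \<in> U \<and> (\<forall>k. Ck_on k U h) \<and> (\<forall>y\<in>S \<inter> U. h y = m (f y) (g y))"
    by (intro exI[of _ "U \<inter> U'"] exI[of _ "\<lambda>x. m (h x) (h' x)"]) auto
qed

lemma smooth_on_Pair:
  assumes "smooth_on S f" "smooth_on S g"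
  shows "smooth_on S (\<lambda>x. (f x, g x))"
proof (rule smooth_onI)
  fix x assume x: "x \<in> S"
  obtain U h where U: "open U" "x \<in> U" "\<forall>k. Ck_on k U h"
      "\<forall>y\<in>S \<inter> U. h y = f y"
    using smooth_onE[OF assms(1) x] by blast
  obtain U' h' where U': "open U'" "x \<in> U'" "\<forall>k. Ck_on k U' h'"
      "\<forall>y\<in>S \<inter> U'. h' y = g y"
    using smooth_onE[OF assms(2) x] by blast
  \<comment> \<open>A pair is the sum of two linear images, so closure under sums and linear maps
    applies.\<close>
  have 1: "Ck_on k (U \<inter> U') (\<lambda>x. (h x, 0) + (0, h' x))" for k
    using U(3)[rule_format, of k] U'(3)[rule_format, of k]
    by (intro Ck_on_add Ck_on_linear_compose[where L="\<lambda>x. (x, 0)"] Ck_on_linear_compose[where L="\<lambda>x. (0, x)"]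
        bounded_linear_Pair bounded_linear_ident bounded_linear_zero) (auto elim: Ck_on_subset)
  with U U' show "\<exists>U h. open U \<and> x \<in> U \<and> (\<forall>k. Ck_on k U h) \<and> (\<forall>y\<in>S \<inter> U. h y = (f y, g y))"
    by (intro exI[of _ "U \<inter> U'"] exI[of _ "\<lambda>x. (h x, 0) + (0, h' x)"]) auto
qed

lemma smooth_on_add:
  "smooth_on S f \<Longrightarrow> smooth_on S g \<Longrightarrow> smooth_on S (\<lambda>x. f x + g x)"
  using smooth_on_linear_compose[OF smooth_on_Pair, of S f g "\<lambda>p. fst p + snd p"]
  by (simp add: bounded_linear_add bounded_linear_fst bounded_linear_snd)

lemma smooth_on_diff:
  "smooth_on S f \<Longrightarrow> smooth_on S g \<Longrightarrow> smooth_on S (\<lambda>x. f x - g x)"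
  using smooth_on_linear_compose[OF smooth_on_Pair, of S f g "\<lambda>p. fst p - snd p"]
  by (simp add: bounded_linear_sub bounded_linear_fst bounded_linear_snd)

lemma smooth_on_inverse:
  fixes f :: "'a::euclidean_space \<Rightarrow> real"
  assumes "smooth_on S f" "\<And>x. x \<in> S \<Longrightarrow> f x \<noteq> 0"
  shows "smooth_on S (\<lambda>x. inverse (f x))"
proof (rule smooth_onI)
  fix x assume x: "x \<in> S"
  obtain U h where U: "open U" "x \<in> U" "\<forall>k. Ck_on k U h"
      "\<forall>y\<in>S \<inter> U. h y = f y"
    using smooth_onE[OF assms(1) x] by blast
  have "continuous_on U h" using U(3)[rule_format, of 0] by simp
  \<comment> \<open>The extension \<open>h\<close> may vanish off \<open>S\<close>, so the
    neighbourhood is shrunk to the set where it does not.\<close>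
  then have o: "open (U \<inter> h -` (- {0}))"
    using U(1) by (metis continuous_on_open_vimage open_Compl closed_singleton Int_commute)
  have "Ck_on k (U \<inter> h -` (- {0})) (\<lambda>x. inverse (h x))" for k
    using U(3)[rule_format, of k] by (intro Ck_on_inverse) (auto elim: Ck_on_subset)
  with o U x assms(2)[of x]
  show "\<exists>U h. open U \<and> x \<in> U \<and> (\<forall>k. Ck_on k U h) \<and> (\<forall>y\<in>S \<inter> U. h y = inverse (f y))"
    by (intro exI[of _ "U \<inter> h -` (- {0})"] exI[of _ "\<lambda>x. inverse (h x)"]) auto
qed

lemmas smooth_on_mult = smooth_on_bilinear[OF bounded_bilinear_mult]
  and smooth_on_scaleR = smooth_on_bilinear[OF bounded_bilinear_scaleR]
  and smooth_on_inner = smooth_on_bilinear[OF bounded_bilinear_inner]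

lemma smooth_on_divide:
  fixes f g :: "'a::euclidean_space \<Rightarrow> real"
  assumes "smooth_on S f" "smooth_on S g" "\<And>x. x \<in> S \<Longrightarrow> g x \<noteq> 0"
  shows "smooth_on S (\<lambda>x. f x / g x)"
  unfolding divide_inverse using assms by (intro smooth_on_mult smooth_on_inverse)

lemma smooth_on_power:
  fixes f :: "'a::euclidean_space \<Rightarrow> real"
  assumes "smooth_on S f" shows "smooth_on S (\<lambda>x. f x ^ n)"
proof (induction n)
  case (Suc n)
  then show ?case using assms by (simp add: smooth_on_mult)
qed simp

text \<open>Sets on which the derivative of a function is unique, even at boundary points.\<close>

definition ample :: "'a::euclidean_space set \<Rightarrow> bool" where
  "ample S \<longleftrightarrow> (\<forall>x\<in>S. \<forall>i\<in>Basis. \<forall>e>0. \<exists>d. 0 < \<bar>d\<bar> \<and> \<bar>d\<bar> < e \<and> x + d *\<^sub>R i \<in> S)"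

lemma ample_derivative_unique:
  assumes "ample S" "x \<in> S" "(f has_derivative f') (at x within S)"
    "(f has_derivative f'') (at x within S)"
  shows "f' = f''"
  using frechet_derivative_unique_within[OF assms(3,4)] assms(1,2) unfolding ample_def by blast

lemma ample_open: assumes "open S" shows "ample S"
  unfolding ample_def
proof (intro ballI allI impI)
  fix x i :: 'a and e :: real assume x: "x \<in> S" and i: "i \<in> Basis" and "e > 0"
  obtain r where r: "r > 0" "ball x r \<subseteq> S" using assms x openE by blast
  let ?d = "min e r / 2"
  have "x + ?d *\<^sub>R i \<in> ball x r"
    using r i \<open>e > 0\<close> by (simp add: dist_norm)
  with r \<open>e > 0\<close> show "\<exists>d. 0 < \<bar>d\<bar> \<and> \<bar>d\<bar> < e \<and> x + d *\<^sub>R i \<in> S"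
    by (intro exI[of _ ?d]) auto
qed

lemma ample_Times: assumes "ample S" "ample T" shows "ample (S \<times> T)"
  unfolding ample_def
proof (intro ballI allI impI)
  fix x i :: "'a \<times> 'b" and e :: real assume x: "x \<in> S \<times> T" and i: "i \<in> Basis" and e: "e > 0"
  from i consider j where "j \<in> Basis" "i = (j, 0)" | j where "j \<in> Basis" "i = (0, j)"
    by (auto simp: Basis_prod_def)
  then show "\<exists>d. 0 < \<bar>d\<bar> \<and> \<bar>d\<bar> < e \<and> x + d *\<^sub>R i \<in> S \<times> T"
    using assms x e unfolding ample_def by cases (auto; meson)+
qed

lemma ample_interval:
  fixes I :: "real set"
  assumes "is_interval I" "a \<in> I" "b \<in> I" "a < b"
  shows "ample I"
  unfolding ample_def
proof (intro ballI allI impI)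
  fix x i e :: real assume x: "x \<in> I" and i: "i \<in> Basis" and e: "e > 0"
  have sub: "{a..b} \<subseteq> I" "{a..x} \<subseteq> I" "{x..b} \<subseteq> I"
    using mem_is_interval_1_I[OF assms(1)] assms(2,3) x by (meson atLeastAtMost_iff subsetI)+
  show "\<exists>d. 0 < \<bar>d\<bar> \<and> \<bar>d\<bar> < e \<and> x + d *\<^sub>R i \<in> I"
  \<comment> \<open>Below \<open>b\<close> there is room to the right; otherwise
    \<open>a < b \<le> x\<close> leaves room to the left.\<close>
  proof (cases "x < b")
    case True
    with sub e i show ?thesis by (intro exI[of _ "min (e/2) (b - x)"]) auto
  next
    case False
    with sub e i assms show ?thesis by (intro exI[of _ "- min (e/2) (x - a)"]) auto
  qed
qed

lemma ample_not_bot: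
  fixes I :: "real set"
  assumes "ample I" "x \<in> I" shows "at x within I \<noteq> bot"
proof -
  have "x islimpt I" unfolding islimpt_approachable
  proof (intro allI impI)
    fix e :: real assume "e > 0"
    then obtain d where "0 < \<bar>d\<bar>" "\<bar>d\<bar> < e" "x + d *\<^sub>R 1 \<in> I"
      using assms unfolding ample_def by force
    then show "\<exists>x'\<in>I. x' \<noteq> x \<and> dist x' x < e"
      by (intro bexI[of _ "x + d"]) (auto simp: dist_real_def)
  qed
  then show ?thesis by (simp add: trivial_limit_within)
qed

text \<open>Any local extension provides a derivative within \<open>S\<close>. Ampleness makes it
  independent of the extension, so the derivative of the extension in a fixed direction extends the
  directional derivative on \<open>S\<close>, which is thereby smooth again.\<close>

lemma smooth_on_has_derivative:
  assumes "smooth_on S f" "ample S"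
  obtains f' where "\<And>x. x \<in> S \<Longrightarrow> (f has_derivative f' x) (at x within S)"
    "\<And>v. smooth_on S (\<lambda>x. f' x v)"
proof -
  have ex: "\<exists>D. (f has_derivative D) (at x within S)" if "x \<in> S" for x
  proof -
    obtain U h where U: "open U" "x \<in> U" "\<forall>k. Ck_on k U h"
        "\<forall>y\<in>S \<inter> U. h y = f y"
      using smooth_onE[OF assms(1) \<open>x \<in> S\<close>] by blast
    obtain D where "(h has_derivative D) (at x)" using U(2) U(3)[rule_format, of 1] by auto
    then have "(h has_derivative D) (at x within S)" by (rule has_derivative_at_withinI)
    moreover obtain d where d: "d > 0" "ball x d \<subseteq> U" by (rule openE[OF U(1,2)])
    ultimately have "(f has_derivative D) (at x within S)"
      using \<open>x \<in> S\<close> U(4) d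
      by (elim has_derivative_transform_within[where d=d]) (auto simp: dist_commute subset_iff)
    then show ?thesis by blast
  qed
  then obtain f' where f': "\<And>x. x \<in> S \<Longrightarrow> (f has_derivative f' x) (at x within S)" by metis
  moreover have "smooth_on S (\<lambda>x. f' x v)" for v
  proof (rule smooth_onI)
    fix x assume x: "x \<in> S"
    obtain U h where U: "open U" "x \<in> U" "\<forall>k. Ck_on k U h"
        "\<forall>y\<in>S \<inter> U. h y = f y"
      using smooth_onE[OF assms(1) x] by blast
    \<comment> \<open>For each order \<open>k\<close> the predicate \<open>Ck_on\<close> may provide
      a different derivative field; one field is fixed here, and on the open set \<open>U\<close>
      all of them agree with it.\<close>
    define h' where "h' y = frechet_derivative h (at y)" for y
    have h': "(h has_derivative h' y) (at y)" if "y \<in> U" for y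
      using U(3)[rule_format, of 1] that unfolding h'_def
      by (auto simp: frechet_derivative_works[symmetric] differentiable_def)
    have "Ck_on k U (\<lambda>x. h' x v)" for k
    proof -
      obtain h'' where h'': "\<And>y. y \<in> U \<Longrightarrow> (h has_derivative h'' y) (at y)"
          "Ck_on k U (\<lambda>x. h'' x v)" using U(3)[rule_format, of "Suc k"] by auto
      show ?thesis
        using has_derivative_unique[OF h''(1) h'] by (intro Ck_on_cong[OF U(1) _ h''(2)]) auto
    qed
    moreover have "h' y v = f' y v" if "y \<in> S \<inter> U" for y
    proof -
      have "(h has_derivative h' y) (at y within S)"
        using h' that by (auto intro: has_derivative_at_withinI)
      moreover obtain d where d: "d > 0" "ball y d \<subseteq> U" using openE[OF U(1), of y] \<open>y \<in> S \<inter> U\<close> by blast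
      ultimately have "(f has_derivative h' y) (at y within S)"
        using \<open>y \<in> S \<inter> U\<close> U(4) d
        by (elim has_derivative_transform_within[where d=d]) (auto simp: dist_commute subset_iff)
      then show ?thesis using ample_derivative_unique[OF assms(2) _ f'] that by auto
    qed
    ultimately show "\<exists>U h. open U \<and> x \<in> U \<and> (\<forall>k. Ck_on k U h) \<and> (\<forall>y\<in>S \<inter> U. h y = f' y v)"
      using U by (intro exI[of _ U] exI[of _ "\<lambda>y. h' y v"]) auto
  qed
  ultimately show ?thesis using that by blast
qed

lemma smooth_on_imp_differentiable_on: "smooth_on S f \<Longrightarrow> ample S \<Longrightarrow> f differentiable_on S"
  unfolding differentiable_on_def differentiable_def by (rule smooth_on_has_derivative[of S f]) auto

lemma smooth_on_interval_derivative:
  fixes f :: "real \<Rightarrow> 'b::euclidean_space"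
  assumes "smooth_on I f" "ample I"
  shows smooth_on_has_vector_derivative:
      "t \<in> I \<Longrightarrow> (f has_vector_derivative vector_derivative f (at t within I)) (at t within I)"
    and smooth_on_vector_derivative: "smooth_on I (\<lambda>t. vector_derivative f (at t within I))"
proof -
  obtain f' where f': "\<And>x. x \<in> I \<Longrightarrow> (f has_derivative f' x) (at x within I)"
    "\<And>v. smooth_on I (\<lambda>x. f' x v)" using smooth_on_has_derivative[OF assms] by blast
  have "(f has_vector_derivative f' x 1) (at x within I)" if "x \<in> I" for x
    unfolding has_vector_derivative_def
  proof (rule has_derivative_eq_rhs[OF f'(1)[OF that]])
    show "f' x = (\<lambda>r. r *\<^sub>R f' x 1)"
      using linear_cmul[OF has_derivative_linear[OF f'(1)[OF that]], of _ 1, symmetric] by auto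
  qed
  then have *: "(f has_vector_derivative f' x 1) (at x within I)"
      "vector_derivative f (at x within I) = f' x 1" if "x \<in> I" for x
    using that ample_not_bot[OF assms(2) that] by (auto intro!: vector_derivative_within)
  then show "t \<in> I \<Longrightarrow> (f has_vector_derivative vector_derivative f (at t within I)) (at t within I)"
    by simp
  show "smooth_on I (\<lambda>t. vector_derivative f (at t within I))"
    by (rule smooth_on_cong[OF f'(2)[of 1]]) (simp add: *)
qed

section \<open>Directional derivatives along basis vectors\<close>

lemma pd_cong:
  assumes "x \<in> S" "\<And>y. y \<in> S \<Longrightarrow> u y = v y"
  shows "pd S b u x = pd S b v x"
  unfolding pd_def using assms by (intro vector_derivative_cong_eq) auto

text \<open>Ampleness makes 0 a limit point of the admissible parameters \<open>s\<close>. The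
  filter in the definition of \<open>pd\<close> is then nontrivial, and
  \<open>vector_derivative\<close> has a unique value.\<close>

lemma pd_eqI:
  assumes "ample S" "x \<in> S" "b \<in> Basis" "(u has_derivative u') (at x within S)"
  shows "pd S b u x = u' b"
proof -
  let ?A = "{s. x + s *\<^sub>R b \<in> S}"
  have "0 islimpt ?A" unfolding islimpt_approachable
  proof (intro allI impI)
    fix e :: real assume "e > 0"
    then obtain d where "0 < \<bar>d\<bar>" "\<bar>d\<bar> < e" "x + d *\<^sub>R b \<in> S"
      using assms(1-3) unfolding ample_def by blast
    then show "\<exists>x'\<in>?A. x' \<noteq> 0 \<and> dist x' 0 < e"
      by (intro bexI[of _ d]) auto
  qed
  then have nb: "at 0 within ?A \<noteq> bot" by (simp add: trivial_limit_within)
  have 1: "((\<lambda>s. x + s *\<^sub>R b) has_derivative (\<lambda>s. s *\<^sub>R b)) (at 0 within ?A)"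
    by (auto intro!: derivative_eq_intros)
  have "(u has_derivative u') (at (x + 0 *\<^sub>R b) within (\<lambda>s. x + s *\<^sub>R b) ` ?A)"
    using assms(4) by (auto intro: has_derivative_subset)
  from diff_chain_within[OF 1 this]
  have "((\<lambda>s. u (x + s *\<^sub>R b)) has_derivative (\<lambda>s. u' (s *\<^sub>R b))) (at 0 within ?A)"
    by (simp add: o_def)
  then have "((\<lambda>s. u (x + s *\<^sub>R b)) has_vector_derivative u' b) (at 0 within ?A)"
    using linear_cmul[OF has_derivative_linear[OF assms(4)]] by (simp add: has_vector_derivative_def)
  then show ?thesis unfolding pd_def using nb by (simp add: vector_derivative_within)
qed

lemma pd_const: "ample S \<Longrightarrow> x \<in> S \<Longrightarrow> b \<in> Basis \<Longrightarrow> pd S b (\<lambda>x. c) x = 0"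
  by (rule pd_eqI) auto

text \<open>The affine form matches the join: as a function of one manifold variable, its one
  component is a linear image of \<open>f1\<close> or \<open>f2\<close> and the other is
  constant.\<close>

lemma pd_affine:
  assumes "smooth_on S u" "ample S" "x \<in> S" "b \<in> Basis" "bounded_linear L"
  shows "pd S b (\<lambda>x. L (u x) + k) x = L (pd S b u x)"
proof -
  obtain u' where u': "(u has_derivative u') (at x within S)"
    using smooth_on_imp_differentiable_on[OF assms(1,2)] assms(3)
    by (auto simp: differentiable_on_def differentiable_def)
  have "((\<lambda>x. L (u x) + k) has_derivative (\<lambda>v. L (u' v))) (at x within S)"
    using has_derivative_add[OF bounded_linear.has_derivative[OF assms(5) u'] has_derivative_const]
    by simp
  from pd_eqI[OF assms(2-4) this] pd_eqI[OF assms(2-4) u'] show ?thesis by simp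
qed

lemma pd_cmult:
  fixes u :: "'a::euclidean_space \<Rightarrow> real"
  assumes "smooth_on S u" "ample S" "x \<in> S" "b \<in> Basis"
  shows "pd S b (\<lambda>x. c * u x) x = c * pd S b u x"
  using pd_affine[OF assms bounded_linear_mult_right[of c], of 0] by simp

lemma smooth_on_pd:
  assumes "smooth_on S u" "ample S" "b \<in> Basis"
  shows "smooth_on S (pd S b u)"
proof -
  obtain u' where u': "\<And>x. x \<in> S \<Longrightarrow> (u has_derivative u' x) (at x within S)"
      "\<And>v. smooth_on S (\<lambda>x. u' x v)"
    by (rule smooth_on_has_derivative[OF assms(1,2)]) (rule that)
  show ?thesis
    by (rule smooth_on_cong[OF u'(2)[of b]]) (simp add: pd_eqI[OF assms(2) _ assms(3) u'(1)])
qed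

lemma pd_interval:
  assumes "ample I" "t \<in> I" "(u has_vector_derivative D) (at t within I)"
  shows "pd I 1 u t = D"
  using pd_eqI[OF assms(1,2), of 1 u] assms(3) by (simp add: has_vector_derivative_def)

section \<open>Inner products and inverse metrics\<close>

text \<open>The pointwise condition in \<open>riemannian_chart\<close>, isolated so that inverse
  metrics are pure linear algebra.\<close>

definition inner_form :: "('e::euclidean_space \<Rightarrow> 'e \<Rightarrow> real) \<Rightarrow> bool" where
  "inner_form g \<longleftrightarrow> bilinear g \<and> (\<forall>u v. g u v = g v u) \<and> (\<forall>u. u \<noteq> 0 \<longrightarrow> 0 < g u u)"

text \<open>This makes the description operator in \<open>cometric\<close> meaningful. Lowering an
  index is the linear map \<open>T\<close>; definiteness makes it injective, and finite dimension
  then makes it bijective.\<close>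

lemma inner_form_representer: assumes "inner_form g" shows "\<exists>!w. \<forall>v. g w v = b \<bullet> v"
proof -
  have bl: "bilinear g" and pos: "\<And>u. u \<noteq> 0 \<Longrightarrow> 0 < g u u"
    using assms by (auto simp: inner_form_def)
  have lin1: "linear (\<lambda>w. g w v)" and lin2: "linear (g v)" for v
    using bl by (auto simp: bilinear_def)
  define T where "T w = (\<Sum>c\<in>Basis. g w c *\<^sub>R c)" for w
  have Tin: "T w \<bullet> v = g w v" for w v
  proof -
    have "T w \<bullet> v = (\<Sum>c\<in>Basis. (v \<bullet> c) * g w c)"
      unfolding T_def by (simp add: inner_sum_left inner_commute[of v] mult.commute)
    also have "\<dots> = g w (\<Sum>c\<in>Basis. (v \<bullet> c) *\<^sub>R c)"
      using lin2[of w] by (simp add: linear_sum linear_cmul)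
    finally show ?thesis by (simp add: euclidean_representation)
  qed
  have linT: "linear T"
    unfolding T_def
    by (rule linearI)
      (simp_all add: bilinear_ladd[OF bl] bilinear_lmul[OF bl] algebra_simps sum.distrib scaleR_sum_right)
  have "inj T" unfolding linear_injective_0[OF linT]
  proof (intro allI impI)
    fix w assume "T w = 0"
    then have "g w w = 0" using Tin[of w w] by simp
    with pos show "w = 0" by force
  qed
  with linT have "surj T" by (rule linear_injective_imp_surjective[OF _ _ refl])
  then obtain w where "T w = b" by (metis surjD)
  then have w: "\<forall>v. g w v = b \<bullet> v" using Tin by auto
  moreover have "w' = w" if "\<forall>v. g w' v = b \<bullet> v" for w'
  proof -
    have "T w' \<bullet> v = T w \<bullet> v" for v using that w by (simp add: Tin)
    then have "T w' = T w" by (metis vector_eq_rdot)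
    with \<open>inj T\<close> show ?thesis by (simp add: inj_def)
  qed
  ultimately show ?thesis by blast
qed

lemma cometric_eqI:
  assumes "inner_form (g x)" "\<And>v. g x w v = b \<bullet> v"
  shows "cometric g x b c = w \<bullet> c"
proof -
  have "(THE w. \<forall>v. g x w v = b \<bullet> v) = w"
    using inner_form_representer[OF assms(1), of b] assms(2) by (intro the1_equality) auto
  then show ?thesis by (simp add: cometric_def)
qed

lemma cometric_zero [simp]:
  assumes "inner_form (g x)"
  shows "cometric g x 0 c = 0" "cometric g x b 0 = 0"
proof -
  have "g x 0 v = 0" for v using assms by (simp add: inner_form_def bilinear_lzero)
  then show "cometric g x 0 c = 0" using cometric_eqI[of g x 0 0 c] assms by simp
qed (simp add: cometric_def)

text \<open>For fixed \<open>b\<close>, with \<open>w\<close> representing \<open>b\<close>, the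
  inner sum is \<open>g x b w = b \<bullet> b = 1\<close>. This trace is how the dimensions of the
  factors, the exponents in \<open>F\<close>, enter the Laplacian.\<close>

lemma cometric_trace:
  fixes g :: "'e::euclidean_space metric_field"
  assumes "inner_form (g x)"
  shows "(\<Sum>b\<in>Basis. \<Sum>c\<in>Basis. cometric g x b c * g x b c) = DIM('e)"
proof -
  have "(\<Sum>c\<in>Basis. cometric g x b c * g x b c) = 1" if b: "b \<in> Basis" for b
  proof -
    obtain w where w: "\<And>v. g x w v = b \<bullet> v" using inner_form_representer[OF assms, of b] by blast
    have lin: "linear (g x b)" using assms by (simp add: inner_form_def bilinear_def)
    have "(\<Sum>c\<in>Basis. cometric g x b c * g x b c) = (\<Sum>c\<in>Basis. (w \<bullet> c) * g x b c)"
      by (simp add: cometric_eqI[of g x, OF assms w])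
    also have "\<dots> = g x b (\<Sum>c\<in>Basis. (w \<bullet> c) *\<^sub>R c)"
      using lin by (simp add: linear_sum linear_cmul)
    also have "\<dots> = g x w b" using assms by (simp add: euclidean_representation inner_form_def)
    finally show ?thesis using w b by simp
  qed
  then show ?thesis by simp
qed

lemma sum_Basis_Times:
  fixes f :: "'a::euclidean_space \<times> 'b::euclidean_space \<Rightarrow> 'c::comm_monoid_add"
  shows "(\<Sum>b\<in>Basis. f b) = (\<Sum>i\<in>Basis. f (i, 0)) + (\<Sum>j\<in>Basis. f (0, j))"
proof -
  have "inj_on (\<lambda>u::'a. (u, 0::'b)) Basis" "inj_on (\<lambda>v::'b. (0::'a, v)) Basis"
    by (auto intro!: inj_onI)
  then show ?thesis
    unfolding Basis_prod_def
    by (subst sum.union_disjoint) (auto simp: sum.reindex)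
qed

section \<open>The Laplacian of a warped product\<close>

definition warped_metric ::
    "(real \<Rightarrow> real) \<Rightarrow> (real \<Rightarrow> real) \<Rightarrow> 'e1::euclidean_space metric_field \<Rightarrow>
     'e2::euclidean_space metric_field \<Rightarrow> (real \<times> 'e1 \<times> 'e2) metric_field" where
  "warped_metric l1 l2 g1 g2 = (\<lambda>(t, x, y) (\<tau>, u, v) (\<tau>', u', v').
            \<tau> * \<tau>' + (l1 t)\<^sup>2 * g1 x u u' + (l2 t)\<^sup>2 * g2 y v v')"

text \<open>Coordinates of a single product chart. The factors \<open>W1\<close>, \<open>W2\<close>
  are open, but \<open>I\<close> may have end points, so the coordinate range \<open>S\<close> is
  only ample.\<close>

locale warped_chart =
  fixes I :: "real set" and l1 l2 :: "real \<Rightarrow> real"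
    and W1 :: "'e1::euclidean_space set" and W2 :: "'e2::euclidean_space set"
    and g1 :: "'e1 metric_field" and g2 :: "'e2 metric_field"
  assumes ample_I: "ample I"
    and l1: "smooth_on I l1" "\<And>t. t \<in> I \<Longrightarrow> 0 < l1 t"
    and l2: "smooth_on I l2" "\<And>t. t \<in> I \<Longrightarrow> 0 < l2 t"
    and W1: "open W1" and W2: "open W2"
    and g1: "\<And>x. x \<in> W1 \<Longrightarrow> inner_form (g1 x)" "\<And>u v. smooth_on W1 (\<lambda>x. g1 x u v)"
    and g2: "\<And>y. y \<in> W2 \<Longrightarrow> inner_form (g2 y)" "\<And>u v. smooth_on W2 (\<lambda>y. g2 y u v)"
begin

abbreviation "S \<equiv> I \<times> W1 \<times> W2"
abbreviation "G \<equiv> warped_metric l1 l2 g1 g2"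
abbreviation "dl1 t \<equiv> vector_derivative l1 (at t within I)"
abbreviation "dl2 t \<equiv> vector_derivative l2 (at t within I)"

lemma ample_W: "ample W1" "ample W2"
  using W1 W2 by (auto intro: ample_open)

lemma ample_S: "ample S"
  using ample_I ample_W by (intro ample_Times)

text \<open>Moving along a basis vector of one factor leaves the other coordinates inside their
  ranges, so both sides use the same set of admissible parameters. Several variables thus reduce to
  one factor at a time.\<close>

lemma pd_slice:
  assumes "t \<in> I" "x \<in> W1" "y \<in> W2"
  shows "pd S (1, 0) u (t, x, y) = pd I 1 (\<lambda>t. u (t, x, y)) t"
    and "pd S (0, i, 0) u (t, x, y) = pd W1 i (\<lambda>x. u (t, x, y)) x"
    and "pd S (0, 0, j) u (t, x, y) = pd W2 j (\<lambda>y. u (t, x, y)) y"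
  using assms by (simp_all add: pd_def zero_prod_def)

lemma pd_slice2:
  assumes "t \<in> I" "x \<in> W1" "y \<in> W2"
  shows "pd S (1, 0) (pd S (1, 0) u) (t, x, y) = pd I 1 (pd I 1 (\<lambda>t. u (t, x, y))) t"
    and "pd S (0, i, 0) (pd S (0, i', 0) u) (t, x, y) = pd W1 i (pd W1 i' (\<lambda>x. u (t, x, y))) x"
    and "pd S (0, 0, j) (pd S (0, 0, j') u) (t, x, y) = pd W2 j (pd W2 j' (\<lambda>y. u (t, x, y))) y"
  unfolding pd_slice[OF assms] using assms by (auto intro!: pd_cong simp: pd_slice)

lemma inner_form_G:
  assumes "t \<in> I" "x \<in> W1" "y \<in> W2"
  shows "inner_form (G (t, x, y))"
proof -
  have h1: "bilinear (g1 x)" "\<And>u v. g1 x u v = g1 x v u" "\<And>u. u \<noteq> 0 \<Longrightarrow> 0 < g1 x u u"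
    and h2: "bilinear (g2 y)" "\<And>u v. g2 y u v = g2 y v u" "\<And>u. u \<noteq> 0 \<Longrightarrow> 0 < g2 y u u"
    using g1(1)[OF assms(2)] g2(1)[OF assms(3)] unfolding inner_form_def by blast+
  have nn: "0 \<le> g1 x u u" "0 \<le> g2 y v v" for u v
    using h1(3)[of u] h2(3)[of v] bilinear_lzero[OF h1(1)] bilinear_lzero[OF h2(1)]
    by (cases "u = 0"; force)+
  have l: "0 < (l1 t)\<^sup>2" "0 < (l2 t)\<^sup>2" using l1(2) l2(2) assms by force+
  have "bilinear (G (t, x, y))"
    unfolding bilinear_def linear_iff warped_metric_def
    by (auto simp: bilinear_ladd[OF h1(1)] bilinear_radd[OF h1(1)] bilinear_lmul[OF h1(1)]
        bilinear_rmul[OF h1(1)] bilinear_ladd[OF h2(1)] bilinear_radd[OF h2(1)]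
        bilinear_lmul[OF h2(1)] bilinear_rmul[OF h2(1)] algebra_simps)
  moreover have "G (t, x, y) u v = G (t, x, y) v u" for u v
    using h1(2) h2(2) by (auto simp: warped_metric_def mult.commute split: prod.splits)
  moreover have "0 < G (t, x, y) w w" if "w \<noteq> 0" for w
  proof -
    obtain \<tau> u v where w: "w = (\<tau>, u, v)" by (metis prod.exhaust)
    have nn': "0 \<le> \<tau> * \<tau>" "0 \<le> (l1 t)\<^sup>2 * g1 x u u" "0 \<le> (l2 t)\<^sup>2 * g2 y v v"
      using nn by auto
    consider "\<tau> \<noteq> 0" | "u \<noteq> 0" | "v \<noteq> 0" using \<open>w \<noteq> 0\<close> w by (auto simp: zero_prod_def)
    then have "0 < \<tau> * \<tau> + (l1 t)\<^sup>2 * g1 x u u + (l2 t)\<^sup>2 * g2 y v v"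
    proof cases
      case 1
      then have "0 < \<tau> * \<tau>" by (simp add: zero_less_mult_iff) linarith
      with nn' show ?thesis by linarith
    next
      case 2
      with h1(3)[of u] l have "0 < (l1 t)\<^sup>2 * g1 x u u" by (intro mult_pos_pos) auto
      with nn' show ?thesis by linarith
    next
      case 3
      with h2(3)[of v] l have "0 < (l2 t)\<^sup>2 * g2 y v v" by (intro mult_pos_pos) auto
      with nn' show ?thesis by linarith
    qed
    with w show ?thesis by (simp add: warped_metric_def)
  qed
  ultimately show ?thesis unfolding inner_form_def by blast
qed

text \<open>The metric is block diagonal, so the representer of \<open>(\<tau>, u, v)\<close> is
  assembled from the representers \<open>w1\<close>, \<open>w2\<close> in the factors, divided by
  the squares of the warps.\<close>

lemma cometric_G:
  assumes "t \<in> I" "x \<in> W1" "y \<in> W2"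
  shows "cometric G (t, x, y) (\<tau>, u, v) (\<tau>', u', v') =
    \<tau> * \<tau>' + cometric g1 x u u' / (l1 t)\<^sup>2 + cometric g2 y v v' / (l2 t)\<^sup>2"
proof -
  obtain w1 where w1: "\<And>v. g1 x w1 v = u \<bullet> v"
    using inner_form_representer[OF g1(1)[OF assms(2)], of u] by blast
  obtain w2 where w2: "\<And>z. g2 y w2 z = v \<bullet> z"
    using inner_form_representer[OF g2(1)[OF assms(3)], of v] by blast
  have b: "bilinear (g1 x)" "bilinear (g2 y)" using g1(1) g2(1) assms by (auto simp: inner_form_def)
  have l: "l1 t \<noteq> 0" "l2 t \<noteq> 0" using l1(2) l2(2) assms by force+
  have "cometric G (t, x, y) (\<tau>, u, v) (\<tau>', u', v') =
      (\<tau>, w1 /\<^sub>R (l1 t)\<^sup>2, w2 /\<^sub>R (l2 t)\<^sup>2) \<bullet> (\<tau>', u', v')"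
    using l by (intro cometric_eqI inner_form_G assms)
      (auto simp: warped_metric_def bilinear_lmul[OF b(1)] bilinear_lmul[OF b(2)] w1 w2
        mult.assoc[symmetric])
  then show ?thesis
    by (simp add: cometric_eqI[of g1 x w1, OF g1(1)[OF assms(2)] w1]
        cometric_eqI[of g2 y w2, OF g2(1)[OF assms(3)] w2] divide_inverse mult.commute)
qed

lemma G_simps:
  assumes "t \<in> I" "x \<in> W1" "y \<in> W2"
  shows "G (t, x, y) (1, 0) (1, 0) = 1"
    "G (t, x, y) (1, 0) (0, i, 0) = 0" "G (t, x, y) (0, i, 0) (1, 0) = 0"
    "G (t, x, y) (1, 0) (0, 0, j) = 0" "G (t, x, y) (0, 0, j) (1, 0) = 0"
    "G (t, x, y) (0, i, 0) (0, 0, j) = 0" "G (t, x, y) (0, 0, j) (0, i, 0) = 0"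
    "G (t, x, y) (0, i, 0) (0, i', 0) = (l1 t)\<^sup>2 * g1 x i i'"
    "G (t, x, y) (0, 0, j) (0, 0, j') = (l2 t)\<^sup>2 * g2 y j j'"
proof -
  have b: "bilinear (g1 x)" "bilinear (g2 y)" using g1(1) g2(1) assms by (auto simp: inner_form_def)
  note [simp] = warped_metric_def zero_prod_def bilinear_lzero[OF b(1)] bilinear_lzero[OF b(2)]
    bilinear_rzero[OF b(1)] bilinear_rzero[OF b(2)]
  show "G (t, x, y) (1, 0) (1, 0) = 1"
    "G (t, x, y) (1, 0) (0, i, 0) = 0" "G (t, x, y) (0, i, 0) (1, 0) = 0"
    "G (t, x, y) (1, 0) (0, 0, j) = 0" "G (t, x, y) (0, 0, j) (1, 0) = 0"
    "G (t, x, y) (0, i, 0) (0, 0, j) = 0" "G (t, x, y) (0, 0, j) (0, i, 0) = 0"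
    "G (t, x, y) (0, i, 0) (0, i', 0) = (l1 t)\<^sup>2 * g1 x i i'"
    "G (t, x, y) (0, 0, j) (0, 0, j') = (l2 t)\<^sup>2 * g2 y j j'"
    by simp_all
qed

lemma cometric_G_simps:
  assumes "t \<in> I" "x \<in> W1" "y \<in> W2"
  shows "cometric G (t, x, y) (1, 0) (1, 0) = 1"
    "cometric G (t, x, y) (1, 0) (0, i, 0) = 0" "cometric G (t, x, y) (0, i, 0) (1, 0) = 0"
    "cometric G (t, x, y) (1, 0) (0, 0, j) = 0" "cometric G (t, x, y) (0, 0, j) (1, 0) = 0"
    "cometric G (t, x, y) (0, i, 0) (0, 0, j) = 0" "cometric G (t, x, y) (0, 0, j) (0, i, 0) = 0"
    "cometric G (t, x, y) (0, i, 0) (0, i', 0) = cometric g1 x i i' / (l1 t)\<^sup>2"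
    "cometric G (t, x, y) (0, 0, j) (0, 0, j') = cometric g2 y j j' / (l2 t)\<^sup>2"
  using cometric_zero[of g1 x, OF g1(1)] cometric_zero[of g2 y, OF g2(1)] assms
  by (simp_all add: zero_prod_def cometric_G[OF assms])

lemma pd_square:
  assumes "t \<in> I"
  shows "pd I 1 (\<lambda>t. (l1 t)\<^sup>2 * c) t = 2 * l1 t * dl1 t * c"
    and "pd I 1 (\<lambda>t. (l2 t)\<^sup>2 * c) t = 2 * l2 t * dl2 t * c"
  using smooth_on_has_vector_derivative[OF l1(1) ample_I assms]
    smooth_on_has_vector_derivative[OF l2(1) ample_I assms]
  by (auto intro!: pd_interval ample_I assms derivative_eq_intros
      simp: has_real_derivative_iff_has_vector_derivative[symmetric])

lemma pd_G:
  assumes txy: "t \<in> I" "x \<in> W1" "y \<in> W2" and "b \<in> Basis"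
  shows "pd S b (\<lambda>z. G z (1, 0) (1, 0)) (t, x, y) = 0"
    "pd S b (\<lambda>z. G z (1, 0) (0, i, 0)) (t, x, y) = 0"
    "pd S b (\<lambda>z. G z (0, i, 0) (1, 0)) (t, x, y) = 0"
    "pd S b (\<lambda>z. G z (1, 0) (0, 0, j)) (t, x, y) = 0"
    "pd S b (\<lambda>z. G z (0, 0, j) (1, 0)) (t, x, y) = 0"
    "pd S b (\<lambda>z. G z (0, i, 0) (0, 0, j)) (t, x, y) = 0"
    "pd S b (\<lambda>z. G z (0, 0, j) (0, i, 0)) (t, x, y) = 0"
proof -
  \<comment> \<open>The entries in question are constant on \<open>S\<close>, though perhaps not off
    \<open>S\<close>; \<open>pd\<close> sees only values on \<open>S\<close>.\<close>
  have 0: "pd S b h (t, x, y) = 0" if "\<And>t x y. t \<in> I \<Longrightarrow> x \<in> W1 \<Longrightarrow> y \<in> W2 \<Longrightarrow> h (t, x, y) = c"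
    for h :: "real \<times> 'e1 \<times> 'e2 \<Rightarrow> real" and c
    using pd_cong[of "(t, x, y)" S h "\<lambda>_. c" b] pd_const[OF ample_S, of "(t, x, y)" b c] that assms
    by auto
  show "pd S b (\<lambda>z. G z (1, 0) (1, 0)) (t, x, y) = 0"
    "pd S b (\<lambda>z. G z (1, 0) (0, i, 0)) (t, x, y) = 0"
    "pd S b (\<lambda>z. G z (0, i, 0) (1, 0)) (t, x, y) = 0"
    "pd S b (\<lambda>z. G z (1, 0) (0, 0, j)) (t, x, y) = 0"
    "pd S b (\<lambda>z. G z (0, 0, j) (1, 0)) (t, x, y) = 0"
    "pd S b (\<lambda>z. G z (0, i, 0) (0, 0, j)) (t, x, y) = 0"
    "pd S b (\<lambda>z. G z (0, 0, j) (0, i, 0)) (t, x, y) = 0"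
    by (rule 0, erule (2) G_simps)+
qed

lemma pd_G1:
  assumes txy: "t \<in> I" "x \<in> W1" "y \<in> W2"
  shows "pd S (1, 0) (\<lambda>z. G z (0, i, 0) (0, i', 0)) (t, x, y) = 2 * l1 t * dl1 t * g1 x i i'"
    "k \<in> Basis \<Longrightarrow> pd S (0, k, 0) (\<lambda>z. G z (0, i, 0) (0, i', 0)) (t, x, y) = (l1 t)\<^sup>2 * pd W1 k (\<lambda>x. g1 x i i') x"
    "m \<in> Basis \<Longrightarrow> pd S (0, 0, m) (\<lambda>z. G z (0, i, 0) (0, i', 0)) (t, x, y) = 0"
proof -
  have *: "pd S b (\<lambda>z. G z (0, i, 0) (0, i', 0)) (t, x, y) = pd S b (\<lambda>(t, x, y). (l1 t)\<^sup>2 * g1 x i i') (t, x, y)" for b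
    using assms by (intro pd_cong) (auto simp: G_simps)
  show "pd S (1, 0) (\<lambda>z. G z (0, i, 0) (0, i', 0)) (t, x, y) = 2 * l1 t * dl1 t * g1 x i i'"
    "k \<in> Basis \<Longrightarrow> pd S (0, k, 0) (\<lambda>z. G z (0, i, 0) (0, i', 0)) (t, x, y) = (l1 t)\<^sup>2 * pd W1 k (\<lambda>x. g1 x i i') x"
    "m \<in> Basis \<Longrightarrow> pd S (0, 0, m) (\<lambda>z. G z (0, i, 0) (0, i', 0)) (t, x, y) = 0"
    unfolding * using txy
    by (simp_all add: pd_slice pd_square pd_const ample_W pd_cmult g1(2))
qed

lemma pd_G2:
  assumes txy: "t \<in> I" "x \<in> W1" "y \<in> W2"
  shows "pd S (1, 0) (\<lambda>z. G z (0, 0, j) (0, 0, j')) (t, x, y) = 2 * l2 t * dl2 t * g2 y j j'"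
    "m \<in> Basis \<Longrightarrow> pd S (0, 0, m) (\<lambda>z. G z (0, 0, j) (0, 0, j')) (t, x, y) = (l2 t)\<^sup>2 * pd W2 m (\<lambda>y. g2 y j j') y"
    "k \<in> Basis \<Longrightarrow> pd S (0, k, 0) (\<lambda>z. G z (0, 0, j) (0, 0, j')) (t, x, y) = 0"
proof -
  have *: "pd S b (\<lambda>z. G z (0, 0, j) (0, 0, j')) (t, x, y) = pd S b (\<lambda>(t, x, y). (l2 t)\<^sup>2 * g2 y j j') (t, x, y)" for b
    using assms by (intro pd_cong) (auto simp: G_simps)
  show "pd S (1, 0) (\<lambda>z. G z (0, 0, j) (0, 0, j')) (t, x, y) = 2 * l2 t * dl2 t * g2 y j j'"
    "m \<in> Basis \<Longrightarrow> pd S (0, 0, m) (\<lambda>z. G z (0, 0, j) (0, 0, j')) (t, x, y) = (l2 t)\<^sup>2 * pd W2 m (\<lambda>y. g2 y j j') y"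
    "k \<in> Basis \<Longrightarrow> pd S (0, k, 0) (\<lambda>z. G z (0, 0, j) (0, 0, j')) (t, x, y) = 0"
    unfolding * using txy
    by (simp_all add: pd_slice pd_square pd_const ample_W pd_cmult g2(2))
qed

lemma Basis_simps:
  "(1, 0) \<in> (Basis :: (real \<times> 'e1 \<times> 'e2) set)"
  "i \<in> Basis \<Longrightarrow> (0, i, 0) \<in> (Basis :: (real \<times> 'e1 \<times> 'e2) set)"
  "j \<in> Basis \<Longrightarrow> (0, 0, j) \<in> (Basis :: (real \<times> 'e1 \<times> 'e2) set)"
  by (auto simp: Basis_prod_def)

lemma sum_Basis3:
  fixes f :: "real \<times> 'e1 \<times> 'e2 \<Rightarrow> 'c::comm_monoid_add"
  shows "(\<Sum>b\<in>Basis. f b) = f (1, 0) + ((\<Sum>i\<in>Basis. f (0, i, 0)) + (\<Sum>j\<in>Basis. f (0, 0, j)))"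
  by (simp add: sum_Basis_Times)

text \<open>The trace in the Laplacian meets only pairs of lower indices from the same factor, since
  the cometric is block diagonal; hence only these symbols appear. The effect of the warps is
  confined to the \<open>t\<close>-components \<open>- l1 l1' g1\<close> and
  \<open>- l2 l2' g2\<close>.\<close>

lemma christoffel_G:
  assumes txy: "t \<in> I" "x \<in> W1" "y \<in> W2"
  shows "christoffel S G (1, 0) (1, 0) (1, 0) (t, x, y) = 0"
    "k \<in> Basis \<Longrightarrow> christoffel S G (0, k, 0) (1, 0) (1, 0) (t, x, y) = 0"
    "m \<in> Basis \<Longrightarrow> christoffel S G (0, 0, m) (1, 0) (1, 0) (t, x, y) = 0"
    "i \<in> Basis \<Longrightarrow> i' \<in> Basis \<Longrightarrow>
      christoffel S G (1, 0) (0, i, 0) (0, i', 0) (t, x, y) = - (l1 t * dl1 t * g1 x i i')"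
    "i \<in> Basis \<Longrightarrow> i' \<in> Basis \<Longrightarrow> k \<in> Basis \<Longrightarrow>
      christoffel S G (0, k, 0) (0, i, 0) (0, i', 0) (t, x, y) = christoffel W1 g1 k i i' x"
    "i \<in> Basis \<Longrightarrow> i' \<in> Basis \<Longrightarrow> m \<in> Basis \<Longrightarrow>
      christoffel S G (0, 0, m) (0, i, 0) (0, i', 0) (t, x, y) = 0"
    "j \<in> Basis \<Longrightarrow> j' \<in> Basis \<Longrightarrow>
      christoffel S G (1, 0) (0, 0, j) (0, 0, j') (t, x, y) = - (l2 t * dl2 t * g2 y j j')"
    "j \<in> Basis \<Longrightarrow> j' \<in> Basis \<Longrightarrow> k \<in> Basis \<Longrightarrow>
      christoffel S G (0, k, 0) (0, 0, j) (0, 0, j') (t, x, y) = 0"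
    "j \<in> Basis \<Longrightarrow> j' \<in> Basis \<Longrightarrow> m \<in> Basis \<Longrightarrow>
      christoffel S G (0, 0, m) (0, 0, j) (0, 0, j') (t, x, y) = christoffel W2 g2 m j j' y"
proof -
  have l: "l1 t \<noteq> 0" "l2 t \<noteq> 0" using l1(2) l2(2) txy by force+
  note simps = christoffel_def sum_Basis3 cometric_G_simps[OF txy] pd_G[OF txy] Basis_simps
    pd_G1[OF txy] pd_G2[OF txy]
  show "christoffel S G (1, 0) (1, 0) (1, 0) (t, x, y) = 0"
    "k \<in> Basis \<Longrightarrow> christoffel S G (0, k, 0) (1, 0) (1, 0) (t, x, y) = 0"
    "m \<in> Basis \<Longrightarrow> christoffel S G (0, 0, m) (1, 0) (1, 0) (t, x, y) = 0"
    "i \<in> Basis \<Longrightarrow> i' \<in> Basis \<Longrightarrow>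
      christoffel S G (1, 0) (0, i, 0) (0, i', 0) (t, x, y) = - (l1 t * dl1 t * g1 x i i')"
    "i \<in> Basis \<Longrightarrow> i' \<in> Basis \<Longrightarrow> m \<in> Basis \<Longrightarrow>
      christoffel S G (0, 0, m) (0, i, 0) (0, i', 0) (t, x, y) = 0"
    "j \<in> Basis \<Longrightarrow> j' \<in> Basis \<Longrightarrow>
      christoffel S G (1, 0) (0, 0, j) (0, 0, j') (t, x, y) = - (l2 t * dl2 t * g2 y j j')"
    "j \<in> Basis \<Longrightarrow> j' \<in> Basis \<Longrightarrow> k \<in> Basis \<Longrightarrow>
      christoffel S G (0, k, 0) (0, 0, j) (0, 0, j') (t, x, y) = 0"
    by (simp_all add: simps)
  \<comment> \<open>The factor \<open>(l1 t)^2\<close> in the derivatives of the metric cancels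
    against its inverse in the cometric.\<close>
  show "i \<in> Basis \<Longrightarrow> i' \<in> Basis \<Longrightarrow> k \<in> Basis \<Longrightarrow>
      christoffel S G (0, k, 0) (0, i, 0) (0, i', 0) (t, x, y) = christoffel W1 g1 k i i' x"
    using l by (simp add: simps) (intro sum.cong refl, simp add: field_simps)
  show "j \<in> Basis \<Longrightarrow> j' \<in> Basis \<Longrightarrow> m \<in> Basis \<Longrightarrow>
      christoffel S G (0, 0, m) (0, 0, j) (0, 0, j') (t, x, y) = christoffel W2 g2 m j j' y"
    using l by (simp add: simps) (intro sum.cong refl, simp add: field_simps)
qed

lemma norm2_differential_G:
  assumes txy: "t \<in> I" "x \<in> W1" "y \<in> W2"
  shows "norm2_differential S G u (t, x, y) =
    pd I 1 (\<lambda>t. u (t, x, y)) t \<bullet> pd I 1 (\<lambda>t. u (t, x, y)) t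
    + norm2_differential W1 g1 (\<lambda>x. u (t, x, y)) x / (l1 t)\<^sup>2
    + norm2_differential W2 g2 (\<lambda>y. u (t, x, y)) y / (l2 t)\<^sup>2"
  by (simp add: norm2_differential_def sum_Basis3 cometric_G_simps[OF txy] pd_slice[OF txy]
      sum_divide_distrib)

text \<open>Tracing \<open>- l1 l1' g1\<close> against \<open>cometric g1 / l1^2\<close> yields, by
  \<open>cometric_trace\<close>, the dimension of the first factor times \<open>l1' / l1\<close>.
  With the analogous second term this is the logarithmic derivative of \<open>F\<close>.\<close>

lemma laplace_beltrami_G:
  assumes txy: "t \<in> I" "x \<in> W1" "y \<in> W2"
  shows "laplace_beltrami S G u (t, x, y) =
    pd I 1 (pd I 1 (\<lambda>t. u (t, x, y))) t
    + (DIM('e1) * dl1 t / l1 t + DIM('e2) * dl2 t / l2 t) *\<^sub>R pd I 1 (\<lambda>t. u (t, x, y)) t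
    + laplace_beltrami W1 g1 (\<lambda>x. u (t, x, y)) x /\<^sub>R (l1 t)\<^sup>2
    + laplace_beltrami W2 g2 (\<lambda>y. u (t, x, y)) y /\<^sub>R (l2 t)\<^sup>2"
proof -
  have l: "l1 t \<noteq> 0" "l2 t \<noteq> 0" using l1(2) l2(2) txy by force+
  let ?D = "pd I 1 (\<lambda>t. u (t, x, y)) t"
  have "laplace_beltrami S G u (t, x, y) = pd I 1 (pd I 1 (\<lambda>t. u (t, x, y))) t
      + ((\<Sum>b\<in>Basis. \<Sum>c\<in>Basis. (cometric g1 x b c / (l1 t)\<^sup>2) *\<^sub>R
           (pd W1 b (pd W1 c (\<lambda>x. u (t, x, y))) x
            - (- (l1 t * dl1 t * g1 x b c) *\<^sub>R ?D
               + (\<Sum>a\<in>Basis. christoffel W1 g1 a b c x *\<^sub>R pd W1 a (\<lambda>x. u (t, x, y)) x))))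
      + (\<Sum>b\<in>Basis. \<Sum>c\<in>Basis. (cometric g2 y b c / (l2 t)\<^sup>2) *\<^sub>R
           (pd W2 b (pd W2 c (\<lambda>y. u (t, x, y))) y
            - (- (l2 t * dl2 t * g2 y b c) *\<^sub>R ?D
               + (\<Sum>a\<in>Basis. christoffel W2 g2 a b c y *\<^sub>R pd W2 a (\<lambda>y. u (t, x, y)) y)))))"
    by (simp add: laplace_beltrami_def sum_Basis3 cometric_G_simps[OF txy]
        pd_slice2[OF txy] christoffel_G[OF txy] cong: sum.cong)
      (simp add: pd_slice[OF txy])
  also have "(\<Sum>b\<in>Basis. \<Sum>c\<in>Basis. (cometric g1 x b c / (l1 t)\<^sup>2) *\<^sub>R
           (pd W1 b (pd W1 c (\<lambda>x. u (t, x, y))) x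
            - (- (l1 t * dl1 t * g1 x b c) *\<^sub>R ?D
               + (\<Sum>a\<in>Basis. christoffel W1 g1 a b c x *\<^sub>R pd W1 a (\<lambda>x. u (t, x, y)) x))))
      = (\<Sum>b\<in>Basis. \<Sum>c\<in>Basis. ((dl1 t / l1 t) * (cometric g1 x b c * g1 x b c)) *\<^sub>R ?D
          + (cometric g1 x b c *\<^sub>R (pd W1 b (pd W1 c (\<lambda>x. u (t, x, y))) x
            - (\<Sum>a\<in>Basis. christoffel W1 g1 a b c x *\<^sub>R pd W1 a (\<lambda>x. u (t, x, y)) x))) /\<^sub>R (l1 t)\<^sup>2)"
    using l by (intro sum.cong refl) (simp add: algebra_simps power2_eq_square divide_inverse)
  also have "\<dots> = ((dl1 t / l1 t) * (\<Sum>b\<in>Basis. \<Sum>c\<in>Basis. cometric g1 x b c * g1 x b c)) *\<^sub>R ?D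
      + laplace_beltrami W1 g1 (\<lambda>x. u (t, x, y)) x /\<^sub>R (l1 t)\<^sup>2"
    by (simp add: laplace_beltrami_def sum.distrib scaleR_sum_left scaleR_sum_right sum_distrib_left)
  also have "(\<Sum>b\<in>Basis. \<Sum>c\<in>Basis. (cometric g2 y b c / (l2 t)\<^sup>2) *\<^sub>R
           (pd W2 b (pd W2 c (\<lambda>y. u (t, x, y))) y
            - (- (l2 t * dl2 t * g2 y b c) *\<^sub>R ?D
               + (\<Sum>a\<in>Basis. christoffel W2 g2 a b c y *\<^sub>R pd W2 a (\<lambda>y. u (t, x, y)) y))))
      = (\<Sum>b\<in>Basis. \<Sum>c\<in>Basis. ((dl2 t / l2 t) * (cometric g2 y b c * g2 y b c)) *\<^sub>R ?D
          + (cometric g2 y b c *\<^sub>R (pd W2 b (pd W2 c (\<lambda>y. u (t, x, y))) y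
            - (\<Sum>a\<in>Basis. christoffel W2 g2 a b c y *\<^sub>R pd W2 a (\<lambda>y. u (t, x, y)) y))) /\<^sub>R (l2 t)\<^sup>2)"
    using l by (intro sum.cong refl) (simp add: algebra_simps power2_eq_square divide_inverse)
  also have "\<dots> = ((dl2 t / l2 t) * (\<Sum>b\<in>Basis. \<Sum>c\<in>Basis. cometric g2 y b c * g2 y b c)) *\<^sub>R ?D
      + laplace_beltrami W2 g2 (\<lambda>y. u (t, x, y)) y /\<^sub>R (l2 t)\<^sup>2"
    by (simp add: laplace_beltrami_def sum.distrib scaleR_sum_left scaleR_sum_right sum_distrib_left)
  finally show ?thesis
    unfolding cometric_trace[of g1 x, OF g1(1)[OF txy(2)]] cometric_trace[of g2 y, OF g2(1)[OF txy(3)]]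
    by (simp add: algebra_simps)
qed

end

section \<open>The harmonic map equation of the join\<close>

lemma laplace_beltrami_cong:
  assumes "x \<in> S" "\<And>y. y \<in> S \<Longrightarrow> u y = v y"
  shows "laplace_beltrami S g u x = laplace_beltrami S g v x"
proof -
  have "pd S b u y = pd S b v y" if "y \<in> S" for b y
    using pd_cong[OF that assms(2)] by simp
  moreover from this have "pd S b (pd S c u) x = pd S b (pd S c v) x" for b c
    using assms(1) by (rule_tac pd_cong) auto
  ultimately show ?thesis using assms(1) by (simp add: laplace_beltrami_def)
qed

lemma norm2_differential_cong:
  assumes "x \<in> S" "\<And>y. y \<in> S \<Longrightarrow> u y = v y"
  shows "norm2_differential S g u x = norm2_differential S g v x"
  using pd_cong[of x S u v] assms by (simp add: norm2_differential_def)

lemma laplace_beltrami_affine: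
  assumes "smooth_on S u" "ample S" "x \<in> S" "bounded_linear L"
  shows "laplace_beltrami S g (\<lambda>x. L (u x) + k) x = L (laplace_beltrami S g u x)"
proof -
  interpret L: bounded_linear L by fact
  have 1: "pd S b (\<lambda>x. L (u x) + k) y = L (pd S b u y)" if "b \<in> Basis" "y \<in> S" for b y
    using pd_affine[OF assms(1,2) that(2,1) assms(4)] .
  have "pd S b (pd S c (\<lambda>x. L (u x) + k)) x = pd S b (\<lambda>x. L (pd S c u x) + 0) x"
    if "c \<in> Basis" for b c
    using assms(3) 1 that by (rule_tac pd_cong) auto
  then have 2: "pd S b (pd S c (\<lambda>x. L (u x) + k)) x = L (pd S b (pd S c u) x)"
    if "b \<in> Basis" "c \<in> Basis" for b c
    using pd_affine[OF smooth_on_pd[OF assms(1,2)] assms(2,3) _ assms(4), of c b 0] that by simp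
  show ?thesis
    unfolding laplace_beltrami_def
    using 1 2 assms(3) by (simp add: L.sum L.scaleR L.diff cong: sum.cong)
qed

lemma norm2_differential_affine:
  assumes "smooth_on S u" "ample S" "x \<in> S" "bounded_linear L" "\<And>v w. L v \<bullet> L w = q * (v \<bullet> w)"
  shows "norm2_differential S g (\<lambda>x. L (u x) + k) x = q * norm2_differential S g u x"
  unfolding norm2_differential_def
  by (simp add: pd_affine[OF assms(1-3) _ assms(4)] assms(5) sum_distrib_left mult.left_commute
      cong: sum.cong)

lemma inner_complex_mult: "(a * b) \<bullet> (a * c) = (cmod a)\<^sup>2 * (b \<bullet> (c :: complex))"
  unfolding cmod_power2 inner_complex_def by (simp add: power2_eq_square algebra_simps)

lemma inner_vector_smult_left: "(a *s v) \<bullet> (a *s w) = (cmod a)\<^sup>2 * (v \<bullet> w)"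
  by (simp add: inner_vec_def inner_complex_mult sum_distrib_left)

text \<open>For a unit vector \<open>v\<close> this says that \<open>a\<close> to
  \<open>a *s v\<close> is a real isometric embedding of the complex plane, the reason why the
  values of the eigenmaps drop out of the equation.\<close>

lemma inner_vector_smult_right: "(a *s v) \<bullet> (b *s v) = (a \<bullet> b) * (norm (v :: complex^'n))\<^sup>2"
proof -
  have "(a *s v) \<bullet> (b *s v) = (\<Sum>i\<in>UNIV. (a \<bullet> b) * (v $ i \<bullet> v $ i))"
    using inner_complex_mult[of "v $ i" a b for i]
    by (simp add: inner_vec_def mult.commute power2_norm_eq_inner)
  then show ?thesis by (simp add: inner_vec_def sum_distrib_left power2_norm_eq_inner)
qed

lemma norm_vector_smult: "norm (a *s (v :: complex^'n)) = cmod a * norm v"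
  using inner_vector_smult_left[of a v v]
  by (simp add: power2_norm_eq_inner[symmetric] power_mult_distrib[symmetric])

lemma bounded_bilinear_vector_smult:
  "bounded_bilinear (\<lambda>a v. a *s (v :: complex^'n))"
  by (rule bounded_bilinear.intro)
    (auto simp: vec_eq_iff algebra_simps norm_vector_smult intro: exI[of _ 1])

text \<open>The ordinary differential equation of the overview, with
  \<open>(F \<gamma>')' / F\<close> multiplied out and \<open>F' / F\<close> written through the
  warps.\<close>

definition join_eq where
  "join_eq k1 k2 d1 d2 l1 l2 I \<gamma> t \<longleftrightarrow>
    vector_derivative (\<lambda>t. vector_derivative \<gamma> (at t within I)) (at t within I)
    + (k1 * vector_derivative l1 (at t within I) / l1 t
       + k2 * vector_derivative l2 (at t within I) / l2 t) *\<^sub>R vector_derivative \<gamma> (at t within I)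
    - ((d1 / (l1 t)\<^sup>2) *\<^sub>R fst (\<gamma> t), (d2 / (l2 t)\<^sup>2) *\<^sub>R snd (\<gamma> t))
    + ((norm (vector_derivative \<gamma> (at t within I)))\<^sup>2 + 2 * potential d1 d2 l1 l2 t (\<gamma> t)) *\<^sub>R \<gamma> t = 0"

context warped_chart
begin

text \<open>At fixed \<open>(x, y)\<close> the map \<open>M\<close> is a linear isometry because
  \<open>\<phi>1 x\<close> and \<open>\<phi>2 y\<close> are unit vectors. Both sides of the harmonic
  map equation lie in its image, so injectivity strips off \<open>M\<close> and leaves an equation
  in which \<open>x\<close> and \<open>y\<close> no longer occur.\<close>

lemma join_laplacian:
  fixes \<phi>1 :: "'e1 \<Rightarrow> complex^'n1" and \<phi>2 :: "'e2 \<Rightarrow> complex^'n2"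
  assumes \<gamma>: "smooth_on I \<gamma>" and \<phi>: "smooth_on W1 \<phi>1" "smooth_on W2 \<phi>2"
    and txy: "t \<in> I" "x \<in> W1" "y \<in> W2"
    and n: "norm (\<phi>1 x) = 1" "norm (\<phi>2 y) = 1"
    and e1: "norm2_differential W1 g1 \<phi>1 x = d1" "laplace_beltrami W1 g1 \<phi>1 x = - (d1 *\<^sub>R \<phi>1 x)"
    and e2: "norm2_differential W2 g2 \<phi>2 y = d2" "laplace_beltrami W2 g2 \<phi>2 y = - (d2 *\<^sub>R \<phi>2 y)"
    and u: "\<And>t x y. t \<in> I \<Longrightarrow> x \<in> W1 \<Longrightarrow> y \<in> W2 \<Longrightarrow> u (t, x, y) = (fst (\<gamma> t) *s \<phi>1 x, snd (\<gamma> t) *s \<phi>2 y)"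
  shows "laplace_beltrami S G u (t, x, y) = - (norm2_differential S G u (t, x, y) *\<^sub>R u (t, x, y))
    \<longleftrightarrow> join_eq DIM('e1) DIM('e2) d1 d2 l1 l2 I \<gamma> t"
proof -
  interpret sm: bounded_bilinear "\<lambda>a v. a *s (v :: complex^'n)"
    by (rule bounded_bilinear_vector_smult)
  define M where "M w = (fst w *s \<phi>1 x, snd w *s \<phi>2 y)" for w
  \<comment> \<open>At fixed \<open>t\<close>, the maps \<open>L1\<close> and \<open>L2\<close> are
    the linear parts of the join in \<open>\<phi>1\<close> and \<open>\<phi>2\<close>; they scale
    inner products by \<open>|z_1|^2\<close> and \<open>|z_2|^2\<close>, which turns
    \<open>d1\<close> and \<open>d2\<close> into the potential.\<close>
  define L1 where "L1 v = (fst (\<gamma> t) *s v, 0 :: complex^'n2)" for v :: "complex^'n1"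
  define L2 where "L2 v = (0 :: complex^'n1, snd (\<gamma> t) *s v)" for v :: "complex^'n2"
  have bl: "bounded_linear M" "bounded_linear L1" "bounded_linear L2"
    unfolding M_def L1_def L2_def
    by (auto intro!: bounded_linear_Pair bounded_linear_zero
        bounded_linear_compose[OF bounded_bilinear.bounded_linear_left[OF bounded_bilinear_vector_smult]]
        bounded_bilinear.bounded_linear_right[OF bounded_bilinear_vector_smult]
        bounded_linear_fst bounded_linear_snd)
  interpret M: bounded_linear M by fact
  have Min: "M v \<bullet> M w = v \<bullet> w" for v w
    unfolding M_def by (simp add: inner_vector_smult_right n inner_prod_def)
  have M0: "M w = 0 \<longleftrightarrow> w = 0" for w using Min[of w w] by (metis inner_eq_zero_iff M.zero)
  have L1in: "L1 v \<bullet> L1 w = (cmod (fst (\<gamma> t)))\<^sup>2 * (v \<bullet> w)"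
    and L2in: "L2 v' \<bullet> L2 w' = (cmod (snd (\<gamma> t)))\<^sup>2 * (v' \<bullet> w')" for v w v' w'
    unfolding L1_def L2_def by (simp_all add: inner_vector_smult_left)
  have D1: "pd I 1 \<gamma> s = vector_derivative \<gamma> (at s within I)" if "s \<in> I" for s
    using pd_interval[OF ample_I that smooth_on_has_vector_derivative[OF \<gamma> ample_I that]] .
  have D2: "pd I 1 (pd I 1 \<gamma>) t = vector_derivative (\<lambda>t. vector_derivative \<gamma> (at t within I)) (at t within I)"
    using pd_cong[OF txy(1) D1, where b=1] pd_interval[OF ample_I txy(1)
      smooth_on_has_vector_derivative[OF smooth_on_vector_derivative[OF \<gamma> ample_I] ample_I txy(1)]]
    by simp
  have "pd I 1 (\<lambda>t. u (t, x, y)) s = pd I 1 (\<lambda>t. M (\<gamma> t) + 0) s" if "s \<in> I" for s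
    using that u txy by (intro pd_cong) (auto simp: M_def)
  then have t1: "pd I 1 (\<lambda>t. u (t, x, y)) s = M (pd I 1 \<gamma> s)" if "s \<in> I" for s
    using pd_affine[OF \<gamma> ample_I that _ bl(1), where b=1 and k=0] that by simp
  have "pd I 1 (pd I 1 (\<lambda>t. u (t, x, y))) t = pd I 1 (\<lambda>t. M (pd I 1 \<gamma> t) + 0) t"
    using t1 txy by (rule_tac pd_cong) auto
  also have "\<dots> = M (pd I 1 (pd I 1 \<gamma>) t)"
    using pd_affine[OF smooth_on_pd[OF \<gamma> ample_I] ample_I txy(1) _ bl(1), of 1 1 0] by simp
  finally have t2: "pd I 1 (pd I 1 (\<lambda>t. u (t, x, y))) t = M (pd I 1 (pd I 1 \<gamma>) t)" .
  have u1: "u (t, x', y) = L1 (\<phi>1 x') + (0, snd (\<gamma> t) *s \<phi>2 y)" if "x' \<in> W1" for x'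
    using u txy that by (simp add: L1_def)
  have u2: "u (t, x, y') = L2 (\<phi>2 y') + (fst (\<gamma> t) *s \<phi>1 x, 0)" if "y' \<in> W2" for y'
    using u txy that by (simp add: L2_def)
  have lb: "laplace_beltrami W1 g1 (\<lambda>x. u (t, x, y)) x = L1 (- (d1 *\<^sub>R \<phi>1 x))"
      "laplace_beltrami W2 g2 (\<lambda>y. u (t, x, y)) y = L2 (- (d2 *\<^sub>R \<phi>2 y))"
    using laplace_beltrami_affine[OF \<phi>(1) ample_W(1) txy(2) bl(2)]
      laplace_beltrami_affine[OF \<phi>(2) ample_W(2) txy(3) bl(3)]
      laplace_beltrami_cong[OF txy(2) u1] laplace_beltrami_cong[OF txy(3) u2] e1 e2 by simp_all
  have nd: "norm2_differential W1 g1 (\<lambda>x. u (t, x, y)) x = (cmod (fst (\<gamma> t)))\<^sup>2 * d1"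
      "norm2_differential W2 g2 (\<lambda>y. u (t, x, y)) y = (cmod (snd (\<gamma> t)))\<^sup>2 * d2"
    using norm2_differential_affine[OF \<phi>(1) ample_W(1) txy(2) bl(2) L1in]
      norm2_differential_affine[OF \<phi>(2) ample_W(2) txy(3) bl(3) L2in]
      norm2_differential_cong[OF txy(2) u1] norm2_differential_cong[OF txy(3) u2] e1 e2 by simp_all
  define D where "D = vector_derivative \<gamma> (at t within I)"
  define DD where "DD = vector_derivative (\<lambda>t. vector_derivative \<gamma> (at t within I)) (at t within I)"
  define \<mu> where "\<mu> = DIM('e1) * dl1 t / l1 t + DIM('e2) * dl2 t / l2 t"
  define e where "e = (norm D)\<^sup>2 + 2 * potential d1 d2 l1 l2 t (\<gamma> t)"
  define \<Lambda> where "\<Lambda> = ((d1 / (l1 t)\<^sup>2) *\<^sub>R fst (\<gamma> t), (d2 / (l2 t)\<^sup>2) *\<^sub>R snd (\<gamma> t))"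
  have ut: "u (t, x, y) = M (\<gamma> t)" using u txy by (simp add: M_def)
  have nd': "norm2_differential S G u (t, x, y) = e"
    unfolding norm2_differential_G[OF txy] t1[OF txy(1)] nd Min D1[OF txy(1)] e_def D_def
    by (simp add: power2_norm_eq_inner[symmetric] potential_def mult_ac)
  have "(d / r) *\<^sub>R a *s v = (a *s (d *\<^sub>R v)) /\<^sub>R r" for d r :: real and a :: complex and v :: "complex^'n"
    by (simp add: vec_eq_iff divide_inverse mult.commute)
  then have "M \<Lambda> = - (L1 (- (d1 *\<^sub>R \<phi>1 x)) /\<^sub>R (l1 t)\<^sup>2 + L2 (- (d2 *\<^sub>R \<phi>2 y)) /\<^sub>R (l2 t)\<^sup>2)"
    unfolding M_def \<Lambda>_def L1_def L2_def
    by (simp add: vec_eq_iff divide_inverse algebra_simps)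
  then have lb': "laplace_beltrami S G u (t, x, y) = M (DD + \<mu> *\<^sub>R D - \<Lambda>)"
    unfolding laplace_beltrami_G[OF txy] t1[OF txy(1)] t2 lb D2 D1[OF txy(1)]
    by (simp add: M.add M.diff M.scaleR DD_def D_def \<mu>_def)
  have "laplace_beltrami S G u (t, x, y) = - (norm2_differential S G u (t, x, y) *\<^sub>R u (t, x, y))
    \<longleftrightarrow> M (DD + \<mu> *\<^sub>R D - \<Lambda> + e *\<^sub>R \<gamma> t) = 0"
    unfolding lb' nd' ut M.add[of _ "e *\<^sub>R \<gamma> t"] M.scaleR[of e "\<gamma> t"] by (simp add: eq_neg_iff_add_eq_0)
  then show ?thesis unfolding M0 join_eq_def DD_def D_def \<mu>_def \<Lambda>_def e_def .
qed

end

section \<open>From coordinate expressions to the product atlas\<close>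

lemma riemannian_chart_inv_into:
  assumes "riemannian_chart X c"
  shows "inj_on (chart_map c) (chart_dom c)"
    "p \<in> chart_dom c \<Longrightarrow> inv_into (chart_dom c) (chart_map c) (chart_map c p) = p"
    "p \<in> chart_dom c \<Longrightarrow> in_chart c f (chart_map c p) = f p"
proof -
  have "openin X (chart_dom c)"
    "homeomorphic_map (subtopology X (chart_dom c)) (top_of_set (chart_range c)) (chart_map c)"
    using assms by (auto simp: riemannian_chart_def)
  then show *: "inj_on (chart_map c) (chart_dom c)"
    using homeomorphic_imp_injective_map openin_subset topspace_subtopology_subset by metis
  then show "p \<in> chart_dom c \<Longrightarrow> inv_into (chart_dom c) (chart_map c) (chart_map c p) = p"
    "p \<in> chart_dom c \<Longrightarrow> in_chart c f (chart_map c p) = f p"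
    by (simp_all add: in_chart_def)
qed

lemma riemannian_chart_warped_chart:
  assumes "ample I" "smooth_on I l1" "\<And>t. t \<in> I \<Longrightarrow> 0 < l1 t" "smooth_on I l2" "\<And>t. t \<in> I \<Longrightarrow> 0 < l2 t"
    "riemannian_chart X1 c1" "riemannian_chart X2 c2"
  shows "warped_chart I l1 l2 (chart_range c1) (chart_range c2) (chart_metric c1) (chart_metric c2)"
  using assms by unfold_locales (auto simp: riemannian_chart_def inner_form_def)

definition product_chart where
  "product_chart I l1 l2 c1 c2 = RChart (I \<times> chart_dom c1 \<times> chart_dom c2)
         (\<lambda>(t, p, q). (t, chart_map c1 p, chart_map c2 q))
         (warped_metric l1 l2 (chart_metric c1) (chart_metric c2))"

lemma warped_product_eq: "warped_product I l1 l2 A1 A2 = (\<lambda>(c1, c2). product_chart I l1 l2 c1 c2) ` (A1 \<times> A2)"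
  by (simp add: warped_product_def product_chart_def warped_metric_def)

lemma product_chart_simps:
  "chart_dom (product_chart I l1 l2 c1 c2) = I \<times> chart_dom c1 \<times> chart_dom c2"
  "chart_map (product_chart I l1 l2 c1 c2) (t, p, q) = (t, chart_map c1 p, chart_map c2 q)"
  "chart_metric (product_chart I l1 l2 c1 c2) = warped_metric l1 l2 (chart_metric c1) (chart_metric c2)"
  "chart_range (product_chart I l1 l2 c1 c2) = I \<times> chart_range c1 \<times> chart_range c2"
  by (auto simp: product_chart_def chart_range_def image_iff split: prod.splits)

lemma in_chart_product:
  assumes "inj_on (chart_map c1) (chart_dom c1)" "inj_on (chart_map c2) (chart_dom c2)"
    "t \<in> I" "x \<in> chart_range c1" "y \<in> chart_range c2"
  shows "in_chart (product_chart I l1 l2 c1 c2) (G_map \<gamma> f1 f2) (t, x, y) =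
    (fst (\<gamma> t) *s in_chart c1 f1 x, snd (\<gamma> t) *s in_chart c2 f2 y)"
proof -
  obtain p q where pq: "p \<in> chart_dom c1" "x = chart_map c1 p" "q \<in> chart_dom c2" "y = chart_map c2 q"
    using assms(4,5) by (auto simp: chart_range_def)
  have "inj_on (chart_map (product_chart I l1 l2 c1 c2)) (chart_dom (product_chart I l1 l2 c1 c2))"
    using assms(1,2) by (auto simp: inj_on_def product_chart_simps)
  from inv_into_f_eq[OF this, of "(t, p, q)" "(t, x, y)"] pq assms show ?thesis
    by (simp add: in_chart_def product_chart_simps G_map_def)
qed

text \<open>Smoothness and unit length of the join come from those of \<open>\<gamma>\<close> and
  the eigenmaps. What remains is a pointwise equation that depends on the point only through
  \<open>t\<close>.\<close>

lemma harmonic_join_iff: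
  fixes A1 :: "('m1, 'e1::euclidean_space) rchart set" and A2 :: "('m2, 'e2::euclidean_space) rchart set"
    and f1 :: "'m1 \<Rightarrow> complex^'n1" and f2 :: "'m2 \<Rightarrow> complex^'n2"
  assumes M: "riemannian_manifold X1 A1" "riemannian_manifold X2 A2"
    and f: "eigenmap A1 d1 f1" "eigenmap A2 d2 f2"
    and I: "ample I" and l: "smooth_on I l1" "\<And>t. t \<in> I \<Longrightarrow> 0 < l1 t"
      "smooth_on I l2" "\<And>t. t \<in> I \<Longrightarrow> 0 < l2 t"
    and \<gamma>: "smooth_on I \<gamma>" "\<gamma> ` I \<subseteq> sphere 0 1"
  shows "harmonic_sphere_map (warped_product I l1 l2 A1 A2) (G_map \<gamma> f1 f2) \<longleftrightarrow>
    (\<forall>t\<in>I. join_eq DIM('e1) DIM('e2) d1 d2 l1 l2 I \<gamma> t)"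
proof -
  let ?c = "product_chart I l1 l2"
  have c: "riemannian_chart X1 c1" "riemannian_chart X2 c2" if "c1 \<in> A1" "c2 \<in> A2" for c1 c2
    using M that by (auto simp: riemannian_manifold_def)
  have sm: "smooth_on (chart_range c1) (in_chart c1 f1)" "smooth_on (chart_range c2) (in_chart c2 f2)"
    if "c1 \<in> A1" "c2 \<in> A2" for c1 c2
    using f that by (auto simp: eigenmap_def smooth_map_def)
  have n: "norm (f1 p) = 1" "norm (f2 q) = 1" if "c1 \<in> A1" "c2 \<in> A2" "p \<in> chart_dom c1" "q \<in> chart_dom c2" for c1 c2 p q
    using f that by (auto simp: eigenmap_def)
  have ic: "in_chart (?c c1 c2) (G_map \<gamma> f1 f2) (t, x, y) =
      (fst (\<gamma> t) *s in_chart c1 f1 x, snd (\<gamma> t) *s in_chart c2 f2 y)"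
    if "c1 \<in> A1" "c2 \<in> A2" "t \<in> I" "x \<in> chart_range c1" "y \<in> chart_range c2" for c1 c2 t x y
    using that c[OF that(1,2)] by (intro in_chart_product) (auto dest: riemannian_chart_inv_into(1))
  have smooth: "smooth_map (warped_product I l1 l2 A1 A2) (G_map \<gamma> f1 f2)"
    unfolding smooth_map_def warped_product_eq
  proof clarify
    fix c1 c2 assume cc: "c1 \<in> A1" "c2 \<in> A2"
    have "smooth_on (I \<times> chart_range c1 \<times> chart_range c2)
      (\<lambda>z. (fst (\<gamma> (fst z)) *s in_chart c1 f1 (fst (snd z)), snd (\<gamma> (fst z)) *s in_chart c2 f2 (snd (snd z))))"
      by (intro smooth_on_Pair smooth_on_bilinear[OF bounded_bilinear_vector_smult]
          smooth_on_linear_compose[OF _ bounded_linear_fst] smooth_on_linear_compose[OF _ bounded_linear_snd]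
          smooth_on_compose_linear[OF \<gamma>(1) bounded_linear_fst]
          smooth_on_compose_linear[OF sm(1)[OF cc] bounded_linear_compose[OF bounded_linear_fst bounded_linear_snd]]
          smooth_on_compose_linear[OF sm(2)[OF cc] bounded_linear_compose[OF bounded_linear_snd bounded_linear_snd]]) auto
    then show "smooth_on (chart_range (?c c1 c2)) (in_chart (?c c1 c2) (G_map \<gamma> f1 f2))"
      unfolding product_chart_simps by (rule smooth_on_cong) (auto simp: ic cc)
  qed
  have sph: "G_map \<gamma> f1 f2 (t, p, q) \<in> sphere 0 1"
    if "c1 \<in> A1" "c2 \<in> A2" "p \<in> chart_dom c1" "q \<in> chart_dom c2" "t \<in> I" for c1 c2 p q t
  proof -
    have "norm (\<gamma> t) = 1" using \<gamma>(2) that by auto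
    then show ?thesis using n[OF that(1-4)] by (simp add: G_map_def norm_prod_def norm_vector_smult)
  qed
  have key: "laplacian (?c c1 c2) (G_map \<gamma> f1 f2) (t, p, q) =
      - (energy_density (?c c1 c2) (G_map \<gamma> f1 f2) (t, p, q) *\<^sub>R G_map \<gamma> f1 f2 (t, p, q))
      \<longleftrightarrow> join_eq DIM('e1) DIM('e2) d1 d2 l1 l2 I \<gamma> t"
    if cc: "c1 \<in> A1" "c2 \<in> A2" and pq: "p \<in> chart_dom c1" "q \<in> chart_dom c2" and t: "t \<in> I" for c1 c2 p q t
  proof -
    interpret warped_chart I l1 l2 "chart_range c1" "chart_range c2" "chart_metric c1" "chart_metric c2"
      using riemannian_chart_warped_chart[OF I l c[OF cc]] .
    have r: "chart_map c1 p \<in> chart_range c1" "chart_map c2 q \<in> chart_range c2"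
      using pq by (auto simp: chart_range_def)
    have v: "in_chart c1 f1 (chart_map c1 p) = f1 p" "in_chart c2 f2 (chart_map c2 q) = f2 q"
      using riemannian_chart_inv_into(3)[OF c(1)[OF cc]] riemannian_chart_inv_into(3)[OF c(2)[OF cc]] pq by auto
    have G: "in_chart (?c c1 c2) (G_map \<gamma> f1 f2) (t, chart_map c1 p, chart_map c2 q) = G_map \<gamma> f1 f2 (t, p, q)"
      using ic[OF cc t r] v by (simp add: G_map_def)
    show ?thesis
      unfolding laplacian_def energy_density_def product_chart_simps G[symmetric]
    proof (rule join_laplacian[OF \<gamma>(1) sm[OF cc] t r])
      show "norm (in_chart c1 f1 (chart_map c1 p)) = 1" "norm (in_chart c2 f2 (chart_map c2 q)) = 1"
        using n[OF cc pq] v by auto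
    qed (use f cc pq v ic in \<open>auto simp: eigenmap_def laplacian_def energy_density_def\<close>)
  qed
  \<comment> \<open>To read off the differential equation at \<open>t\<close> there must be a point
    \<open>(t, p, q)\<close>; nonemptiness of the manifolds provides it.\<close>
  have "topspace X1 \<noteq> {}" "topspace X2 \<noteq> {}"
    "(\<Union>c\<in>A1. chart_dom c) = topspace X1" "(\<Union>c\<in>A2. chart_dom c) = topspace X2"
    using M by (auto simp: riemannian_manifold_def)
  then obtain c1 c2 p q where ne: "c1 \<in> A1" "c2 \<in> A2" "p \<in> chart_dom c1" "q \<in> chart_dom c2" by blast
  show ?thesis
  proof
    assume h: "harmonic_sphere_map (warped_product I l1 l2 A1 A2) (G_map \<gamma> f1 f2)"
    show "\<forall>t\<in>I. join_eq DIM('e1) DIM('e2) d1 d2 l1 l2 I \<gamma> t"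
    proof
      fix t assume t: "t \<in> I"
      have "?c c1 c2 \<in> warped_product I l1 l2 A1 A2" "(t, p, q) \<in> chart_dom (?c c1 c2)"
        using ne t by (auto simp: warped_product_eq product_chart_simps)
      with h key[OF ne t] show "join_eq DIM('e1) DIM('e2) d1 d2 l1 l2 I \<gamma> t"
        unfolding harmonic_sphere_map_def by blast
    qed
  next
    assume "\<forall>t\<in>I. join_eq DIM('e1) DIM('e2) d1 d2 l1 l2 I \<gamma> t"
    then show "harmonic_sphere_map (warped_product I l1 l2 A1 A2) (G_map \<gamma> f1 f2)"
      unfolding harmonic_sphere_map_def using smooth sph key
      by (auto simp: warped_product_eq product_chart_simps simp del: mem_sphere_0)
  qed
qed

section \<open>Functions of two real variables\<close>

lemma ample_Ioo: "0 < \<epsilon> \<Longrightarrow> ample {-\<epsilon><..<\<epsilon>::real}"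
  by (rule ample_open) simp

lemma ample_Icc: "a < b \<Longrightarrow> ample {a..b::real}"
  by (rule ample_interval[of _ a b]) (auto simp: is_interval_cc)

lemma smooth_on_partials:
  fixes f :: "real \<times> real \<Rightarrow> 'b::euclidean_space"
  assumes "smooth_on (U \<times> J) f" "ample U" "ample J"
  obtains f1 f2 where "smooth_on (U \<times> J) f1" "smooth_on (U \<times> J) f2"
    "\<And>r s. r \<in> U \<Longrightarrow> s \<in> J \<Longrightarrow> ((\<lambda>r. f (r, s)) has_vector_derivative f1 (r, s)) (at r within U)"
    "\<And>r s. r \<in> U \<Longrightarrow> s \<in> J \<Longrightarrow> ((\<lambda>s. f (r, s)) has_vector_derivative f2 (r, s)) (at s within J)"
proof -
  obtain f' where f': "\<And>x. x \<in> U \<times> J \<Longrightarrow> (f has_derivative f' x) (at x within U \<times> J)"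
      "\<And>v. smooth_on (U \<times> J) (\<lambda>x. f' x v)"
    by (rule smooth_on_has_derivative[OF assms(1) ample_Times[OF assms(2,3)]]) (rule that)
  show ?thesis
  proof (rule that[of "\<lambda>x. f' x (1, 0)" "\<lambda>x. f' x (0, 1)"])
    fix r s assume rs: "r \<in> U" "s \<in> J"
    note lin = linear_cmul[OF has_derivative_linear[OF f'(1)[of "(r, s)"]]]
    have "((\<lambda>r. (r, s)) has_derivative (\<lambda>h. (h, 0))) (at r within U)"
      by (auto intro!: derivative_eq_intros)
    moreover have "(f has_derivative f' (r, s)) (at (r, s) within (\<lambda>r. (r, s)) ` U)"
      using rs by (intro has_derivative_subset[OF f'(1)]) auto
    ultimately have "((\<lambda>r. f (r, s)) has_derivative (\<lambda>h. f' (r, s) (h, 0))) (at r within U)"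
      using diff_chain_within[of "\<lambda>r. (r, s)" "\<lambda>h. (h, 0)" r U f "f' (r, s)"] by (simp add: o_def)
    then show "((\<lambda>r. f (r, s)) has_vector_derivative f' (r, s) (1, 0)) (at r within U)"
      unfolding has_vector_derivative_def
      by (rule has_derivative_eq_rhs) (use lin[of _ "(1, 0)", symmetric] rs in auto)
    have "((\<lambda>s. (r, s)) has_derivative (\<lambda>h. (0, h))) (at s within J)"
      by (auto intro!: derivative_eq_intros)
    moreover have "(f has_derivative f' (r, s)) (at (r, s) within (\<lambda>s. (r, s)) ` J)"
      using rs by (intro has_derivative_subset[OF f'(1)]) auto
    ultimately have "((\<lambda>s. f (r, s)) has_derivative (\<lambda>h. f' (r, s) (0, h))) (at s within J)"
      using diff_chain_within[of "\<lambda>s. (r, s)" "\<lambda>h. (0, h)" s J f "f' (r, s)"] by (simp add: o_def)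
    then show "((\<lambda>s. f (r, s)) has_vector_derivative f' (r, s) (0, 1)) (at s within J)"
      unfolding has_vector_derivative_def
      by (rule has_derivative_eq_rhs) (use lin[of _ "(0, 1)", symmetric] rs in auto)
  qed (rule f'(2))+
qed

text \<open>Symmetry of mixed derivatives, obtained by differentiating
  \<open>f (r, s) - f (r, a) = \<integral>\<^sub>a\<^sup>s f2 (r, \<sigma>) d\<sigma>\<close> with respect to \<open>r\<close>, so that \<open>s\<close> may be an end point.\<close>

lemma mixed_derivative:
  fixes f :: "real \<times> real \<Rightarrow> 'b::euclidean_space"
  assumes U: "convex U" "ample U" and "r \<in> U" and s: "s \<in> {a..b}"
    and f1: "\<And>r s. r \<in> U \<Longrightarrow> s \<in> {a..b} \<Longrightarrow> ((\<lambda>r. f (r, s)) has_vector_derivative f1 (r, s)) (at r within U)"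
    and f2: "\<And>r s. r \<in> U \<Longrightarrow> s \<in> {a..b} \<Longrightarrow> ((\<lambda>s. f (r, s)) has_vector_derivative f2 (r, s)) (at s within {a..b})"
    and f21: "\<And>r s. r \<in> U \<Longrightarrow> s \<in> {a..b} \<Longrightarrow> ((\<lambda>r. f2 (r, s)) has_vector_derivative f21 (r, s)) (at r within U)"
    and c2: "continuous_on (U \<times> {a..b}) f2" and c21: "continuous_on (U \<times> {a..b}) f21"
  shows "((\<lambda>s. f1 (r, s)) has_vector_derivative f21 (r, s)) (at s within {a..b})"
proof -
  have "f1 (r, x) = f1 (r, a) + integral {a..x} (\<lambda>\<sigma>. f21 (r, \<sigma>))" if x: "x \<in> {a..b}" for x
  proof -
    have i: "((\<lambda>\<sigma>. f2 (r, \<sigma>)) has_integral f (r, x) - f (r, a)) {a..x}" if "r \<in> U" for r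
    proof (rule fundamental_theorem_of_calculus)
      fix y assume "y \<in> {a..x}"
      then show "((\<lambda>s. f (r, s)) has_vector_derivative f2 (r, y)) (at y within {a..x})"
        using x \<open>r \<in> U\<close> by (intro has_vector_derivative_within_subset[OF f2]) auto
    qed (use x in auto)
    \<comment> \<open>The \<open>r\<close>-derivative of \<open>f (r, x) - f (r, a)\<close> is
      computed twice, here under the integral sign and below by \<open>f1\<close>.\<close>
    have "((\<lambda>r. integral (cbox a x) (\<lambda>\<sigma>. f2 (r, \<sigma>))) has_vector_derivative
        integral (cbox a x) (\<lambda>\<sigma>. f21 (r, \<sigma>))) (at r within U)"
    proof (rule leibniz_rule_vector_derivative)
      show "continuous_on (U \<times> cbox a x) (\<lambda>(r, \<sigma>). f21 (r, \<sigma>))"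
        using x by (auto intro!: continuous_on_subset[OF c21])
      show "(\<lambda>\<sigma>. f2 (r, \<sigma>)) integrable_on cbox a x" if "r \<in> U" for r
        using i[OF that] by auto
    qed (use x f21 U \<open>r \<in> U\<close> in auto)
    from this[unfolded box_real] have "((\<lambda>r. f (r, x) - f (r, a)) has_vector_derivative
        integral {a..x} (\<lambda>\<sigma>. f21 (r, \<sigma>))) (at r within U)"
      by (rule has_vector_derivative_transform[rotated 2])
        (use i \<open>r \<in> U\<close> in \<open>auto simp: integral_unique[OF i]\<close>)
    moreover have "((\<lambda>r. f (r, x) - f (r, a)) has_vector_derivative f1 (r, x) - f1 (r, a)) (at r within U)"
      using x \<open>r \<in> U\<close> by (intro has_vector_derivative_diff f1) auto
    ultimately have "integral {a..x} (\<lambda>\<sigma>. f21 (r, \<sigma>)) = f1 (r, x) - f1 (r, a)"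
      using vector_derivative_unique_within[OF ample_not_bot[OF U(2) \<open>r \<in> U\<close>]] by blast
    then show ?thesis by simp
  qed
  moreover have "((\<lambda>x. f1 (r, a) + integral {a..x} (\<lambda>\<sigma>. f21 (r, \<sigma>))) has_vector_derivative f21 (r, s))
      (at s within {a..b})"
  proof -
    have "continuous_on {a..b} (\<lambda>\<sigma>. f21 (r, \<sigma>))"
      using \<open>r \<in> U\<close> by (intro continuous_on_compose2[OF c21] continuous_intros) auto
    from has_vector_derivative_add[OF has_vector_derivative_const integral_has_vector_derivative[OF this s]]
    show ?thesis by simp
  qed
  ultimately show ?thesis by (rule has_vector_derivative_transform[OF s])
qed

lemma has_real_derivative_inner_self:
  assumes "(w has_vector_derivative w') (at r within U)"
  shows "((\<lambda>r. w r \<bullet> w r) has_real_derivative 2 * (w r \<bullet> w')) (at r within U)"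
  using bounded_bilinear.has_vector_derivative[OF bounded_bilinear_inner assms assms]
  by (simp add: has_real_derivative_iff_has_vector_derivative inner_commute)

lemma has_real_derivative_chain_within:
  assumes "(f has_real_derivative f') (at (g x) within T)" "g ` S \<subseteq> T"
    "(g has_real_derivative g') (at x within S)"
  shows "((\<lambda>x. f (g x)) has_real_derivative f' * g') (at x within S)"
  using DERIV_image_chain[OF DERIV_subset[OF assms(1,2)] assms(3)] by (simp add: o_def)

lemma has_vector_derivative_fst:
  "(f has_vector_derivative f') F \<Longrightarrow> ((\<lambda>x. fst (f x)) has_vector_derivative fst f') F"
  by (rule bounded_linear.has_vector_derivative[OF bounded_linear_fst])

lemma has_vector_derivative_snd:
  "(f has_vector_derivative f') F \<Longrightarrow> ((\<lambda>x. snd (f x)) has_vector_derivative snd f') F"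
  by (rule bounded_linear.has_vector_derivative[OF bounded_linear_snd])

section \<open>The first variation of the length\<close>

text \<open>The pointwise computation behind the first variation, with independent slots:
  \<open>f\<close>, \<open>\<alpha>1\<close>, \<open>\<alpha>2\<close> are the coefficients at the
  varied time, \<open>\<tau>\<close> and \<open>w\<close> the time and space velocities in
  \<open>s\<close>, and \<open>z1\<close>, \<open>z2\<close> the components of the varied
  point.\<close>

lemma join_lagrangian_derivative:
  fixes w :: "real \<Rightarrow> 'a::real_inner" and z1 :: "real \<Rightarrow> 'b::real_inner" and z2 :: "real \<Rightarrow> 'c::real_inner"
  assumes "(f has_real_derivative f') (at r within U)" "(\<alpha>1 has_real_derivative \<alpha>1') (at r within U)"
    "(\<alpha>2 has_real_derivative \<alpha>2') (at r within U)" "(\<tau> has_real_derivative \<tau>') (at r within U)"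
    "(w has_vector_derivative w') (at r within U)" "(z1 has_vector_derivative z1') (at r within U)"
    "(z2 has_vector_derivative z2') (at r within U)" "\<tau> r \<noteq> 0"
  shows "((\<lambda>r. f r / (2 * \<tau> r) * (w r \<bullet> w r)
      + (\<alpha>1 r * (z1 r \<bullet> z1 r) + \<alpha>2 r * (z2 r \<bullet> z2 r)) * \<tau> r / 2) has_real_derivative
    f' / (2 * \<tau> r) * (w r \<bullet> w r) - f r * \<tau>' / (2 * (\<tau> r)\<^sup>2) * (w r \<bullet> w r) + f r / \<tau> r * (w r \<bullet> w')
    + (\<alpha>1' * (z1 r \<bullet> z1 r) + \<alpha>2' * (z2 r \<bullet> z2 r)) * \<tau> r / 2
    + (\<alpha>1 r * (z1 r \<bullet> z1') + \<alpha>2 r * (z2 r \<bullet> z2')) * \<tau> r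
    + (\<alpha>1 r * (z1 r \<bullet> z1 r) + \<alpha>2 r * (z2 r \<bullet> z2 r)) * \<tau>' / 2) (at r within U)"
  using assms(8)
  by (auto intro!: derivative_eq_intros assms(1-4) has_real_derivative_inner_self assms(5-7))
    (auto simp: field_simps power2_eq_square)

text \<open>\<open>K\<close> on the cone, with \<open>\<alpha>1\<close>, \<open>\<alpha>2\<close>
  standing for \<open>F\<close> times \<open>\<lambda>_1\<close>, \<open>\<lambda>_2\<close>, and
  inner products in place of norms for differentiation.\<close>

locale join_lagrangian =
  fixes I :: "real set" and F \<alpha>1 \<alpha>2 :: "real \<Rightarrow> real"
    and K :: "(real \<times> complex \<times> complex) \<times> (real \<times> complex \<times> complex) \<Rightarrow> real"
  assumes ample_I: "ample I" and is_interval_I: "is_interval I"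
    and smooth: "smooth_on I F" "smooth_on I \<alpha>1" "smooth_on I \<alpha>2"
    and K: "\<And>t z \<xi> v. t \<in> I \<Longrightarrow> 0 < \<xi> \<Longrightarrow> K ((t, z), (\<xi>, v)) =
      F t / (2 * \<xi>) * (v \<bullet> v) + (\<alpha>1 t * (fst z \<bullet> fst z) + \<alpha>2 t * (snd z \<bullet> snd z)) * \<xi> / 2"
begin

abbreviation "der f t \<equiv> vector_derivative f (at t within I)"

lemma der: "smooth_on I f \<Longrightarrow> t \<in> I \<Longrightarrow> (f has_vector_derivative der f t) (at t within I)"
  using smooth_on_has_vector_derivative[OF _ ample_I] .

lemma der_real:
  fixes f :: "real \<Rightarrow> real"
  shows "smooth_on I f \<Longrightarrow> t \<in> I \<Longrightarrow> (f has_real_derivative der f t) (at t within I)"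
  using der by (simp add: has_real_derivative_iff_has_vector_derivative)

lemma smooth_on_der: "smooth_on I f \<Longrightarrow> smooth_on I (der f)"
  using smooth_on_vector_derivative[OF _ ample_I] .

text \<open>The vector \<open>P\<close> of the overview. It is the unconstrained expression in the
  ambient space; the constraint to the sphere is taken into account by projecting away the direction
  of \<open>\<gamma>\<close>.\<close>

definition euler_lagrange :: "(real \<Rightarrow> complex \<times> complex) \<Rightarrow> real \<Rightarrow> complex \<times> complex" where
  "euler_lagrange \<gamma> t = der F t *\<^sub>R der \<gamma> t + F t *\<^sub>R der (der \<gamma>) t
     - (\<alpha>1 t *\<^sub>R fst (\<gamma> t), \<alpha>2 t *\<^sub>R snd (\<gamma> t))"

text \<open>The length is differentiated in the ambient space, as an unconstrained problem; that the
  varied curves lie on the sphere only yields \<open>\<gamma> s \<bullet> Y s = 0\<close>. The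
  integration by parts is carried out by exhibiting a primitive, the function \<open>H\<close> in
  the proof.\<close>

lemma first_variation:
  assumes \<gamma>: "smooth_on I \<gamma>" and ab: "a < b" "{a..b} \<subseteq> I"
    and \<Phi>: "fixed_end_variation (cone_IS3 I) (\<lambda>t. (t, \<gamma> t)) a b \<epsilon> \<Phi>"
  obtains X Y where
    "\<And>s. s \<in> {a..b} \<Longrightarrow> ((\<lambda>r. \<Phi> r s) has_vector_derivative (X s, Y s)) (at 0)"
    "\<And>s. s \<in> {a..b} \<Longrightarrow> \<gamma> s \<bullet> Y s = 0"
    "((\<lambda>r. finsler_length K a b (\<Phi> r)) has_real_derivative
      - integral {a..b} (\<lambda>s. euler_lagrange \<gamma> s \<bullet> (Y s - X s *\<^sub>R der \<gamma> s))) (at 0)"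
proof -
  define U where "U = {-\<epsilon><..<\<epsilon>}"
  let ?J = "{a..b}"
  let ?\<phi> = "\<lambda>(r, s). \<Phi> r s"
  have \<epsilon>: "0 < \<epsilon>" and smooth_\<Phi>: "smooth_on (U \<times> ?J) ?\<phi>"
    and \<Phi>0: "\<And>s. s \<in> ?J \<Longrightarrow> \<Phi> 0 s = (s, \<gamma> s)"
    and ends: "\<And>r. r \<in> U \<Longrightarrow> \<Phi> r a = (a, \<gamma> a)" "\<And>r. r \<in> U \<Longrightarrow> \<Phi> r b = (b, \<gamma> b)"
    and cone: "\<And>r s. r \<in> U \<Longrightarrow> s \<in> ?J \<Longrightarrow>
       (\<Phi> r s, vector_derivative (\<Phi> r) (at s within ?J)) \<in> cone_IS3 I"
    using \<Phi> unfolding fixed_end_variation_def U_def by auto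
  have U: "0 \<in> U" "open U" "convex U" "ample U" using \<epsilon> by (auto simp: U_def ample_Ioo)
  have J: "ample ?J" using ab by (rule_tac ample_Icc)
  have nb: "at r within U \<noteq> bot" if "r \<in> U" for r using ample_not_bot[OF U(4) that] .
  obtain \<phi>r \<phi>s where smooth_\<phi>: "smooth_on (U \<times> ?J) \<phi>r" "smooth_on (U \<times> ?J) \<phi>s"
    and \<phi>r: "\<And>r s. r \<in> U \<Longrightarrow> s \<in> ?J \<Longrightarrow> ((\<lambda>r. ?\<phi> (r, s)) has_vector_derivative \<phi>r (r, s)) (at r within U)"
    and \<phi>s: "\<And>r s. r \<in> U \<Longrightarrow> s \<in> ?J \<Longrightarrow> ((\<lambda>s. ?\<phi> (r, s)) has_vector_derivative \<phi>s (r, s)) (at s within ?J)"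
    by (rule smooth_on_partials[OF smooth_\<Phi> U(4) J]) (rule that)
  obtain \<phi>sr \<phi>ss where smooth_\<phi>sr: "smooth_on (U \<times> ?J) \<phi>sr" and "smooth_on (U \<times> ?J) \<phi>ss"
    and \<phi>sr: "\<And>r s. r \<in> U \<Longrightarrow> s \<in> ?J \<Longrightarrow> ((\<lambda>r. \<phi>s (r, s)) has_vector_derivative \<phi>sr (r, s)) (at r within U)"
    and "\<And>r s. r \<in> U \<Longrightarrow> s \<in> ?J \<Longrightarrow> ((\<lambda>s. \<phi>s (r, s)) has_vector_derivative \<phi>ss (r, s)) (at s within ?J)"
    by (rule smooth_on_partials[OF smooth_\<phi>(2) U(4) J]) (rule that)
  note cont = smooth_on_imp_continuous_on[OF smooth_\<Phi>] smooth_on_imp_continuous_on[OF smooth_\<phi>(1)]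
    smooth_on_imp_continuous_on[OF smooth_\<phi>(2)] smooth_on_imp_continuous_on[OF smooth_\<phi>sr]
  \<comment> \<open>The integrand derivative \<open>h'\<close> contains the
    \<open>r\<close>-derivative of the velocity. Integration by parts needs it as the
    \<open>s\<close>-derivative of the variation field.\<close>
  have \<phi>rs: "((\<lambda>s. \<phi>r (r, s)) has_vector_derivative \<phi>sr (r, s)) (at s within ?J)"
    if "r \<in> U" "s \<in> ?J" for r s
    using mixed_derivative[OF U(3,4) that \<phi>r \<phi>s \<phi>sr cont(3,4)] .

  have vd: "vector_derivative (\<Phi> r) (at s within ?J) = \<phi>s (r, s)" if "r \<in> U" "s \<in> ?J" for r s
    using vector_derivative_within[OF ample_not_bot[OF J that(2)]] \<phi>s[OF that] by simp
  define T Z Ts Zs where "T q = fst (?\<phi> q)" and "Z q = snd (?\<phi> q)"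
    and "Ts q = fst (\<phi>s q)" and "Zs q = snd (\<phi>s q)" for q
  have C: "T (r, s) \<in> I" "norm (Z (r, s)) = 1" "Z (r, s) \<bullet> Zs (r, s) = 0" "0 < Ts (r, s)"
    if "r \<in> U" "s \<in> ?J" for r s
    using cone[OF that] unfolding vd[OF that] T_def Z_def Ts_def Zs_def
    by (auto simp: cone_IS3_def T_IS3_def)

  define h where "h q = F (T q) / (2 * Ts q) * (Zs q \<bullet> Zs q)
    + (\<alpha>1 (T q) * (fst (Z q) \<bullet> fst (Z q)) + \<alpha>2 (T q) * (snd (Z q) \<bullet> snd (Z q))) * Ts q / 2" for q
  have K_h: "K (\<Phi> r s, vector_derivative (\<Phi> r) (at s within ?J)) = h (r, s)" if "r \<in> U" "s \<in> ?J" for r s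
    using K[OF C(1,4)[OF that], of "Z (r, s)" "Zs (r, s)"]
    unfolding vd[OF that] h_def T_def Z_def Ts_def Zs_def by simp
  define h' where "h' q = der F (T q) * fst (\<phi>r q) / (2 * Ts q) * (Zs q \<bullet> Zs q)
      - F (T q) * fst (\<phi>sr q) / (2 * (Ts q)\<^sup>2) * (Zs q \<bullet> Zs q)
      + F (T q) / Ts q * (Zs q \<bullet> snd (\<phi>sr q))
    + (der \<alpha>1 (T q) * fst (\<phi>r q) * (fst (Z q) \<bullet> fst (Z q))
       + der \<alpha>2 (T q) * fst (\<phi>r q) * (snd (Z q) \<bullet> snd (Z q))) * Ts q / 2
    + (\<alpha>1 (T q) * (fst (Z q) \<bullet> fst (snd (\<phi>r q))) + \<alpha>2 (T q) * (snd (Z q) \<bullet> snd (snd (\<phi>r q)))) * Ts q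
    + (\<alpha>1 (T q) * (fst (Z q) \<bullet> fst (Z q)) + \<alpha>2 (T q) * (snd (Z q) \<bullet> snd (Z q))) * fst (\<phi>sr q) / 2" for q
  have h': "((\<lambda>r. h (r, s)) has_real_derivative h' (r, s)) (at r within U)" if rs: "r \<in> U" "s \<in> ?J" for r s
  proof -
    have dT: "((\<lambda>r. T (r, s)) has_real_derivative fst (\<phi>r (r, s))) (at r within U)"
      using has_vector_derivative_fst[OF \<phi>r[OF rs]]
      by (simp add: has_real_derivative_iff_has_vector_derivative T_def)
    have dTs: "((\<lambda>r. Ts (r, s)) has_real_derivative fst (\<phi>sr (r, s))) (at r within U)"
      using has_vector_derivative_fst[OF \<phi>sr[OF rs]]
      by (simp add: has_real_derivative_iff_has_vector_derivative Ts_def)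
    have dZ: "((\<lambda>r. Z (r, s)) has_vector_derivative snd (\<phi>r (r, s))) (at r within U)"
      using has_vector_derivative_snd[OF \<phi>r[OF rs]] by (simp add: Z_def)
    have dZs: "((\<lambda>r. Zs (r, s)) has_vector_derivative snd (\<phi>sr (r, s))) (at r within U)"
      using has_vector_derivative_snd[OF \<phi>sr[OF rs]] by (simp add: Zs_def)
    \<comment> \<open>The coefficients are differentiable within \<open>I\<close> only, so the chain
      rule needs the varied times to stay in \<open>I\<close>; at an end point of \<open>I\<close>
      this matters.\<close>
    have TI: "(\<lambda>r. T (r, s)) ` U \<subseteq> I" using C(1) rs by auto
    note ch = has_real_derivative_chain_within[OF der_real[OF _ C(1)[OF rs]] TI dT]
    show ?thesis
      unfolding h_def h'_def
      by (rule join_lagrangian_derivative[OF ch[OF smooth(1)] ch[OF smooth(2)] ch[OF smooth(3)] dTs dZs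
          has_vector_derivative_fst[OF dZ] has_vector_derivative_snd[OF dZ]])
        (use C(4)[OF rs] in simp)
  qed
  have cT: "continuous_on (U \<times> ?J) T" "continuous_on (U \<times> ?J) Z"
      "continuous_on (U \<times> ?J) Ts" "continuous_on (U \<times> ?J) Zs"
    unfolding T_def Z_def Ts_def Zs_def by (intro continuous_intros cont)+
  have cI: "continuous_on (U \<times> ?J) (\<lambda>q. f (T q))" if "smooth_on I f" for f :: "real \<Rightarrow> real"
    using smooth_on_imp_continuous_on[OF that] by (rule continuous_on_compose2[OF _ cT(1)]) (use C in auto)
  have Ts0: "Ts q \<noteq> 0" if "q \<in> U \<times> ?J" for q using that C(4) by (cases q) force
  have ch: "continuous_on (U \<times> ?J) h"
    unfolding h_def using Ts0 by (intro continuous_intros cT cI smooth) auto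
  have ch': "continuous_on (U \<times> ?J) h'"
    unfolding h'_def using Ts0 by (intro continuous_intros cT cI cont smooth smooth_on_der) auto
  have leib: "((\<lambda>r. integral (cbox a b) (\<lambda>s. h (r, s))) has_field_derivative
      integral (cbox a b) (\<lambda>s. h' (0, s))) (at 0 within U)"
  proof (rule leibniz_rule_field_derivative)
    show "(\<lambda>s. h (r, s)) integrable_on cbox a b" if "r \<in> U" for r
      using that by (intro integrable_continuous continuous_on_compose2[OF ch] continuous_intros) auto
    show "continuous_on (U \<times> cbox a b) (\<lambda>(r, s). h' (r, s))" using ch' by simp
  qed (use h' U in auto)
  have fl: "finsler_length K a b (\<Phi> r) = integral (cbox a b) (\<lambda>s. h (r, s))" if "r \<in> U" for r
    unfolding finsler_length_def using K_h[OF that] by (auto intro: integral_cong)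
  have len: "((\<lambda>r. finsler_length K a b (\<Phi> r)) has_real_derivative integral ?J (\<lambda>s. h' (0, s))) (at 0)"
    by (rule has_field_derivative_transform_within_open[OF leib[unfolded at_within_open[OF U(1,2)] box_real] U(2,1)])
      (simp add: fl)

  define X Y where "X s = fst (\<phi>r (0, s))" and "Y s = snd (\<phi>r (0, s))" for s
  have XY: "((\<lambda>r. \<Phi> r s) has_vector_derivative (X s, Y s)) (at 0)" if "s \<in> ?J" for s
    using \<phi>r[OF U(1) that] unfolding at_within_open[OF U(1,2)] by (simp add: X_def Y_def)
  have \<gamma>Y: "\<gamma> s \<bullet> Y s = 0" if "s \<in> ?J" for s
  proof -
    have "((\<lambda>r. Z (r, s)) has_vector_derivative Y s) (at 0 within U)"
      using has_vector_derivative_snd[OF \<phi>r[OF U(1) that]] by (simp add: Z_def Y_def)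
    then have "((\<lambda>r. Z (r, s) \<bullet> Z (r, s)) has_real_derivative 2 * (Z (0, s) \<bullet> Y s)) (at 0 within U)"
      by (rule has_real_derivative_inner_self)
    moreover have "((\<lambda>r. Z (r, s) \<bullet> Z (r, s)) has_real_derivative 0) (at 0 within U)"
      by (rule has_field_derivative_transform_within[OF DERIV_const[of 1], of 1])
        (use U(1) C(2) that in \<open>auto simp: power2_norm_eq_inner[symmetric]\<close>)
    ultimately have "2 * (Z (0, s) \<bullet> Y s) = 0"
      unfolding has_real_derivative_iff_has_vector_derivative
      by (rule vector_derivative_unique_within[OF nb[OF U(1)]])
    then show ?thesis using \<Phi>0[OF that] by (simp add: Z_def)
  qed
  have ends0: "X a = 0" "Y a = 0" "X b = 0" "Y b = 0"
  proof -
    have "\<phi>r (0, s) = 0" if s: "s \<in> ?J" and e: "\<And>r. r \<in> U \<Longrightarrow> \<Phi> r s = (s, \<gamma> s)" for s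
    proof -
      have "((\<lambda>r. \<Phi> r s) has_vector_derivative 0) (at 0 within U)"
        using e by (rule has_vector_derivative_transform[OF U(1) _ has_vector_derivative_const])
      with \<phi>r[OF U(1) s, unfolded case_prod_conv] show ?thesis
        by (rule vector_derivative_unique_within[OF nb[OF U(1)]])
    qed
    with ends ab show "X a = 0" "Y a = 0" "X b = 0" "Y b = 0" by (simp_all add: X_def Y_def)
  qed
  define DX DY where "DX s = fst (\<phi>sr (0, s))" and "DY s = snd (\<phi>sr (0, s))" for s
  have dX: "(X has_real_derivative DX s) (at s within ?J)" and dY: "(Y has_vector_derivative DY s) (at s within ?J)"
    if "s \<in> ?J" for s
    using has_vector_derivative_fst[OF \<phi>rs[OF U(1) that]] has_vector_derivative_snd[OF \<phi>rs[OF U(1) that]]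
    by (simp_all add: X_def[abs_def] Y_def[abs_def] DX_def DY_def has_real_derivative_iff_has_vector_derivative)
  \<comment> \<open>The unvaried curve is a graph over its own parameter. Its time velocity is 1,
    which removes all denominators from \<open>h'\<close>.\<close>
  have at0: "T (0, s) = s" "Z (0, s) = \<gamma> s" "Ts (0, s) = 1" "Zs (0, s) = der \<gamma> s" if s: "s \<in> ?J" for s
  proof -
    show "T (0, s) = s" "Z (0, s) = \<gamma> s" using \<Phi>0[OF s] by (simp_all add: T_def Z_def)
    have "((\<lambda>s. (s, \<gamma> s)) has_vector_derivative (1, der \<gamma> s)) (at s within ?J)"
      using s ab by (intro has_vector_derivative_Pair has_vector_derivative_id
          has_vector_derivative_within_subset[OF der[OF \<gamma>]]) auto
    then have "(\<Phi> 0 has_vector_derivative (1, der \<gamma> s)) (at s within ?J)"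
      using s \<Phi>0 by (rule_tac has_vector_derivative_transform[of s ?J "\<Phi> 0" "\<lambda>s. (s, \<gamma> s)"])
    from vector_derivative_within[OF ample_not_bot[OF J s] this]
    have "\<phi>s (0, s) = (1, der \<gamma> s)" using vd[OF U(1) s] by simp
    then show "Ts (0, s) = 1" "Zs (0, s) = der \<gamma> s" by (simp_all add: Ts_def Zs_def)
  qed
  let ?P = "\<lambda>s. euler_lagrange \<gamma> s \<bullet> (Y s - X s *\<^sub>R der \<gamma> s)"
  \<comment> \<open>\<open>H\<close> is the fibre derivative of \<open>K\<close> at
    \<open>(1, \<gamma>')\<close> applied to \<open>(X, Y)\<close>. It vanishes at \<open>a\<close>
    and \<open>b\<close> with \<open>X\<close> and \<open>Y\<close>. The \<open>X\<close>-part of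
    \<open>H' - h'\<close> is \<open>- P \<bullet> \<gamma>'\<close> times \<open>X\<close>, the
    dependence between the two Euler-Lagrange equations that homogeneity forces.\<close>
  define H where "H s = F s * (der \<gamma> s \<bullet> Y s) - F s * (der \<gamma> s \<bullet> der \<gamma> s) * X s / 2
     + (\<alpha>1 s * (fst (\<gamma> s) \<bullet> fst (\<gamma> s)) + \<alpha>2 s * (snd (\<gamma> s) \<bullet> snd (\<gamma> s))) * X s / 2" for s
  have dH: "(H has_real_derivative h' (0, s) + ?P s) (at s within ?J)" if s: "s \<in> ?J" for s
  proof -
    have sI: "s \<in> I" using s ab by auto
    have dF: "(f has_real_derivative der f s) (at s within ?J)" if "smooth_on I f" for f
      using DERIV_subset[OF der_real[OF that sI] ab(2)] .
    have d\<gamma>: "(\<gamma> has_vector_derivative der \<gamma> s) (at s within ?J)"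
      "(der \<gamma> has_vector_derivative der (der \<gamma>) s) (at s within ?J)"
      using has_vector_derivative_within_subset[OF der[OF \<gamma> sI] ab(2)]
        has_vector_derivative_within_subset[OF der[OF smooth_on_der[OF \<gamma>] sI] ab(2)] by auto
    have di: "((\<lambda>s. der \<gamma> s \<bullet> Y s) has_real_derivative der \<gamma> s \<bullet> DY s + der (der \<gamma>) s \<bullet> Y s) (at s within ?J)"
      using bounded_bilinear.has_vector_derivative[OF bounded_bilinear_inner d\<gamma>(2) dY[OF s]]
      by (simp add: has_real_derivative_iff_has_vector_derivative)
    note dn = has_real_derivative_inner_self[OF d\<gamma>(2)]
      has_real_derivative_inner_self[OF has_vector_derivative_fst[OF d\<gamma>(1)]]
      has_real_derivative_inner_self[OF has_vector_derivative_snd[OF d\<gamma>(1)]]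
    show ?thesis
      unfolding H_def
      by (rule DERIV_cong[OF DERIV_add[OF DERIV_diff[OF DERIV_mult[OF dF[OF smooth(1)] di]
            DERIV_cdivide[OF DERIV_mult[OF DERIV_mult[OF dF[OF smooth(1)] dn(1)] dX[OF s]]]]
            DERIV_cdivide[OF DERIV_mult[OF DERIV_add[OF DERIV_mult[OF dF[OF smooth(2)] dn(2)]
              DERIV_mult[OF dF[OF smooth(3)] dn(3)]] dX[OF s]]]]])
        (simp add: h'_def at0[OF s] euler_lagrange_def X_def[symmetric] Y_def[symmetric]
          DX_def[symmetric] DY_def[symmetric] inner_prod_def inner_diff_left inner_diff_right
          inner_add_left inner_add_right inner_commute field_simps)
  qed
  have "((\<lambda>s. h' (0, s) + ?P s) has_integral H b - H a) ?J"
    using ab dH by (intro fundamental_theorem_of_calculus)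
      (auto simp: has_real_derivative_iff_has_vector_derivative[symmetric])
  then have "((\<lambda>s. h' (0, s) + ?P s) has_integral 0) ?J"
    using ends0 by (simp add: H_def)
  moreover have i: "(\<lambda>s. h' (0, s)) integrable_on ?J"
    using U(1) by (intro integrable_continuous_real continuous_on_compose2[OF ch'] continuous_intros) auto
  ultimately have "(?P has_integral 0 - integral ?J (\<lambda>s. h' (0, s))) ?J"
    using has_integral_diff[OF _ integrable_integral[OF i], of "\<lambda>s. h' (0, s) + ?P s" 0] by simp
  then have "integral ?J (\<lambda>s. h' (0, s)) = - integral ?J ?P"
    by (simp add: integral_unique)
  with len XY \<gamma>Y show ?thesis by (intro that[of X Y]) auto
qed

end

section \<open>The geodesic equation\<close>

lemma unit_curve_orthogonal:
  assumes "ample I" "t \<in> I" "\<And>t. t \<in> I \<Longrightarrow> norm (\<gamma> t) = 1"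
    and "(\<gamma> has_vector_derivative v) (at t within I)"
  shows "\<gamma> t \<bullet> v = 0"
proof -
  have "((\<lambda>t. \<gamma> t \<bullet> \<gamma> t) has_real_derivative 2 * (\<gamma> t \<bullet> v)) (at t within I)"
    using assms(4) by (rule has_real_derivative_inner_self)
  moreover have "((\<lambda>t. \<gamma> t \<bullet> \<gamma> t) has_real_derivative 0) (at t within I)"
    by (rule has_field_derivative_transform_within[OF DERIV_const[of 1], of 1])
      (use assms(2,3) in \<open>auto simp: power2_norm_eq_inner[symmetric]\<close>)
  ultimately have "2 * (\<gamma> t \<bullet> v) = 0"
    unfolding has_real_derivative_iff_has_vector_derivative
    by (rule vector_derivative_unique_within[OF ample_not_bot[OF assms(1,2)]])
  then show ?thesis by simp
qed

lemma mem_T_IS3: "((t, z), (\<xi>, v)) \<in> T_IS3 I \<longleftrightarrow> t \<in> I \<and> norm z = 1 \<and> z \<bullet> v = 0"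
  unfolding T_IS3_def by (cases z; cases v) auto

lemma mem_cone_IS3: "((t, z), (\<xi>, v)) \<in> cone_IS3 I \<longleftrightarrow> t \<in> I \<and> norm z = 1 \<and> z \<bullet> v = 0 \<and> 0 < \<xi>"
proof -
  have "((t, z), (\<xi>, v)) \<in> cone_IS3 I \<longleftrightarrow> ((t, z), (\<xi>, v)) \<in> T_IS3 I \<and> 0 < \<xi>"
    unfolding cone_IS3_def by (cases z; cases v) auto
  then show ?thesis by (auto simp: mem_T_IS3)
qed

lemma ample_interval_obtains:
  fixes I :: "real set"
  assumes "ample I" "is_interval I" "t \<in> I"
  obtains a b where "a < b" "{a..b} \<subseteq> I" "t \<in> {a..b}"
proof -
  have "\<exists>d. 0 < \<bar>d\<bar> \<and> \<bar>d\<bar> < 1 \<and> t + d *\<^sub>R 1 \<in> I"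
    using assms(1,3) unfolding ample_def by simp
  then obtain d where d: "d \<noteq> 0" "t + d \<in> I" by auto
  have "{min t (t + d)..max t (t + d)} \<subseteq> I"
  proof
    fix x assume "x \<in> {min t (t + d)..max t (t + d)}"
    then show "x \<in> I"
      using mem_is_interval_1_I[OF assms(2), of "min t (t + d)" "max t (t + d)" x] d assms(3)
      by (cases "0 < d") auto
  qed
  with d show ?thesis by (intro that[of "min t (t + d)" "max t (t + d)"]) auto
qed

text \<open>A curve in the unit sphere with initial velocity \<open>2w\<close>, for \<open>w\<close> orthogonal to \<open>z\<close>
  (inverse stereographic projection of the line through \<open>w\<close>). It is rational
  in \<open>r\<close>, so that no square root has to be differentiated.\<close>

definition sphere_push :: "'a::real_inner \<Rightarrow> 'a \<Rightarrow> real \<Rightarrow> 'a" where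
  "sphere_push z w r = inverse (1 + r\<^sup>2 * (w \<bullet> w)) *\<^sub>R ((1 - r\<^sup>2 * (w \<bullet> w)) *\<^sub>R z + (2 * r) *\<^sub>R w)"

lemma sphere_push_denominator: "0 < 1 + r\<^sup>2 * (w \<bullet> w)"
  by (intro add_pos_nonneg) auto

lemma norm_sphere_push:
  assumes "norm z = 1" "z \<bullet> w = 0" shows "norm (sphere_push z w r) = 1"
proof -
  define q where "q = r\<^sup>2 * (w \<bullet> w)"
  have q: "0 < 1 + q" unfolding q_def by (rule sphere_push_denominator)
  have "z \<bullet> z = 1" using assms(1) by (simp add: power2_norm_eq_inner[symmetric])
  then have "((1 - q) *\<^sub>R z + (2 * r) *\<^sub>R w) \<bullet> ((1 - q) *\<^sub>R z + (2 * r) *\<^sub>R w) = (1 - q)\<^sup>2 + 4 * q"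
    using assms(2) by (simp add: inner_add_left inner_add_right inner_commute[of w z] q_def power2_eq_square)
  also have "\<dots> = (1 + q)\<^sup>2" by (simp add: power2_eq_square algebra_simps)
  finally have "(norm ((1 - q) *\<^sub>R z + (2 * r) *\<^sub>R w))\<^sup>2 = (1 + q)\<^sup>2"
    by (simp add: power2_norm_eq_inner)
  then have "norm ((1 - q) *\<^sub>R z + (2 * r) *\<^sub>R w) = 1 + q"
    using q by (metis norm_ge_zero less_imp_le power2_eq_imp_eq)
  then show ?thesis using q unfolding sphere_push_def q_def[symmetric] by simp
qed

lemma sphere_push_derivative:
  "((sphere_push z w) has_vector_derivative 2 *\<^sub>R w) (at 0)"
proof -
  have 1: "((\<lambda>r. inverse (1 + r\<^sup>2 * (w \<bullet> w))) has_real_derivative 0) (at 0)"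
    and 2: "((\<lambda>r. 1 - r\<^sup>2 * (w \<bullet> w)) has_real_derivative 0) (at 0)"
    and 3: "((\<lambda>r. 2 * r) has_real_derivative 2) (at (0::real))"
    by (auto intro!: derivative_eq_intros)
  from has_vector_derivative_scaleR[OF 1 has_vector_derivative_add[OF
      has_vector_derivative_scaleR[OF 2 has_vector_derivative_const[of z]]
      has_vector_derivative_scaleR[OF 3 has_vector_derivative_const[of w]]]]
  show ?thesis by (simp add: sphere_push_def[abs_def])
qed

context join_lagrangian
begin

lemma smooth_on_euler_lagrange: "smooth_on I \<gamma> \<Longrightarrow> smooth_on I (euler_lagrange \<gamma>)"
  unfolding euler_lagrange_def
  by (intro smooth_on_diff smooth_on_add smooth_on_scaleR smooth_on_Pair smooth_on_der smooth
      smooth_on_linear_compose[OF _ bounded_linear_fst] smooth_on_linear_compose[OF _ bounded_linear_snd])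

lemma graph_in_cone:
  assumes "smooth_on I \<gamma>" "\<gamma> ` I \<subseteq> sphere 0 1" "t \<in> I"
  shows "((t, \<gamma> t), vector_derivative (\<lambda>t. (t, \<gamma> t)) (at t within I)) \<in> cone_IS3 I"
proof -
  have "vector_derivative (\<lambda>t. (t, \<gamma> t)) (at t within I) = (1, der \<gamma> t)"
    using assms by (intro vector_derivative_within[OF ample_not_bot[OF ample_I]]
        has_vector_derivative_Pair has_vector_derivative_id der)
  moreover have "\<gamma> t \<bullet> der \<gamma> t = 0"
    using assms by (intro unit_curve_orthogonal[OF ample_I] der) auto
  ultimately show ?thesis using assms by (auto simp: mem_cone_IS3)
qed

text \<open>The condition says that \<open>P\<close> has no tangential part. For the converse a
  single test variation on each interval suffices, because its variation field is a nonnegative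
  weight times that tangential part.\<close>

lemma geodesic_iff:
  assumes \<gamma>: "smooth_on I \<gamma>" "\<gamma> ` I \<subseteq> sphere 0 1"
  shows "unparametrized_geodesic (cone_IS3 I) K I (\<lambda>t. (t, \<gamma> t)) \<longleftrightarrow>
    (\<forall>t\<in>I. euler_lagrange \<gamma> t = (euler_lagrange \<gamma> t \<bullet> \<gamma> t) *\<^sub>R \<gamma> t)"
proof
  assume eq: "\<forall>t\<in>I. euler_lagrange \<gamma> t = (euler_lagrange \<gamma> t \<bullet> \<gamma> t) *\<^sub>R \<gamma> t"
  have smooth_graph: "smooth_on I (\<lambda>t. (t, \<gamma> t))"
    by (intro smooth_on_Pair \<gamma>(1) smooth_on_bounded_linear[OF bounded_linear_ident])
  show "unparametrized_geodesic (cone_IS3 I) K I (\<lambda>t. (t, \<gamma> t))"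
    unfolding unparametrized_geodesic_def
  proof (intro conjI smooth_graph ballI allI impI graph_in_cone \<gamma>)
    fix a b \<epsilon> \<Phi>
    assume ab: "a < b" "{a..b} \<subseteq> I" and \<Phi>: "fixed_end_variation (cone_IS3 I) (\<lambda>t. (t, \<gamma> t)) a b \<epsilon> \<Phi>"
    obtain X Y where Y: "\<And>s. s \<in> {a..b} \<Longrightarrow> \<gamma> s \<bullet> Y s = 0"
      and D: "((\<lambda>r. finsler_length K a b (\<Phi> r)) has_real_derivative
      - integral {a..b} (\<lambda>s. euler_lagrange \<gamma> s \<bullet> (Y s - X s *\<^sub>R der \<gamma> s))) (at 0)"
      by (rule first_variation[OF \<gamma>(1) ab \<Phi>]) (rule that)
    \<comment> \<open>\<open>P\<close> is parallel to \<open>\<gamma>\<close>, while both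
      \<open>Y\<close> and \<open>\<gamma>'\<close> are orthogonal to
      \<open>\<gamma>\<close>.\<close>
    have "integral {a..b} (\<lambda>s. euler_lagrange \<gamma> s \<bullet> (Y s - X s *\<^sub>R der \<gamma> s)) = integral {a..b} (\<lambda>s. 0)"
    proof (rule integral_cong)
      fix s assume s: "s \<in> {a..b}"
      then have sI: "s \<in> I" using ab by auto
      have "\<gamma> s \<bullet> der \<gamma> s = 0"
        using \<gamma> sI by (intro unit_curve_orthogonal[OF ample_I] der) auto
      then have "\<gamma> s \<bullet> (Y s - X s *\<^sub>R der \<gamma> s) = 0"
        using Y[OF s] by (simp add: inner_diff_right)
      then show "euler_lagrange \<gamma> s \<bullet> (Y s - X s *\<^sub>R der \<gamma> s) = 0"
        using bspec[OF eq sI] by (metis inner_scaleR_left mult_zero_right)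
    qed
    with D show "((\<lambda>r. finsler_length K a b (\<Phi> r)) has_real_derivative 0) (at 0)" by simp
  qed
next
  assume geo: "unparametrized_geodesic (cone_IS3 I) K I (\<lambda>t. (t, \<gamma> t))"
  define P where "P = euler_lagrange \<gamma>"
  define E where "E t = P t - (P t \<bullet> \<gamma> t) *\<^sub>R \<gamma> t" for t
  have smooth_E: "smooth_on I E"
    unfolding E_def P_def
    by (intro smooth_on_diff smooth_on_scaleR smooth_on_inner smooth_on_euler_lagrange \<gamma>)
  have n\<gamma>: "norm (\<gamma> t) = 1" if "t \<in> I" for t using \<gamma>(2) that by auto
  have E_orth: "\<gamma> t \<bullet> E t = 0" "P t \<bullet> E t = E t \<bullet> E t" if "t \<in> I" for t
  proof -
    have "\<gamma> t \<bullet> \<gamma> t = 1" using n\<gamma>[OF that] by (simp add: power2_norm_eq_inner[symmetric])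
    then show orth: "\<gamma> t \<bullet> E t = 0" by (simp add: E_def inner_diff_right inner_commute)
    have "E t \<bullet> E t = P t \<bullet> E t - (P t \<bullet> \<gamma> t) * (\<gamma> t \<bullet> E t)"
      unfolding E_def by (simp only: inner_diff_left inner_scaleR_left)
    with orth show "P t \<bullet> E t = E t \<bullet> E t" by simp
  qed
  show "\<forall>t\<in>I. euler_lagrange \<gamma> t = (euler_lagrange \<gamma> t \<bullet> \<gamma> t) *\<^sub>R \<gamma> t"
  proof
    fix t assume t: "t \<in> I"
    obtain a b where ab: "a < b" "{a..b} \<subseteq> I" "t \<in> {a..b}"
      by (rule ample_interval_obtains[OF ample_I is_interval_I t])
    let ?J = "{a..b}"
    \<comment> \<open>The weight vanishes at both ends, which fixes them, and is positive between.
      The variation field is \<open>2 w\<close>, twice this, because \<open>sphere_push\<close> has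
      initial velocity \<open>2 w\<close>.\<close>
    define w where "w s = ((s - a) * (b - s)) *\<^sub>R E s" for s
    define \<Phi> where "\<Phi> r s = (s, sphere_push (\<gamma> s) (w s) r)" for r s
    have w_orth: "\<gamma> s \<bullet> w s = 0" if "s \<in> ?J" for s
      using E_orth(1)[of s] ab that by (auto simp: w_def)
    have n\<Phi>: "norm (snd (\<Phi> r s)) = 1" if "s \<in> ?J" for r s
      using norm_sphere_push[OF n\<gamma> w_orth[OF that]] ab that by (auto simp: \<Phi>_def)
    have smooth_w: "smooth_on ?J w"
      unfolding w_def
      by (intro smooth_on_scaleR smooth_on_mult smooth_on_diff smooth_on_const smooth_on_subset[OF smooth_E ab(2)]
          smooth_on_bounded_linear bounded_linear_ident)
    let ?Q = "{-1<..<1::real} \<times> ?J"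
    have proj: "smooth_on ?Q (\<lambda>q. f (snd q))" if "smooth_on ?J f" for f :: "real \<Rightarrow> 'z::euclidean_space"
      by (rule smooth_on_compose_linear[OF that bounded_linear_snd]) auto
    have "smooth_on ?Q (\<lambda>q. \<Phi> (fst q) (snd q))"
      unfolding \<Phi>_def sphere_push_def
      by (intro smooth_on_Pair smooth_on_scaleR smooth_on_inverse smooth_on_add smooth_on_diff smooth_on_mult
          smooth_on_power smooth_on_inner proj smooth_w smooth_on_subset[OF \<gamma>(1) ab(2)] smooth_on_const
          smooth_on_bounded_linear bounded_linear_fst bounded_linear_snd)
        (metis less_irrefl sphere_push_denominator)
    then have smooth_\<Phi>: "smooth_on ?Q (\<lambda>(r, s). \<Phi> r s)" by (simp add: case_prod_unfold)
    \<comment> \<open>Times are not varied, so the time velocity is constantly 1 and positive; the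
      space velocity is tangent because the pushed curve stays on the unit sphere.\<close>
    have cone: "(\<Phi> r s, vector_derivative (\<Phi> r) (at s within ?J)) \<in> cone_IS3 I"
      if r: "r \<in> {-1<..<1}" and s: "s \<in> ?J" for r s
    proof -
      obtain \<phi>r \<phi>s where "smooth_on ?Q \<phi>r" "smooth_on ?Q \<phi>s"
        and "\<And>r s. r \<in> {-1<..<1} \<Longrightarrow> s \<in> ?J \<Longrightarrow>
          ((\<lambda>r. (\<lambda>(r, s). \<Phi> r s) (r, s)) has_vector_derivative \<phi>r (r, s)) (at r within {-1<..<1})"
        and \<phi>s: "\<And>r s. r \<in> {-1<..<1} \<Longrightarrow> s \<in> ?J \<Longrightarrow>
          ((\<lambda>s. (\<lambda>(r, s). \<Phi> r s) (r, s)) has_vector_derivative \<phi>s (r, s)) (at s within ?J)"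
        by (rule smooth_on_partials[OF smooth_\<Phi> ample_Ioo[OF zero_less_one] ample_Icc[OF ab(1)]]) (rule that)
      have d: "(\<Phi> r has_vector_derivative \<phi>s (r, s)) (at s within ?J)" using \<phi>s[OF r s] by simp
      have "fst (\<phi>s (r, s)) = 1"
        using has_vector_derivative_fst[OF d] unfolding \<Phi>_def fst_conv
        by (rule vector_derivative_unique_within[OF ample_not_bot[OF ample_Icc[OF ab(1)] s]])
          (rule has_vector_derivative_id)
      moreover have "snd (\<Phi> r s) \<bullet> snd (\<phi>s (r, s)) = 0"
        using has_vector_derivative_snd[OF d] n\<Phi> s
        by (intro unit_curve_orthogonal[OF ample_Icc[OF ab(1)]])
      moreover have "vector_derivative (\<Phi> r) (at s within ?J) = \<phi>s (r, s)"
        using vector_derivative_within[OF ample_not_bot[OF ample_Icc[OF ab(1)] s] d] .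
      moreover have "s \<in> I" using s ab by auto
      ultimately show ?thesis using n\<Phi>[OF s, of r]
        by (cases "\<phi>s (r, s)") (auto simp: mem_cone_IS3 \<Phi>_def)
    qed
    \<comment> \<open>The bound 1 on the parameter is an arbitrary choice:
      \<open>sphere_push\<close> is defined for every real \<open>r\<close>, its denominator being
      positive.\<close>
    have \<Phi>: "fixed_end_variation (cone_IS3 I) (\<lambda>t. (t, \<gamma> t)) a b 1 \<Phi>"
      unfolding fixed_end_variation_def
    proof (intro conjI smooth_\<Phi> ballI cone)
      show "\<Phi> 0 s = (s, \<gamma> s)" "\<Phi> r a = (a, \<gamma> a)" "\<Phi> r b = (b, \<gamma> b)" for r s
        by (simp_all add: \<Phi>_def sphere_push_def w_def)
    qed simp_all
    obtain X Y where XY: "\<And>s. s \<in> ?J \<Longrightarrow> ((\<lambda>r. \<Phi> r s) has_vector_derivative (X s, Y s)) (at 0)"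
      and D: "((\<lambda>r. finsler_length K a b (\<Phi> r)) has_real_derivative
      - integral ?J (\<lambda>s. euler_lagrange \<gamma> s \<bullet> (Y s - X s *\<^sub>R der \<gamma> s))) (at 0)"
      by (rule first_variation[OF \<gamma>(1) ab(1,2) \<Phi>]) (rule that)
    have XY': "X s = 0" "Y s = 2 *\<^sub>R w s" if "s \<in> ?J" for s
    proof -
      have "((\<lambda>r. \<Phi> r s) has_vector_derivative (0, 2 *\<^sub>R w s)) (at 0)"
        unfolding \<Phi>_def by (intro has_vector_derivative_Pair has_vector_derivative_const sphere_push_derivative)
      with XY[OF that] have "(X s, Y s) = (0, 2 *\<^sub>R w s)" by (rule vector_derivative_unique_at)
      then show "X s = 0" "Y s = 2 *\<^sub>R w s" by auto
    qed
    have "((\<lambda>r. finsler_length K a b (\<Phi> r)) has_real_derivative 0) (at 0)"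
      using geo ab \<Phi> unfolding unparametrized_geodesic_def by blast
    from DERIV_unique[OF D[folded P_def] this]
    have "integral ?J (\<lambda>s. P s \<bullet> (Y s - X s *\<^sub>R der \<gamma> s)) = 0" by simp
    also have "integral ?J (\<lambda>s. P s \<bullet> (Y s - X s *\<^sub>R der \<gamma> s))
        = integral ?J (\<lambda>s. 2 * ((s - a) * (b - s) * (E s \<bullet> E s)))"
    proof (rule integral_cong)
      fix s assume s: "s \<in> ?J"
      then have "s \<in> I" using ab by auto
      then show "P s \<bullet> (Y s - X s *\<^sub>R der \<gamma> s) = 2 * ((s - a) * (b - s) * (E s \<bullet> E s))"
        using XY'[OF s] E_orth(2)[of s] by (simp add: w_def)
    qed
    finally have "integral ?J (\<lambda>s. 2 * ((s - a) * (b - s) * (E s \<bullet> E s))) = 0" .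
    moreover have cE: "continuous_on ?J E"
      using smooth_on_imp_continuous_on[OF smooth_E] ab(2) by (rule continuous_on_subset)
    \<comment> \<open>The integrand is continuous and nonnegative with integral zero, hence vanishes
      identically.\<close>
    ultimately have "\<forall>s\<in>?J. 2 * ((s - a) * (b - s) * (E s \<bullet> E s)) = 0"
      using ab(1) by (subst (asm) integral_eq_0_iff) (auto intro!: continuous_intros)
    then have E0: "E s = 0" if "s \<in> {a<..<b}" for s using that by auto
    \<comment> \<open>\<open>t\<close> may be an end point of the interval, where the weight
      vanishes and gives no information; continuity of \<open>E\<close> settles it.\<close>
    have "E t = 0"
      by (rule continuous_constant_on_closure[of "{a<..<b}" E 0]) (use cE E0 ab in auto)
    then show "euler_lagrange \<gamma> t = (euler_lagrange \<gamma> t \<bullet> \<gamma> t) *\<^sub>R \<gamma> t"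
      by (simp add: E_def P_def)
  qed
qed

end

section \<open>The conic Finsler metric\<close>

text \<open>Strong convexity is tested on lines. There \<open>K''\<close> is nonnegative and
  vanishes only in the radial direction, in which homogeneity makes \<open>K'\<close> a nonzero
  multiple of \<open>K\<close>. Hence \<open>K'^2 + K K''\<close> is positive in every nonzero
  direction.\<close>

lemma conic_finsler_K_metric:
  assumes F: "smooth_on I F" "\<And>t. t \<in> I \<Longrightarrow> 0 < F t"
    and \<mu>: "smooth_on I \<mu>1" "smooth_on I \<mu>2" "\<And>t. t \<in> I \<Longrightarrow> 0 < \<mu>1 t" "\<And>t. t \<in> I \<Longrightarrow> 0 < \<mu>2 t"
    and V: "\<And>t z. V t z = (\<mu>1 t * (cmod (fst z))\<^sup>2 + \<mu>2 t * (cmod (snd z))\<^sup>2) / 2"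
  shows "conic_finsler_metric (T_IS3 I) (cone_IS3 I) (K_metric F V)"
    and "strongly_convex (T_IS3 I) (cone_IS3 I) (K_metric F V)"
proof -
  have V_pos: "0 < V t z" if "t \<in> I" "norm z = 1" for t z
  proof -
    have "fst z \<noteq> 0 \<or> snd z \<noteq> 0" using that(2) by (metis fst_zero snd_zero prod_eqI norm_zero zero_neq_one)
    moreover have "0 \<le> \<mu>1 t * (cmod (fst z))\<^sup>2" "0 \<le> \<mu>2 t * (cmod (snd z))\<^sup>2"
      using \<mu>(3,4)[OF that(1)] by simp_all
    moreover have "fst z \<noteq> 0 \<Longrightarrow> 0 < \<mu>1 t * (cmod (fst z))\<^sup>2" "snd z \<noteq> 0 \<Longrightarrow> 0 < \<mu>2 t * (cmod (snd z))\<^sup>2"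
      using \<mu>(3,4)[OF that(1)] by simp_all
    ultimately show ?thesis unfolding V by (smt (verit) divide_pos_pos)
  qed
  have K_pos: "0 < K_metric F V ((t, z), (\<xi>, v))" if "t \<in> I" "norm z = 1" "0 < \<xi>" for t z \<xi> v
    using F(2)[OF that(1)] V_pos[OF that(1,2)] that(3)
    by (auto simp: K_metric_def intro!: mult_pos_pos divide_pos_pos add_nonneg_pos)
  show "conic_finsler_metric (T_IS3 I) (cone_IS3 I) (K_metric F V)"
    unfolding conic_finsler_metric_def
  proof (intro conjI allI impI)
    have "cone_IS3 I = T_IS3 I \<inter> {p. 0 < fst (snd p)}"
      by (auto simp: mem_T_IS3 mem_cone_IS3)
    moreover have "open {p :: (real \<times> complex \<times> complex) \<times> (real \<times> complex \<times> complex). 0 < fst (snd p)}"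
      by (intro open_Collect_less continuous_intros)
    ultimately show "openin (top_of_set (T_IS3 I)) (cone_IS3 I)" by (auto simp: openin_open)
  next
    fix p :: "real \<times> complex \<times> complex"
    obtain t z where p: "p = (t, z)" by (cases p)
    show "convex {v. (p, v) \<in> cone_IS3 I}"
    proof (rule convexI)
      fix x y :: "real \<times> complex \<times> complex" and u w :: real
      assume xy: "x \<in> {v. (p, v) \<in> cone_IS3 I}" "y \<in> {v. (p, v) \<in> cone_IS3 I}"
        and uw: "0 \<le> u" "0 \<le> w" "u + w = 1"
      obtain \<xi> v where x: "x = (\<xi>, v)" by (cases x)
      obtain \<eta> v' where y: "y = (\<eta>, v')" by (cases y)
      have "0 < \<xi>" "0 < \<eta>" using xy by (auto simp: p x y mem_cone_IS3)
      then have "0 < u * \<xi> + w * \<eta>"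
        using uw by (cases "u = 0") (auto intro: add_pos_nonneg)
      with xy show "u *\<^sub>R x + w *\<^sub>R y \<in> {v. (p, v) \<in> cone_IS3 I}"
        by (auto simp: p x y mem_cone_IS3 inner_add_right)
    qed
  next
    fix p v :: "real \<times> complex \<times> complex" and r :: real
    assume "(p, v) \<in> cone_IS3 I" "0 < r"
    moreover obtain t z \<xi> w where "p = (t, z)" "v = (\<xi>, w)" by (cases p; cases v)
    ultimately show "(p, r *\<^sub>R v) \<in> cone_IS3 I" by (simp add: mem_cone_IS3)
  next
    have sq: "(norm x)\<^sup>2 = x \<bullet> x" for x :: "'z::real_inner" by (rule power2_norm_eq_inner)
    note proj = bounded_linear_compose[OF bounded_linear_fst bounded_linear_fst]
      bounded_linear_compose[OF bounded_linear_snd bounded_linear_fst]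
      bounded_linear_compose[OF bounded_linear_fst bounded_linear_snd]
      bounded_linear_compose[OF bounded_linear_snd bounded_linear_snd]
    have t: "smooth_on (cone_IS3 I) (\<lambda>p. f (fst (fst p)))" if "smooth_on I f" for f :: "real \<Rightarrow> real"
      by (rule smooth_on_compose_linear[OF that proj(1)]) (auto simp: mem_cone_IS3)
    have "smooth_on (cone_IS3 I) (\<lambda>p. F (fst (fst p)) / (2 * fst (snd p)) * (snd (snd p) \<bullet> snd (snd p)
        + (\<mu>1 (fst (fst p)) * (fst (snd (fst p)) \<bullet> fst (snd (fst p)))
           + \<mu>2 (fst (fst p)) * (snd (snd (fst p)) \<bullet> snd (snd (fst p)))) * (fst (snd p))\<^sup>2))"
      by (intro smooth_on_mult smooth_on_divide smooth_on_add smooth_on_inner smooth_on_power t F(1) \<mu>(1,2)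
          smooth_on_const smooth_on_linear_compose[OF _ bounded_linear_fst]
          smooth_on_linear_compose[OF _ bounded_linear_snd] smooth_on_bounded_linear bounded_linear_ident)
        (auto simp: mem_cone_IS3)
    then show "smooth_on (cone_IS3 I) (K_metric F V)"
      by (rule smooth_on_cong) (auto simp: K_metric_def V sq)
  next
    fix p v :: "real \<times> complex \<times> complex"
    assume "(p, v) \<in> cone_IS3 I"
    then show "0 < K_metric F V (p, v)"
      by (cases p; cases v) (simp add: mem_cone_IS3 K_pos)
  next
    fix p v :: "real \<times> complex \<times> complex" and r :: real
    assume "(p, v) \<in> cone_IS3 I" "0 < r"
    moreover obtain t z \<xi> w where "p = (t, z)" "v = (\<xi>, w)" by (cases p; cases v)
    ultimately show "K_metric F V (p, r *\<^sub>R v) = r * K_metric F V (p, v)"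
      by (simp add: mem_cone_IS3 K_metric_def field_simps power2_eq_square)
  qed
  show "strongly_convex (T_IS3 I) (cone_IS3 I) (K_metric F V)"
    unfolding strongly_convex_def
  proof (intro allI impI)
    fix p v w :: "real \<times> complex \<times> complex"
    assume C: "(p, v) \<in> cone_IS3 I" and w0: "w \<noteq> 0"
    obtain t z where p: "p = (t, z)" by (cases p)
    obtain \<xi> v' where v: "v = (\<xi>, v')" by (cases v)
    obtain \<eta> \<omega> where w: "w = (\<eta>, \<omega>)" by (cases w)
    have t: "t \<in> I" "norm z = 1" and \<xi>: "0 < \<xi>" using C by (auto simp: p v mem_cone_IS3)
    define m where "m = F t / 2"
    define a b c W where "a = v' \<bullet> v'" and "b = v' \<bullet> \<omega>" and "c = \<omega> \<bullet> \<omega>" and "W = 2 * V t z"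
    define k where "k x = m * ((a + 2 * b * x + c * x\<^sup>2) / (\<xi> + x * \<eta>) + W * (\<xi> + x * \<eta>))" for x
    define k1 where "k1 x = m * ((2 * b + 2 * c * x) / (\<xi> + x * \<eta>)
      - (a + 2 * b * x + c * x\<^sup>2) * \<eta> / (\<xi> + x * \<eta>)\<^sup>2 + W * \<eta>)" for x
    define k2 where "k2 = 2 * m / \<xi> ^ 3 * ((\<xi> *\<^sub>R \<omega> - \<eta> *\<^sub>R v') \<bullet> (\<xi> *\<^sub>R \<omega> - \<eta> *\<^sub>R v'))"
    have m: "0 < m" and W: "0 < W" using F(2)[OF t(1)] V_pos[OF t] by (simp_all add: m_def W_def)
    have K_k: "K_metric F V (p, v + x *\<^sub>R w) = k x" if "\<xi> + x * \<eta> \<noteq> 0" for x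
    proof -
      have n: "(norm (v' + x *\<^sub>R \<omega>))\<^sup>2 = a + 2 * b * x + c * x\<^sup>2"
        unfolding power2_norm_eq_inner
        by (simp add: a_def b_def c_def inner_add_left inner_add_right inner_commute power2_eq_square algebra_simps)
      show ?thesis
        unfolding p v w K_metric_def k_def m_def W_def using that
        by (simp add: n) (simp add: field_simps power2_eq_square)
    qed
    have dk: "(k has_real_derivative k1 x) (at x)" if "\<xi> + x * \<eta> \<noteq> 0" for x
    proof -
      have n: "((\<lambda>x. a + 2 * b * x + c * x\<^sup>2) has_real_derivative 2 * b + 2 * c * x) (at x)"
        and y: "((\<lambda>x. \<xi> + x * \<eta>) has_real_derivative \<eta>) (at x)"
        by (auto intro!: derivative_eq_intros)
      have *: "(n' * y - n * \<eta>) / (y * y) = n' / y - n * \<eta> / y\<^sup>2" if "y \<noteq> 0" for n n' y :: real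
        using that by (simp add: field_simps power2_eq_square)
      show ?thesis
        unfolding k_def[abs_def] k1_def
        by (rule DERIV_cong[OF DERIV_cmult[OF DERIV_add[OF DERIV_divide[OF n y that] DERIV_cmult[OF y]]]])
          (simp only: *[OF that])
    qed
    have dk1: "(k1 has_real_derivative k2) (at 0)"
      unfolding k1_def k2_def using \<xi>
      by (auto intro!: derivative_eq_intros)
        (simp add: a_def b_def c_def inner_diff_left inner_diff_right inner_commute field_simps
          power2_eq_square power3_eq_cube power4_eq_xxxx)
    \<comment> \<open>The derivative formulas for \<open>k\<close> are available only where the
      denominator is nonzero. As \<open>\<xi>\<close> is positive this holds near 0, and
      \<open>deriv\<close> depends only on values nearby.\<close>
    have ev: "\<forall>\<^sub>F r in nhds 0. \<xi> + r * \<eta> \<noteq> 0"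
    proof -
      have "open {r. \<xi> + r * \<eta> \<noteq> 0}" by (intro open_Collect_neq continuous_intros)
      from eventually_nhds_in_open[OF this, of 0] \<xi> show ?thesis by simp
    qed
    \<comment> \<open>Both directions of the Hessian equal \<open>w\<close>, so the inner derivative
      is that of \<open>k^2 / 2\<close> at the shifted parameter \<open>r\<close>, and the nested
      derivatives become a second derivative in one variable.\<close>
    have inner_deriv: "deriv (\<lambda>s. (K_metric F V (p, v + r *\<^sub>R w + s *\<^sub>R w))\<^sup>2 / 2) 0 = k r * k1 r"
      if r: "\<xi> + r * \<eta> \<noteq> 0" for r
    proof -
      have "open {s. \<xi> + (r + s) * \<eta> \<noteq> 0}" by (intro open_Collect_neq continuous_intros)
      from eventually_nhds_in_open[OF this, of 0] r
      have ev': "\<forall>\<^sub>F s in nhds 0. \<xi> + (r + s) * \<eta> \<noteq> 0" by simp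
      have "\<forall>\<^sub>F s in nhds 0. (K_metric F V (p, v + r *\<^sub>R w + s *\<^sub>R w))\<^sup>2 / 2 = (k (r + s))\<^sup>2 / 2"
        using ev' by eventually_elim (simp add: K_k[symmetric] scaleR_left_distrib add.assoc)
      then have "deriv (\<lambda>s. (K_metric F V (p, v + r *\<^sub>R w + s *\<^sub>R w))\<^sup>2 / 2) 0 = deriv (\<lambda>s. (k (r + s))\<^sup>2 / 2) 0"
        by (rule deriv_cong_ev) simp
      also have "\<dots> = k r * k1 r"
      proof (rule DERIV_imp_deriv)
        have "((\<lambda>s. k (r + s)) has_real_derivative k1 r) (at 0)"
          using dk[OF r] DERIV_shift[of k "k1 r" 0 r] by (simp add: add.commute)
        then show "((\<lambda>s. (k (r + s))\<^sup>2 / 2) has_real_derivative k r * k1 r) (at 0)"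
          by (auto intro!: derivative_eq_intros)
      qed
      finally show ?thesis .
    qed
    have "hessian (\<lambda>u. (K_metric F V (p, u))\<^sup>2 / 2) v w w = deriv (\<lambda>r. k r * k1 r) 0"
      unfolding hessian_def using ev
      by (intro deriv_cong_ev) (auto elim!: eventually_mono simp: inner_deriv)
    also have "\<dots> = k1 0 * k1 0 + k 0 * k2"
      by (rule DERIV_imp_deriv) (use \<xi> in \<open>auto intro!: derivative_eq_intros dk dk1\<close>)
    also have "\<dots> > 0"
    proof -
      have k0: "0 < k 0" using K_k[of 0] K_pos[OF t \<xi>, of v'] \<xi> by (simp add: p v)
      have "0 \<le> k2" using m \<xi> by (auto simp: k2_def)
      show ?thesis
      \<comment> \<open>Equality means that \<open>w\<close> is \<open>\<eta> / \<xi>\<close> times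
        \<open>v\<close>, the radial direction.\<close>
      proof (cases "\<xi> *\<^sub>R \<omega> = \<eta> *\<^sub>R v'")
        case False
        then have "0 < (\<xi> *\<^sub>R \<omega> - \<eta> *\<^sub>R v') \<bullet> (\<xi> *\<^sub>R \<omega> - \<eta> *\<^sub>R v')" by (subst inner_gt_zero_iff) simp
        then have "0 < k2" using m \<xi> unfolding k2_def by (intro mult_pos_pos divide_pos_pos) auto
        with k0 show ?thesis by (intro add_nonneg_pos mult_pos_pos) auto
      next
        case True
        then have "(1 / \<xi>) *\<^sub>R \<xi> *\<^sub>R \<omega> = (1 / \<xi>) *\<^sub>R \<eta> *\<^sub>R v'" by simp
        then have \<omega>: "\<omega> = (\<eta> / \<xi>) *\<^sub>R v'" using \<xi> by simp
        have "\<eta> \<noteq> 0" using w0 \<omega> by (auto simp: w zero_prod_def)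
        have "k1 0 = m * \<eta> * (a / \<xi>\<^sup>2 + W)"
          using \<xi> by (simp add: k1_def b_def \<omega> a_def field_simps power2_eq_square)
        moreover have "0 < a / \<xi>\<^sup>2 + W" using W by (intro add_nonneg_pos) (auto simp: a_def)
        ultimately have "k1 0 \<noteq> 0" using m \<open>\<eta> \<noteq> 0\<close> by simp
        then have "0 < k1 0 * k1 0" by (metis not_square_less_zero linorder_neqE_linordered_idom mult_eq_0_iff)
        with k0 \<open>0 \<le> k2\<close> show ?thesis by (intro add_pos_nonneg) auto
      qed
    qed
    finally show "0 < hessian (\<lambda>u. (K_metric F V (p, u))\<^sup>2 / 2) v w w" .
  qed
qed

section \<open>Comparison of the two equations\<close>

lemma warp_density_derivative:
  assumes "(l1 has_real_derivative l1') (at t within I)" "(l2 has_real_derivative l2') (at t within I)"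
    and "0 < l1 t" "0 < l2 t"
  shows "(warp_density k1 k2 l1 l2 has_real_derivative
    warp_density k1 k2 l1 l2 t * (k1 * l1' / l1 t + k2 * l2' / l2 t)) (at t within I)"
proof -
  \<comment> \<open>For \<open>k = 0\<close> the truncated exponent is harmless, since the factor
    \<open>k\<close> kills the term.\<close>
  have p: "real k * (D * l ^ (k - Suc 0)) = l ^ k * (k * D / l)" if "0 < l" for l D :: real and k
    using that by (cases k) auto
  show ?thesis
    unfolding warp_density_def[abs_def]
    by (rule DERIV_cong[OF DERIV_mult[OF DERIV_power[OF assms(1)] DERIV_power[OF assms(2)]]])
      (simp only: p[OF assms(3)] p[OF assms(4)], simp add: algebra_simps)
qed

context join_lagrangian
begin

text \<open>\<open>P = F B\<close>, where \<open>B\<close> is the left side of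
  \<open>join_eq\<close> without its last term. Since \<open>\<gamma> \<bullet> B = - e\<close> for
  every curve on the sphere, \<open>P\<close> is normal exactly if \<open>B = - e \<gamma>\<close>;
  the positive factor \<open>F\<close> cancels.\<close>

lemma euler_lagrange_iff_join_eq:
  assumes l: "smooth_on I l1" "smooth_on I l2" "\<And>t. t \<in> I \<Longrightarrow> 0 < l1 t" "\<And>t. t \<in> I \<Longrightarrow> 0 < l2 t"
    and F: "F = warp_density k1 k2 l1 l2"
    and \<alpha>: "\<And>t. \<alpha>1 t = F t * (d1 / (l1 t)\<^sup>2)" "\<And>t. \<alpha>2 t = F t * (d2 / (l2 t)\<^sup>2)"
    and \<gamma>: "smooth_on I \<gamma>" "\<gamma> ` I \<subseteq> sphere 0 1" and t: "t \<in> I"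
  shows "euler_lagrange \<gamma> t = (euler_lagrange \<gamma> t \<bullet> \<gamma> t) *\<^sub>R \<gamma> t \<longleftrightarrow>
    join_eq k1 k2 d1 d2 l1 l2 I \<gamma> t"
proof -
  define \<mu> where "\<mu> = k1 * der l1 t / l1 t + k2 * der l2 t / l2 t"
  define \<Lambda> where "\<Lambda> = ((d1 / (l1 t)\<^sup>2) *\<^sub>R fst (\<gamma> t), (d2 / (l2 t)\<^sup>2) *\<^sub>R snd (\<gamma> t))"
  define e where "e = (norm (der \<gamma> t))\<^sup>2 + 2 * potential d1 d2 l1 l2 t (\<gamma> t)"
  define B where "B = der (der \<gamma>) t + \<mu> *\<^sub>R der \<gamma> t - \<Lambda>"
  have F0: "0 < F t" using l(3,4)[OF t] by (simp add: F warp_density_def)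
  have "(F has_real_derivative F t * \<mu>) (at t within I)"
    unfolding F \<mu>_def using l t by (intro warp_density_derivative der_real) auto
  then have dF: "der F t = F t * \<mu>"
    by (intro vector_derivative_within[OF ample_not_bot[OF ample_I t]])
      (simp add: has_real_derivative_iff_has_vector_derivative)
  have P: "euler_lagrange \<gamma> t = F t *\<^sub>R B"
    unfolding euler_lagrange_def dF B_def \<Lambda>_def \<alpha> by (simp add: algebra_simps)
  have n: "norm (\<gamma> t) = 1" if "t \<in> I" for t using \<gamma>(2) that by auto
  have n1: "\<gamma> t \<bullet> \<gamma> t = 1" using n[OF t] by (simp add: power2_norm_eq_inner[symmetric])
  have orth: "\<gamma> t \<bullet> der \<gamma> t = 0" if "t \<in> I" for t
    using n \<gamma>(1) that by (intro unit_curve_orthogonal[OF ample_I] der) auto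
  \<comment> \<open>The product \<open>\<gamma> \<bullet> \<gamma>'\<close> vanishes on all of
    \<open>I\<close>, so it may be differentiated once more, also at an end point.\<close>
  have "((\<lambda>t. \<gamma> t \<bullet> der \<gamma> t) has_vector_derivative \<gamma> t \<bullet> der (der \<gamma>) t + der \<gamma> t \<bullet> der \<gamma> t) (at t within I)"
    by (rule bounded_bilinear.has_vector_derivative[OF bounded_bilinear_inner der[OF \<gamma>(1) t]
        der[OF smooth_on_der[OF \<gamma>(1)] t]])
  moreover have "((\<lambda>t. \<gamma> t \<bullet> der \<gamma> t) has_vector_derivative 0) (at t within I)"
    using orth by (rule has_vector_derivative_transform[OF t _ has_vector_derivative_const])
  ultimately have "\<gamma> t \<bullet> der (der \<gamma>) t + der \<gamma> t \<bullet> der \<gamma> t = 0"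
    by (rule vector_derivative_unique_within[OF ample_not_bot[OF ample_I t]])
  moreover have "\<gamma> t \<bullet> \<Lambda> = 2 * potential d1 d2 l1 l2 t (\<gamma> t)"
    by (simp add: \<Lambda>_def potential_def inner_prod_def power2_norm_eq_inner mult_ac)
  ultimately have "\<gamma> t \<bullet> B = - e"
    unfolding B_def e_def power2_norm_eq_inner
    by (simp only: inner_diff_right inner_add_right inner_scaleR_right orth[OF t])
  then have "euler_lagrange \<gamma> t = (euler_lagrange \<gamma> t \<bullet> \<gamma> t) *\<^sub>R \<gamma> t \<longleftrightarrow> F t *\<^sub>R B = F t *\<^sub>R (- e *\<^sub>R \<gamma> t)"
    unfolding P by (simp add: inner_commute)
  also have "\<dots> \<longleftrightarrow> B + e *\<^sub>R \<gamma> t = 0"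
    using F0 by (subst scaleR_cancel_left) (simp add: eq_neg_iff_add_eq_0)
  finally show ?thesis
    unfolding join_eq_def B_def \<mu>_def \<Lambda>_def e_def .
qed

end

theorem theoremA:
  fixes X1 :: "'m1 topology" and A1 :: "('m1, real^'k1) rchart set"
    and X2 :: "'m2 topology" and A2 :: "('m2, real^'k2) rchart set"
    and f1 :: "'m1 \<Rightarrow> complex^'n1" and f2 :: "'m2 \<Rightarrow> complex^'n2"
    and d1 d2 :: real
    and I :: "real set" and l1 l2 :: "real \<Rightarrow> real"
    and F :: "real \<Rightarrow> real" and V :: "real \<Rightarrow> complex \<times> complex \<Rightarrow> real"
    and K :: "(real \<times> complex \<times> complex) \<times> (real \<times> complex \<times> complex) \<Rightarrow> real"
  assumes "riemannian_manifold X1 A1" and "riemannian_manifold X2 A2"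
    and "eigenmap A1 d1 f1" and "eigenmap A2 d2 f2"
    and "is_interval I" and "interior I \<noteq> {}"
    and "smooth_on I l1" and "\<And>t. t \<in> I \<Longrightarrow> 0 < l1 t"
    and "smooth_on I l2" and "\<And>t. t \<in> I \<Longrightarrow> 0 < l2 t"
  defines "F \<equiv> warp_density CARD('k1) CARD('k2) l1 l2"
    and "V \<equiv> potential d1 d2 l1 l2"
    and "K \<equiv> K_metric F V"
  shows "conic_finsler_metric (T_IS3 I) (cone_IS3 I) K \<and>
    strongly_convex (T_IS3 I) (cone_IS3 I) K \<and>
    (\<forall>\<gamma>. smooth_on I \<gamma> \<longrightarrow> \<gamma> ` I \<subseteq> sphere 0 1 \<longrightarrow>
       (harmonic_sphere_map (warped_product I l1 l2 A1 A2) (G_map \<gamma> f1 f2) \<longleftrightarrow>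
        unparametrized_geodesic (cone_IS3 I) K I (\<lambda>t. (t, \<gamma> t))))"
proof -
  have d: "0 < d1" "0 < d2" using assms(3,4) by (auto simp: eigenmap_def)
  \<comment> \<open>Nonempty interior gives two distinct points of the interval, and hence
    well-defined derivatives within \<open>I\<close>.\<close>
  obtain x where "x \<in> interior I" using assms(6) by blast
  then obtain r where "r > 0" "ball x r \<subseteq> I" by (meson mem_interior)
  then have "x \<in> I" "x + r / 2 \<in> I" by (auto simp: subset_iff dist_real_def)
  with \<open>r > 0\<close> have ample: "ample I"
    using assms(5) by (intro ample_interval[of I x "x + r / 2"]) auto
  have F: "smooth_on I F" "\<And>t. t \<in> I \<Longrightarrow> 0 < F t"
    using assms(7-10) unfolding F_def warp_density_def[abs_def]
    by (auto intro!: smooth_on_mult smooth_on_power)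
  define \<mu>1 \<mu>2 where "\<mu>1 t = d1 / (l1 t)\<^sup>2" and "\<mu>2 t = d2 / (l2 t)\<^sup>2" for t
  have l0: "l1 t \<noteq> 0" "l2 t \<noteq> 0" if "t \<in> I" for t using assms(8,10)[OF that] by auto
  have \<mu>: "smooth_on I \<mu>1" "smooth_on I \<mu>2"
    unfolding \<mu>1_def[abs_def] \<mu>2_def[abs_def]
    by (intro smooth_on_divide smooth_on_power smooth_on_const assms(7,9); simp add: l0)+
  have \<mu>_pos: "0 < \<mu>1 t" "0 < \<mu>2 t" if "t \<in> I" for t
    using d l0[OF that] by (auto simp: \<mu>1_def \<mu>2_def)
  have V: "V t z = (\<mu>1 t * (cmod (fst z))\<^sup>2 + \<mu>2 t * (cmod (snd z))\<^sup>2) / 2" for t z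
    by (simp add: V_def potential_def \<mu>1_def \<mu>2_def)
  interpret join_lagrangian I F "\<lambda>t. F t * \<mu>1 t" "\<lambda>t. F t * \<mu>2 t" K
  proof
    fix t \<xi> :: real and z v :: "complex \<times> complex"
    assume "0 < \<xi>"
    then show "K ((t, z), (\<xi>, v)) = F t / (2 * \<xi>) * (v \<bullet> v)
        + (F t * \<mu>1 t * (fst z \<bullet> fst z) + F t * \<mu>2 t * (snd z \<bullet> snd z)) * \<xi> / 2"
      unfolding K_def K_metric_def V power2_norm_eq_inner by (simp add: field_simps power2_eq_square)
  qed (use ample assms(5) F \<mu> in \<open>auto intro: smooth_on_mult\<close>)
  have "harmonic_sphere_map (warped_product I l1 l2 A1 A2) (G_map \<gamma> f1 f2) \<longleftrightarrow>
        unparametrized_geodesic (cone_IS3 I) K I (\<lambda>t. (t, \<gamma> t))"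
    if \<gamma>: "smooth_on I \<gamma>" "\<gamma> ` I \<subseteq> sphere 0 1" for \<gamma>
  proof -
    have "harmonic_sphere_map (warped_product I l1 l2 A1 A2) (G_map \<gamma> f1 f2) \<longleftrightarrow>
      (\<forall>t\<in>I. join_eq CARD('k1) CARD('k2) d1 d2 l1 l2 I \<gamma> t)"
      using harmonic_join_iff[OF assms(1-4) ample assms(7-10) \<gamma>] by simp
    also have "\<dots> \<longleftrightarrow> (\<forall>t\<in>I. euler_lagrange \<gamma> t = (euler_lagrange \<gamma> t \<bullet> \<gamma> t) *\<^sub>R \<gamma> t)"
      using euler_lagrange_iff_join_eq[OF assms(7,9,8,10) meta_eq_to_obj_eq[OF F_def], of d1 d2 \<gamma>] \<gamma>
      by (simp add: \<mu>1_def \<mu>2_def)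
    also have "\<dots> \<longleftrightarrow> unparametrized_geodesic (cone_IS3 I) K I (\<lambda>t. (t, \<gamma> t))"
      using geodesic_iff[OF \<gamma>] by simp
    finally show ?thesis .
  qed
  with conic_finsler_K_metric[OF F \<mu> \<mu>_pos V] show ?thesis by (simp add: K_def)
qed

end
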